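(* Let $X$ be a path connected metric space and $x\in X$. The following hold: (1) If $X$ is locally path connected then the Spanier group $\pi_1^s(X, x)$ is equal to the shape kernel, and in particular is closed. (2) If $X$ is compact then $\pi_1^s(X, x)$ is analytic.
   Context: Closed and analytic subgroups: $L_x$ is the set of loops $[0,1]\to X$ based at $x$ with the sup metric. For $G\leq\pi_1(X,x)$, $\bigcup G\subseteq L_x$ is the set of all loops whose homotopy class lies in $G$; $G$ is closed (analytic) if $\bigcup G$ is closed (analytic) in $L_x$. A subset of a Polish (separable completely metrizable) space is analytic if it is a continuous image of a Polish space; $L_x$ is Polish when $X$ is. Spanier group: for an open cover $\mathcal{U}$ of $X$, $\pi_1(\mathcal{U},x)$ is the subgroup of $\pi_1(X,x)$ generated by the classes of loops of the form $\rho*l*\rho^{-1}$, where $\rho$ is a path with $\rho(0)=x$ and $l$ is a loop based at $\rho(1)$ with image contained in some element of $\mathcal{U}$. Then $\pi_1^s(X,x)=\bigcap_{\mathcal{U}}\pi_1(\mathcal{U},x)$ over all open covers $\mathcal{U}$ of $X$. Shape kernel: for an open cover $\mathcal{U}$ of $X$, the nerve $N(\mathcal{U})$ is the geometric simplicial complex with a distinct vertex $v_U$ for each $U\in\mathcal{U}$, and with $[v_{U_0},\ldots,v_{U_n}]$ a simplex iff $U_0\cap\cdots\cap U_n\neq\emptyset$. Consider pairs $(\mathcal{U},U)$ with $\mathcal{U}$ an open cover and $U\in\mathcal{U}$ a distinguished element containing $x$. If $\mathcal{V}$ refines $\mathcal{U}$, with distinguished elements $V\subseteq U$, then a vertex assignment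 $v_{V'}\mapsto v_{U'}$ with $V'\subseteq U'$ and with $v_V\mapsto v_U$ extends to a simplicial map $p_{(\mathcal{V},V),(\mathcal{U},U)}:(N(\mathcal{V}),v_V)\to(N(\mathcal{U}),v_U)$, unique up to basepoint preserving homotopy. The shape group is the inverse limit $\check{\pi}_1(X,x)=\varprojlim(\pi_1(N(\mathcal{U}),v_U),p_{(\mathcal{V},V),(\mathcal{U},U)*})$ over the pairs directed by refinement. Since $X$ is paracompact Hausdorff, the pairs $(\mathcal{V},V)$ for which $V$ is the unique element of $\mathcal{V}$ containing $x$ are cofinal. For such a pair, a partition of unity $\{\rho_{V'}\}_{V'\in\mathcal{V}}$ subordinate to $\mathcal{V}$ gives a barycentric map $(X,x)\to(N(\mathcal{V}),v_V)$, $z\mapsto\sum_{V'}\rho_{V'}(z)v_{V'}$, unique up to based homotopy. The homomorphisms induced by these maps are compatible with the inverse system and define a homomorphism $\Psi:\pi_1(X,x)\to\check{\pi}_1(X,x)$. The shape kernel is $\ker(\Psi)$. *)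

theory Defs
  imports
    "HOL-Analysis.Analysis"
    "HOL-Algebra.Generated_Groups"
    "HOL-Algebra.Product_Groups"
begin

section \<open>Fundamental groups\<close>

text \<open>
  Spaces are abstract topologies \<open>T\<close>, because nerves below carry the weak topology, which is
  not the topology of any type-class instance. The sort \<open>topological_space\<close> is required only by
  the library's path operations \<open>+++\<close>, \<open>reversepath\<close>, etc.; the class topology plays no role.

  A loop is represented by a unique function, with the value \<open>undefined\<close> outside \<open>{0..1}\<close>.
  Hence an element of the fundamental group is literally a set of loops, and \<open>\<Union>G\<close> is the set of
  all loops whose class lies in \<open>G\<close>.
\<close>

definition loops :: "'a::topological_space topology \<Rightarrow> 'a \<Rightarrow> (real \<Rightarrow> 'a) set" where
  "loops T x = {p \<in> extensional {0..1}. pathin T p \<and> pathstart p = x \<and> pathfinish p = x}"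

definition homotopic_loops_at ::
    "'a::topological_space topology \<Rightarrow> 'a \<Rightarrow> (real \<Rightarrow> 'a) \<Rightarrow> (real \<Rightarrow> 'a) \<Rightarrow> bool" where
  "homotopic_loops_at T x =
     homotopic_with (\<lambda>r. pathstart r = x \<and> pathfinish r = x) (top_of_set {0..1}) T"

text \<open>The argument \<open>p\<close> need not be extensional: only its values on \<open>{0..1}\<close> matter.\<close>

definition loop_class ::
    "'a::topological_space topology \<Rightarrow> 'a \<Rightarrow> (real \<Rightarrow> 'a) \<Rightarrow> (real \<Rightarrow> 'a) set" where
  "loop_class T x p = {q \<in> loops T x. homotopic_loops_at T x p q}"

text \<open>
  Operations on classes are defined as unions over all representatives; since the result does not
  depend on the representatives, these unions are single classes.
\<close>

definition fundamental_group ::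
    "'a::topological_space topology \<Rightarrow> 'a \<Rightarrow> (real \<Rightarrow> 'a) set monoid" where
  "fundamental_group T x =
     \<lparr>carrier = loop_class T x ` loops T x,
      mult = (\<lambda>A B. \<Union>p\<in>A. \<Union>q\<in>B. loop_class T x (p +++ q)),
      one = loop_class T x (\<lambda>t. x)\<rparr>"

definition induced_hom ::
    "'b::topological_space topology \<Rightarrow> 'b \<Rightarrow> ('a \<Rightarrow> 'b) \<Rightarrow> (real \<Rightarrow> 'a) set \<Rightarrow> (real \<Rightarrow> 'b) set" where
  "induced_hom T y f A = (\<Union>p\<in>A. loop_class T y (f \<circ> p))"

lemma homotopic_loops_at_top_of_set:
  assumes "pathstart p = x" "pathfinish p = x"
  shows "homotopic_loops_at (top_of_set S) x p q \<longleftrightarrow> homotopic_paths S p q"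
  using assms by (simp add: homotopic_loops_at_def homotopic_paths_def)


section \<open>The space of loops; closed and analytic subgroups\<close>

definition loop_metric :: "'a::metric_space set \<Rightarrow> 'a \<Rightarrow> (real \<Rightarrow> 'a) metric" where
  "loop_metric X x =
     submetric (cfunspace (top_of_set {0..1}) (submetric euclidean_metric X)) (loops (top_of_set X) x)"

definition closed_in_pi1 :: "'a::metric_space set \<Rightarrow> 'a \<Rightarrow> (real \<Rightarrow> 'a) set set \<Rightarrow> bool" where
  "closed_in_pi1 X x G \<longleftrightarrow> closedin (mtopology_of (loop_metric X x)) (\<Union>G)"

definition Polish_space :: "'a topology \<Rightarrow> bool" where
  "Polish_space T \<longleftrightarrow> completely_metrizable_space T \<and> separable_space T"

text \<open>
  Every Polish space is homeomorphic to a subspace of the countable product of real lines, so it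
  is no restriction to let the source of the parametrisation range over the Polish topologies on
  subsets of the type \<open>nat \<Rightarrow> real\<close>.
\<close>

definition analytic_in :: "'a topology \<Rightarrow> 'a set \<Rightarrow> bool" where
  "analytic_in T A \<longleftrightarrow>
     (\<exists>(P :: (nat \<Rightarrow> real) topology) f. Polish_space P \<and> continuous_map P T f \<and> f ` topspace P = A)"

definition analytic_in_pi1 :: "'a::metric_space set \<Rightarrow> 'a \<Rightarrow> (real \<Rightarrow> 'a) set set \<Rightarrow> bool" where
  "analytic_in_pi1 X x G \<longleftrightarrow> analytic_in (mtopology_of (loop_metric X x)) (\<Union>G)"

lemma mspace_loop_metric: "mspace (loop_metric X x) = loops (top_of_set X) x"
proof -
  let ?I = "top_of_set {0..1::real}" and ?m = "submetric euclidean_metric X"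
  have top: "mtopology_of ?m = top_of_set X"
    by (simp add: mtopology_of_submetric)
  have "compactin ?I (topspace ?I)"
    by (simp add: compactin_subtopology)
  then have "mspace (cfunspace ?I ?m) =
      {f. (\<forall>x\<in>topspace ?I. f x \<in> mspace ?m) \<and> f \<in> extensional (topspace ?I) \<and>
          continuous_map ?I (mtopology_of ?m) f}"
    by (rule compactin_mspace_cfunspace)
  then have "loops (top_of_set X) x \<subseteq> mspace (cfunspace ?I ?m)"
    unfolding top loops_def pathin_def
    by (auto simp del: mspace_cfunspace simp: Pi_iff)
  then show ?thesis
    by (auto simp: loop_metric_def simp del: mspace_cfunspace)
qed

lemma mdist_loop_metric:
  assumes "p \<in> loops (top_of_set X) x" "q \<in> loops (top_of_set X) x"
  shows "mdist (loop_metric X x) p q = (SUP t\<in>{0..1}. dist (p t) (q t))"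
proof -
  interpret Metric_space X dist
    by unfold_locales (auto simp: dist_commute dist_triangle)
  let ?c = "cfunspace (top_of_set {0..1::real}) (submetric euclidean_metric X)"
  have "p \<in> mspace ?c" "q \<in> mspace ?c"
    using assms unfolding mspace_loop_metric [symmetric]
    by (auto simp: loop_metric_def simp del: mspace_cfunspace)
  then have "p \<in> fspace {0..1}" "q \<in> fspace {0..1}"
    by (auto simp: fspace_def)
  then show ?thesis
    by (simp add: loop_metric_def mdist_cfunspace_eq_mdist_funspace fdist_def)
qed


section \<open>Open covers and the Spanier group\<close>

definition open_cover :: "'a topology \<Rightarrow> 'a set set \<Rightarrow> bool" where
  "open_cover T \<U> \<longleftrightarrow> (\<forall>U\<in>\<U>. openin T U) \<and> \<Union>\<U> = topspace T"

definition spanier_generators ::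
    "'a::topological_space topology \<Rightarrow> 'a \<Rightarrow> 'a set set \<Rightarrow> (real \<Rightarrow> 'a) set set" where
  "spanier_generators T x \<U> =
     {loop_class T x (\<rho> +++ l +++ reversepath \<rho>) | \<rho> l.
        pathin T \<rho> \<and> pathstart \<rho> = x \<and> l \<in> loops T (pathfinish \<rho>) \<and> (\<exists>U\<in>\<U>. path_image l \<subseteq> U)}"

definition spanier_group_cover ::
    "'a::topological_space topology \<Rightarrow> 'a \<Rightarrow> 'a set set \<Rightarrow> (real \<Rightarrow> 'a) set set" where
  "spanier_group_cover T x \<U> = generate (fundamental_group T x) (spanier_generators T x \<U>)"

definition spanier_group :: "'a::topological_space topology \<Rightarrow> 'a \<Rightarrow> (real \<Rightarrow> 'a) set set" where
  "spanier_group T x = (\<Inter>\<U>\<in>{\<U>. open_cover T \<U>}. spanier_group_cover T x \<U>)"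


section \<open>Geometric realizations and nerves\<close>

text \<open>
  An abstract simplicial complex is given by its set \<open>K\<close> of simplices (finite nonempty sets of
  vertices). Points of the realization are given by their barycentric coordinates. The closed
  simplices carry the Euclidean topology, and the realization the weak topology they determine.
\<close>

definition closed_simplex :: "'v set \<Rightarrow> ('v \<Rightarrow> real) set" where
  "closed_simplex \<sigma> = {b. (\<forall>v. 0 \<le> b v) \<and> (\<forall>v. v \<notin> \<sigma> \<longrightarrow> b v = 0) \<and> (\<Sum>v\<in>\<sigma>. b v) = 1}"

definition realization :: "'v set set \<Rightarrow> ('v \<Rightarrow> real) topology" where
  "realization K =
     topology (\<lambda>W. W \<subseteq> (\<Union>\<sigma>\<in>K. closed_simplex \<sigma>) \<and>
                   (\<forall>\<sigma>\<in>K. openin (top_of_set (closed_simplex \<sigma>)) (W \<inter> closed_simplex \<sigma>)))"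

lemma openin_realization:
  "openin (realization K) W \<longleftrightarrow>
     W \<subseteq> (\<Union>\<sigma>\<in>K. closed_simplex \<sigma>) \<and>
     (\<forall>\<sigma>\<in>K. openin (top_of_set (closed_simplex \<sigma>)) (W \<inter> closed_simplex \<sigma>))"
proof -
  have "istopology (\<lambda>W. W \<subseteq> (\<Union>\<sigma>\<in>K. closed_simplex \<sigma>) \<and>
                   (\<forall>\<sigma>\<in>K. openin (top_of_set (closed_simplex \<sigma>)) (W \<inter> closed_simplex \<sigma>)))"
    unfolding istopology_def
  proof (intro conjI allI impI; (elim conjE)?)
    fix S S' :: "('a \<Rightarrow> real) set"
    assume "\<forall>\<sigma>\<in>K. openin (top_of_set (closed_simplex \<sigma>)) (S \<inter> closed_simplex \<sigma>)"
      and "\<forall>\<sigma>\<in>K. openin (top_of_set (closed_simplex \<sigma>)) (S' \<inter> closed_simplex \<sigma>)"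
    moreover have "S \<inter> S' \<inter> C = (S \<inter> C) \<inter> (S' \<inter> C)" for C by blast
    ultimately show "\<forall>\<sigma>\<in>K. openin (top_of_set (closed_simplex \<sigma>)) (S \<inter> S' \<inter> closed_simplex \<sigma>)"
      by (metis openin_Int)
  next
    fix \<W> :: "('a \<Rightarrow> real) set set"
    assume *: "\<forall>W\<in>\<W>. W \<subseteq> (\<Union>\<sigma>\<in>K. closed_simplex \<sigma>) \<and>
                   (\<forall>\<sigma>\<in>K. openin (top_of_set (closed_simplex \<sigma>)) (W \<inter> closed_simplex \<sigma>))"
    show "\<Union>\<W> \<subseteq> (\<Union>\<sigma>\<in>K. closed_simplex \<sigma>)"
      using * by blast
    have "\<Union>\<W> \<inter> C = (\<Union>W\<in>\<W>. W \<inter> C)" for C by blast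
    then show "\<forall>\<sigma>\<in>K. openin (top_of_set (closed_simplex \<sigma>)) (\<Union>\<W> \<inter> closed_simplex \<sigma>)"
      using * by (metis (no_types, lifting) imageE openin_Union)
  qed auto
  then show ?thesis
    by (simp add: realization_def topology_inverse')
qed

definition nerve_simplices :: "'a set set \<Rightarrow> 'a set set set" where
  "nerve_simplices \<U> = {\<sigma>. \<sigma> \<subseteq> \<U> \<and> finite \<sigma> \<and> \<sigma> \<noteq> {} \<and> \<Inter>\<sigma> \<noteq> {}}"

definition nerve :: "'a set set \<Rightarrow> ('a set \<Rightarrow> real) topology" where
  "nerve \<U> = realization (nerve_simplices \<U>)"

definition vertex :: "'v \<Rightarrow> 'v \<Rightarrow> real" where
  "vertex v = indicat_real {v}"

definition simplicial_map :: "('v \<Rightarrow> 'w) \<Rightarrow> ('v \<Rightarrow> real) \<Rightarrow> ('w \<Rightarrow> real)" where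
  "simplicial_map f b = (\<lambda>w. \<Sum>v | b v \<noteq> 0 \<and> f v = w. b v)"


section \<open>The shape group and the shape kernel\<close>

definition pointed_covers :: "'a topology \<Rightarrow> 'a \<Rightarrow> ('a set set \<times> 'a set) set" where
  "pointed_covers T x = {(\<U>, U). open_cover T \<U> \<and> U \<in> \<U> \<and> x \<in> U}"

definition refines :: "'a set set \<times> 'a set \<Rightarrow> 'a set set \<times> 'a set \<Rightarrow> bool" where
  "refines = (\<lambda>(\<V>, V) (\<U>, U). (\<forall>V'\<in>\<V>. \<exists>U'\<in>\<U>. V' \<subseteq> U') \<and> V \<subseteq> U)"

definition nerve_group ::
    "'a set set \<times> 'a set \<Rightarrow> (real \<Rightarrow> 'a set \<Rightarrow> real) set monoid" where
  "nerve_group = (\<lambda>(\<U>, U). fundamental_group (nerve \<U>) (vertex U))"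

definition vertex_assignment ::
    "'a set set \<times> 'a set \<Rightarrow> 'a set set \<times> 'a set \<Rightarrow> ('a set \<Rightarrow> 'a set) \<Rightarrow> bool" where
  "vertex_assignment =
     (\<lambda>(\<V>, V) (\<U>, U) f. (\<forall>V'\<in>\<V>. f V' \<in> \<U> \<and> V' \<subseteq> f V') \<and> f V = U)"

text \<open>
  The bonding map and, below, the barycentric map are unique only up to based homotopy. One is
  picked by \<open>SOME\<close>; the induced homomorphisms do not depend on the choice.
\<close>

definition bonding_map ::
    "'a set set \<times> 'a set \<Rightarrow> 'a set set \<times> 'a set \<Rightarrow> ('a set \<Rightarrow> real) \<Rightarrow> ('a set \<Rightarrow> real)" where
  "bonding_map j i = simplicial_map (SOME f. vertex_assignment j i f)"

definition bonding_hom ::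
    "'a set set \<times> 'a set \<Rightarrow> 'a set set \<times> 'a set \<Rightarrow>
     (real \<Rightarrow> 'a set \<Rightarrow> real) set \<Rightarrow> (real \<Rightarrow> 'a set \<Rightarrow> real) set" where
  "bonding_hom j i = (case i of (\<U>, U) \<Rightarrow> induced_hom (nerve \<U>) (vertex U) (bonding_map j i))"

definition shape_group ::
    "'a topology \<Rightarrow> 'a \<Rightarrow> ('a set set \<times> 'a set \<Rightarrow> (real \<Rightarrow> 'a set \<Rightarrow> real) set) monoid" where
  "shape_group T x =
     (product_group (pointed_covers T x) nerve_group)
       \<lparr>carrier := {g \<in> carrier (product_group (pointed_covers T x) nerve_group).
          \<forall>i\<in>pointed_covers T x. \<forall>j\<in>pointed_covers T x. refines j i \<longrightarrow> bonding_hom j i (g j) = g i}\<rparr>"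

definition partition_of_unity :: "'a topology \<Rightarrow> 'a set set \<Rightarrow> ('a set \<Rightarrow> 'a \<Rightarrow> real) \<Rightarrow> bool" where
  "partition_of_unity T \<V> \<rho> \<longleftrightarrow>
     (\<forall>V\<in>\<V>. continuous_map T euclideanreal (\<rho> V) \<and> (\<forall>z\<in>topspace T. 0 \<le> \<rho> V z) \<and>
            T closure_of {z \<in> topspace T. \<rho> V z \<noteq> 0} \<subseteq> V) \<and>
     (\<forall>z\<in>topspace T. \<exists>N. openin T N \<and> z \<in> N \<and> finite {V\<in>\<V>. \<exists>y\<in>N. \<rho> V y \<noteq> 0}) \<and>
     (\<forall>z\<in>topspace T. (\<Sum>V | V \<in> \<V> \<and> \<rho> V z \<noteq> 0. \<rho> V z) = 1)"

definition barycentric_map :: "'a topology \<Rightarrow> 'a set set \<Rightarrow> 'a \<Rightarrow> ('a set \<Rightarrow> real)" where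
  "barycentric_map T \<V> = (let \<rho> = (SOME \<rho>. partition_of_unity T \<V> \<rho>) in
     (\<lambda>z V. if V \<in> \<V> then \<rho> V z else 0))"

definition barycentric_hom ::
    "'a topology \<Rightarrow> 'a set set \<times> 'a set \<Rightarrow> (real \<Rightarrow> 'a) set \<Rightarrow> (real \<Rightarrow> 'a set \<Rightarrow> real) set" where
  "barycentric_hom T = (\<lambda>(\<V>, V). induced_hom (nerve \<V>) (vertex V) (barycentric_map T \<V>))"

definition special_covers :: "'a topology \<Rightarrow> 'a \<Rightarrow> ('a set set \<times> 'a set) set" where
  "special_covers T x = {(\<V>, V) \<in> pointed_covers T x. \<forall>W\<in>\<V>. x \<in> W \<longrightarrow> W = V}"

text \<open>
  The component of \<open>\<Psi>\<close> at an arbitrary pair is obtained from the one at a refinement in the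
  cofinal family of pairs whose distinguished element is the only one containing \<open>x\<close>.
\<close>

definition shape_hom ::
    "'a topology \<Rightarrow> 'a \<Rightarrow> (real \<Rightarrow> 'a) set \<Rightarrow> ('a set set \<times> 'a set \<Rightarrow> (real \<Rightarrow> 'a set \<Rightarrow> real) set)" where
  "shape_hom T x c =
     (\<lambda>i\<in>pointed_covers T x.
        let j = (SOME j. j \<in> special_covers T x \<and> refines j i)
        in bonding_hom j i (barycentric_hom T j c))"

definition shape_kernel :: "'a::topological_space topology \<Rightarrow> 'a \<Rightarrow> (real \<Rightarrow> 'a) set set" where
  "shape_kernel T x = kernel (fundamental_group T x) (shape_group T x) (shape_hom T x)"

end

theory Submission
  imports Defs
begin

text \<open>
  Part 1. Modulo \<open>\<pi>\<^sub>1(\<U>, x)\<close>, a path that stays in one element of \<open>\<U>\<close> is determined by its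
  endpoints. If \<open>\<W>\<close> is a cover by path connected sets such that the elements containing a given
  point lie in one element of \<open>\<U>\<close>, then joining chosen centers of intersecting elements of \<open>\<W>\<close>
  yields a cocycle on the nerve of \<open>\<W>\<close>, with values in \<open>\<pi>\<^sub>1(X, x)\<close> modulo \<open>\<pi>\<^sub>1(\<U>, x)\<close>. Pulled
  back along a null homotopy in the nerve it is the coboundary of a function on the square, so its
  product along the boundary is trivial; for the image of a loop under the barycentric map this
  product is the class of the loop. Conversely, a loop in the support of a weight function is
  mapped into an open star of the nerve, where it contracts. Since nearby loops run through the
  same elements of \<open>\<W>\<close>, the union of \<open>\<pi>\<^sub>1(\<U>, x)\<close> is clopen.

  Part 2. A loop lies in the Spanier group iff, for each \<open>n\<close>, it can be made constant by finitely
  many moves, each of which changes it on an interval where the old and the new loop have diameter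
  at most \<open>1/n\<close>. These moves form countably many closed relations on the Polish space of loops,
  and analytic sets are stable under countable unions, countable intersections and preimages under
  closed relations.
\<close>

section \<open>Homotopy of paths in an abstract topology\<close>

text \<open>The argument uses no map from a nerve back to the space along which a null homotopy
  could be transported. What survives of the homotopy is discrete: at each point of the square, an
  element of the cover with maximal barycentric coordinate. Holonomy is designed for such data,
  since inside one cover element it forgets everything about a path except its endpoints. The price
  is that values lie in a possibly nonabelian quotient, so normality is needed and the order of
  factors matters throughout. Local path connectedness enters through the star refinement, whose
  members must be both open and path connected. For analyticity the obstacle is an intersection over
  all open covers. Lebesgue numbers reduce these to the mesh sizes \<open>1/n\<close>. A single kind
  of move then serves two purposes: a fine grid breaks any homotopy into moves, and one move
  contracts a small loop at the end of a tail. Conversely, a move leaves the holonomy unchanged for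
  every cover whose Lebesgue number exceeds the size of the move.\<close>

abbreviation unit_interval :: "real topology" where
  "unit_interval \<equiv> top_of_set {0..1}"

lemma pathin_top_of_set:
  "pathin (top_of_set X) p \<longleftrightarrow> path p \<and> path_image p \<subseteq> X"
  by (auto simp: pathin_canon_iff path_image_def)

text \<open>The endpoints are pinned to those of \<open>p\<close>. For a loop at \<open>x\<close>
  this is \<open>homotopic_loops_at T x\<close>, and base paths, links and segments, which are not
  loops, obey the same calculus.\<close>

definition path_homotopic :: "'a::topological_space topology \<Rightarrow> (real \<Rightarrow> 'a) \<Rightarrow> (real \<Rightarrow> 'a) \<Rightarrow> bool" where
  "path_homotopic T p q \<longleftrightarrow>
     homotopic_with (\<lambda>r. pathstart r = pathstart p \<and> pathfinish r = pathfinish p) unit_interval T p q"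

lemma path_homotopicD:
  assumes "path_homotopic T p q"
  shows "pathin T p" "pathin T q" "pathstart q = pathstart p" "pathfinish q = pathfinish p"
  using homotopic_with_imp_continuous_maps[OF assms[unfolded path_homotopic_def]]
    homotopic_with_imp_property[OF assms[unfolded path_homotopic_def]]
  by (auto simp: pathin_def)

lemma path_homotopic_sym: "path_homotopic T p q \<Longrightarrow> path_homotopic T q p"
  using path_homotopicD[of T p q] unfolding path_homotopic_def by (simp add: homotopic_with_sym)

lemma path_homotopic_trans [trans]:
  assumes "path_homotopic T p q" "path_homotopic T q r"
  shows "path_homotopic T p r"
  using assms path_homotopicD(3,4)[OF assms(1)] homotopic_with_trans
  unfolding path_homotopic_def by fastforce

lemma path_homotopic_eq:
  assumes "pathin T p" "\<And>t. t \<in> {0..1} \<Longrightarrow> q t = p t"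
  shows "path_homotopic T p q"
  unfolding path_homotopic_def
proof (rule homotopic_with_equal)
  show "continuous_map unit_interval T p"
    using assms by (simp add: pathin_def)
  show "pathstart q = pathstart p \<and> pathfinish q = pathfinish p"
    using assms by (auto simp: pathstart_def pathfinish_def)
  show "\<And>t. t \<in> topspace unit_interval \<Longrightarrow> p t = q t"
    using assms by auto
qed auto

lemma path_homotopic_refl [simp]: "path_homotopic T p p \<longleftrightarrow> pathin T p"
  using path_homotopic_eq path_homotopicD by blast

lemma path_homotopic_image:
  assumes "path_homotopic S p q" "continuous_map S T f"
  shows "path_homotopic T (f \<circ> p) (f \<circ> q)"
  using homotopic_with_compose_continuous_map_left[OF assms(1)[unfolded path_homotopic_def] assms(2)]
  unfolding path_homotopic_def by (simp add: pathstart_def pathfinish_def)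

text \<open>The straight-line homotopy from \<open>a\<close> to \<open>b\<close> stays in the convex
  set \<open>{0..1}\<close> and is then composed with \<open>p\<close>. The unit, inverse and
  associativity laws all reduce to this, each comparing two parametrisations of one path.\<close>

lemma path_homotopic_reparam:
  assumes p: "pathin T p" and "continuous_on {0..1} a" "continuous_on {0..1} b"
    and ab: "a \<in> {0..1} \<rightarrow> {0..1::real}" "b \<in> {0..1} \<rightarrow> {0..1}" and "a 0 = b 0" "a 1 = b 1"
  shows "path_homotopic T (p \<circ> a) (p \<circ> b)"
proof -
  have "homotopic_paths {0..1} a b"
  proof (rule homotopic_paths_linear)
    show "closed_segment (a t) (b t) \<subseteq> {0..1}" if "t \<in> {0..1}" for t
      using that ab by (intro closed_segment_subset) (auto simp: Pi_iff)
  qed (use assms in \<open>auto simp: path_def pathstart_def pathfinish_def\<close>)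
  then have "path_homotopic unit_interval a b"
    by (simp add: homotopic_paths_def path_homotopic_def)
  then show ?thesis
    using p by (intro path_homotopic_image) (simp_all add: pathin_def)
qed

lemma pathin_reparam:
  fixes T :: "'a::topological_space topology"
  assumes "pathin T p" "continuous_on {0..1} a" "a \<in> {0..1} \<rightarrow> {0..1::real}"
  shows "pathin T (p \<circ> a)"
  using path_homotopic_reparam[OF assms(1,2,2,3,3)] by simp

lemma pathin_subset: "pathin T p \<Longrightarrow> t \<in> {0..1} \<Longrightarrow> p t \<in> topspace T"
  by (auto simp: pathin_def continuous_map_def)

lemma pathin_const_path [simp]: "pathin T (\<lambda>t. x) \<longleftrightarrow> x \<in> topspace T"
  by (auto simp: pathin_def)

lemma pathstart_const [simp]: "pathstart (\<lambda>t. x) = x"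
  and pathfinish_const [simp]: "pathfinish (\<lambda>t. x) = x"
  and reversepath_const [simp]: "reversepath (\<lambda>t. x) = (\<lambda>t. x)"
  and path_image_const [simp]: "path_image (\<lambda>t. x) = {x}"
  by (auto simp: pathstart_def pathfinish_def reversepath_def path_image_def)

lemma pathin_reversepath [intro, simp]: "pathin T p \<Longrightarrow> pathin T (reversepath p)"
  using pathin_reparam[of T p "\<lambda>t. 1 - t"] by (simp add: reversepath_def o_def continuous_intros)

text \<open>The two homotopies are pasted along the line where the second coordinate is
  \<open>1/2\<close>; there both are constantly the common endpoint.\<close>

lemma path_homotopic_join:
  assumes pp: "path_homotopic T p p'" and qq: "path_homotopic T q q'" and pq: "pathfinish p = pathstart q"
  shows "path_homotopic T (p +++ q) (p' +++ q')"
proof -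
  let ?I = unit_interval and ?Q = "prod_topology unit_interval unit_interval"
  obtain h where h: "continuous_map ?Q T h" "\<And>t. h (0,t) = p t" "\<And>t. h (1,t) = p' t"
      "\<And>s. s \<in> {0..1} \<Longrightarrow> h (s,0) = pathstart p" "\<And>s. s \<in> {0..1} \<Longrightarrow> h (s,1) = pathfinish p"
    using pp unfolding path_homotopic_def homotopic_with_def by (auto simp: pathstart_def pathfinish_def)
  obtain k where k: "continuous_map ?Q T k" "\<And>t. k (0,t) = q t" "\<And>t. k (1,t) = q' t"
      "\<And>s. s \<in> {0..1} \<Longrightarrow> k (s,0) = pathstart q" "\<And>s. s \<in> {0..1} \<Longrightarrow> k (s,1) = pathfinish q"
    using qq unfolding path_homotopic_def homotopic_with_def by (auto simp: pathstart_def pathfinish_def)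
  let ?m = "\<lambda>z. if snd z \<le> 1/2 then h (fst z, 2 * snd z) else k (fst z, 2 * snd z - 1)"
  have Q: "?Q = top_of_set ({0..1} \<times> {0..1})"
    by simp
  have "continuous_map ?Q T ?m"
  proof (rule continuous_map_cases_le)
    show "continuous_map ?Q euclideanreal snd" "continuous_map ?Q euclideanreal (\<lambda>z. 1/2)"
      unfolding Q by (auto intro!: continuous_intros)
    have "continuous_map (subtopology ?Q {z \<in> topspace ?Q. snd z \<le> 1/2}) ?Q (\<lambda>z. (fst z, 2 * snd z))"
      unfolding Q subtopology_subtopology
      by (auto intro!: continuous_intros)
    from continuous_map_compose[OF this h(1)]
    show "continuous_map (subtopology ?Q {z \<in> topspace ?Q. snd z \<le> 1/2}) T (\<lambda>z. h (fst z, 2 * snd z))"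
      by (simp add: o_def)
    have "continuous_map (subtopology ?Q {z \<in> topspace ?Q. 1/2 \<le> snd z}) ?Q (\<lambda>z. (fst z, 2 * snd z - 1))"
      unfolding Q subtopology_subtopology
      by (auto intro!: continuous_intros)
    from continuous_map_compose[OF this k(1)]
    show "continuous_map (subtopology ?Q {z \<in> topspace ?Q. 1/2 \<le> snd z}) T (\<lambda>z. k (fst z, 2 * snd z - 1))"
      by (simp add: o_def)
    fix z assume "z \<in> topspace ?Q" "snd z = 1/2"
    then have "2 * snd z = 1" "2 * snd z - 1 = 0" "fst z \<in> {0..1}"
      by auto
    then show "h (fst z, 2 * snd z) = k (fst z, 2 * snd z - 1)"
      using h(5) k(4) pq by simp
  qed
  then show ?thesis
    unfolding path_homotopic_def homotopic_with_def
    by (intro exI[of _ ?m])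
      (use h k in \<open>auto simp: joinpaths_def pathstart_def pathfinish_def\<close>)
qed

lemma pathin_join [intro, simp]:
  "pathin T p \<Longrightarrow> pathin T q \<Longrightarrow> pathfinish p = pathstart q \<Longrightarrow> pathin T (p +++ q)"
  using path_homotopic_join[of T p p q q] by simp

text \<open>The library's \<^const>\<open>subpath\<close> is confined to normed vector spaces.\<close>

definition segpath :: "real \<Rightarrow> real \<Rightarrow> (real \<Rightarrow> 'a) \<Rightarrow> real \<Rightarrow> 'a" where
  "segpath u v p = p \<circ> linepath u v"

lemma pathstart_segpath [simp]: "pathstart (segpath u v p) = p u"
  and pathfinish_segpath [simp]: "pathfinish (segpath u v p) = p v"
  by (simp_all add: segpath_def pathstart_def pathfinish_def linepath_def)

lemma segpath_trivial: "segpath u u p = (\<lambda>t. p u)"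
  and segpath_full: "segpath 0 1 p = p"
  and segpath_reverse: "segpath 1 0 p = reversepath p"
  by (auto simp: segpath_def linepath_def fun_eq_iff reversepath_def algebra_simps)

lemma path_image_segpath: "u \<le> v \<Longrightarrow> path_image (segpath u v p) = p ` {u..v}"
  by (simp add: segpath_def path_image_compose closed_segment_eq_real_ivl)

text \<open>The three times may come in any order. The degenerate choices \<open>(0,1,1)\<close>,
  \<open>(0,0,1)\<close> and \<open>(0,1,0)\<close> give the right unit, left unit and inverse
  laws.\<close>

lemma path_homotopic_segpaths:
  fixes T :: "'a::topological_space topology"
  assumes p: "pathin T p" and uvw: "u \<in> {0..1}" "v \<in> {0..1}" "w \<in> {0..1}"
  shows "path_homotopic T (segpath u v p +++ segpath v w p) (segpath u w p)"
proof -
  let ?a = "linepath u v +++ linepath v w" and ?b = "linepath u w"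
  have c: "closed_segment u v \<subseteq> {0..1}" "closed_segment v w \<subseteq> {0..1}" "closed_segment u w \<subseteq> {0..1}"
    using uvw by (simp_all add: closed_segment_subset)
  have "path_homotopic T (p \<circ> ?a) (p \<circ> ?b)"
  proof (rule path_homotopic_reparam[OF p])
    show "continuous_on {0..1} ?a" "continuous_on {0..1} ?b"
      using path_join_imp[of "linepath u v" "linepath v w"] by (auto simp flip: path_def)
    have "path_image ?a \<subseteq> {0..1}" "path_image ?b \<subseteq> {0..1}"
      using c by (auto simp: path_image_join)
    then show "?a \<in> {0..1} \<rightarrow> {0..1}" "?b \<in> {0..1} \<rightarrow> {0..1}"
      by (auto simp: path_image_def)
  qed (auto simp: joinpaths_def linepath_def)
  moreover have "p \<circ> ?a = segpath u v p +++ segpath v w p" "p \<circ> ?b = segpath u w p"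
    by (auto simp: fun_eq_iff joinpaths_def segpath_def)
  ultimately show ?thesis by simp
qed

lemma pathin_segpath [intro]:
  fixes T :: "'a::topological_space topology"
  assumes "pathin T p" "u \<in> {0..1}" "v \<in> {0..1}"
  shows "pathin T (segpath u v p)"
  using path_homotopicD(2)[OF path_homotopic_segpaths[OF assms(1,2,2,3)]] .

lemma path_homotopic_rid:
  assumes "pathin T p" "pathfinish p = y"
  shows "path_homotopic T (p +++ (\<lambda>t. y)) p"
  using path_homotopic_segpaths[OF assms(1), of 0 1 1] assms(2)
  by (simp add: segpath_trivial segpath_full pathfinish_def)

lemma path_homotopic_lid:
  assumes "pathin T p" "pathstart p = y"
  shows "path_homotopic T ((\<lambda>t. y) +++ p) p"
  using path_homotopic_segpaths[OF assms(1), of 0 0 1] assms(2)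
  by (simp add: segpath_trivial segpath_full pathstart_def)

lemma path_homotopic_rinv:
  assumes "pathin T p" "pathstart p = y"
  shows "path_homotopic T (p +++ reversepath p) (\<lambda>t. y)"
  using path_homotopic_segpaths[OF assms(1), of 0 1 0] assms(2)
  by (simp add: segpath_trivial segpath_full segpath_reverse pathstart_def)

lemma path_homotopic_linv:
  assumes "pathin T p" "pathfinish p = y"
  shows "path_homotopic T (reversepath p +++ p) (\<lambda>t. y)"
  using path_homotopic_rinv[of T "reversepath p" y] assms by simp

lemma path_homotopic_assoc:
  assumes "pathin T p" "pathin T q" "pathin T r" "pathfinish p = pathstart q" "pathfinish q = pathstart r"
  shows "path_homotopic T (p +++ (q +++ r)) ((p +++ q) +++ r)"
proof -
  let ?w = "p +++ (q +++ r)"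
  have w: "pathin T ?w" using assms by simp
  \<comment> \<open>Piecewise linear, sending the break points \<open>1/4\<close>,
    \<open>1/2\<close> of the left-bracketed join to the break points \<open>1/2\<close>,
    \<open>3/4\<close> of the right-bracketed one.\<close>
  let ?f = "\<lambda>t::real. if t \<le> 1/4 then 2 * t else if t \<le> 1/2 then t + 1/4 else (t + 1) / 2"
  have f: "continuous_on {0..1} ?f"
    by (intro continuous_on_cases_1 continuous_intros) auto
  have "path_homotopic T (?w \<circ> id) (?w \<circ> ?f)"
    by (rule path_homotopic_reparam[OF w _ f]) auto
  moreover have "path_homotopic T (?w \<circ> ?f) ((p +++ q) +++ r)"
    by (rule path_homotopic_eq[OF pathin_reparam[OF w f]])
      (auto simp: joinpaths_def assms pathstart_def pathfinish_def add_divide_distrib)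
  ultimately show ?thesis by (auto intro: path_homotopic_trans)
qed


section \<open>The fundamental group and Spanier groups\<close>

text \<open>This is \<open>loops\<close> without extensionality, which constant paths, segments and
  images under continuous maps need not satisfy.\<close>

definition loop_at :: "'a::topological_space topology \<Rightarrow> 'a \<Rightarrow> (real \<Rightarrow> 'a) \<Rightarrow> bool" where
  "loop_at T x p \<longleftrightarrow> pathin T p \<and> pathstart p = x \<and> pathfinish p = x"

lemma loop_atD: "loop_at T x p \<Longrightarrow> pathin T p \<and> pathstart p = x \<and> pathfinish p = x"
  by (simp add: loop_at_def)

lemma loop_at_loops: "p \<in> loops T x \<Longrightarrow> loop_at T x p"
  by (auto simp: loops_def loop_at_def)

lemma loop_at_join: "loop_at T x p \<Longrightarrow> loop_at T x q \<Longrightarrow> loop_at T x (p +++ q)"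
  and loop_at_reversepath: "loop_at T x p \<Longrightarrow> loop_at T x (reversepath p)"
  by (auto simp: loop_at_def)

lemma loop_at_const: "x \<in> topspace T \<Longrightarrow> loop_at T x (\<lambda>t. x)"
  by (simp add: loop_at_def)

lemma mem_loop_class:
  assumes "loop_at T x p"
  shows "q \<in> loop_class T x p \<longleftrightarrow> q \<in> loops T x \<and> path_homotopic T p q"
  using assms by (auto simp: loop_class_def loop_at_def homotopic_loops_at_def path_homotopic_def)

lemma loop_class_self: "p \<in> loops T x \<Longrightarrow> p \<in> loop_class T x p"
  by (simp add: mem_loop_class loop_at_loops loop_atD[OF loop_at_loops])

lemma restrict_loop:
  assumes "loop_at T x p"
  shows "restrict p {0..1} \<in> loops T x" "path_homotopic T p (restrict p {0..1})"
proof -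
  show h: "path_homotopic T p (restrict p {0..1})"
    using assms by (intro path_homotopic_eq) (auto simp: loop_at_def)
  show "restrict p {0..1} \<in> loops T x"
    using path_homotopicD[OF h] assms by (auto simp: loops_def loop_at_def)
qed

lemma loop_class_eqI:
  assumes p: "loop_at T x p" and pq: "path_homotopic T p q"
  shows "loop_class T x p = loop_class T x q"
proof -
  have q: "loop_at T x q" using p path_homotopicD[OF pq] by (simp add: loop_at_def)
  show ?thesis
    using path_homotopic_trans[OF pq] path_homotopic_trans[OF path_homotopic_sym[OF pq]]
    by (auto simp: mem_loop_class p q)
qed

lemma loop_class_eq_iff:
  assumes p: "loop_at T x p" and q: "loop_at T x q"
  shows "loop_class T x p = loop_class T x q \<longleftrightarrow> path_homotopic T p q"
proof
  assume "loop_class T x p = loop_class T x q"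
  then have "path_homotopic T q (restrict p {0..1})"
    using restrict_loop[OF p] mem_loop_class[OF p] mem_loop_class[OF q] by blast
  then show "path_homotopic T p q"
    using restrict_loop(2)[OF p] path_homotopic_sym path_homotopic_trans by metis
qed (rule loop_class_eqI[OF p])

lemma loop_class_in_carrier:
  assumes "loop_at T x p"
  shows "loop_class T x p \<in> carrier (fundamental_group T x)"
  unfolding loop_class_eqI[OF assms restrict_loop(2)[OF assms]]
  using restrict_loop(1)[OF assms] by (simp add: fundamental_group_def)

lemma carrier_fundamental_groupE:
  assumes "A \<in> carrier (fundamental_group T x)"
  obtains p where "loop_at T x p" "p \<in> loops T x" "A = loop_class T x p"
  using assms loop_at_loops by (auto simp: fundamental_group_def)

text \<open>Distinct classes are disjoint, so a loop can lie in \<open>\<Union>G\<close> only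
  through its own class. This turns closedness and analyticity of a subgroup into statements about
  single loops.\<close>

lemma Union_loop_classes:
  assumes "G \<subseteq> carrier (fundamental_group T x)"
  shows "\<Union>G = {p \<in> loops T x. loop_class T x p \<in> G}"
proof (intro equalityI subsetI)
  fix p assume "p \<in> \<Union>G"
  then obtain A where A: "A \<in> G" "p \<in> A" by blast
  then obtain q where "loop_at T x q" "A = loop_class T x q"
    using assms carrier_fundamental_groupE by blast
  then show "p \<in> {p \<in> loops T x. loop_class T x p \<in> G}"
    using A loop_class_eqI[of T x q p] by (simp add: mem_loop_class)
qed (auto intro: loop_class_self)

text \<open>Evaluates the operations that are defined as unions over representatives: invariance
  makes all members of the union equal, and a class is never empty.\<close>

lemma UN_loop_class_const:
  assumes "loop_at T x p" and "\<And>q. loop_at T x q \<Longrightarrow> path_homotopic T p q \<Longrightarrow> F q = C"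
  shows "(\<Union>q\<in>loop_class T x p. F q) = C"
proof -
  have "loop_class T x p \<noteq> {}"
    using restrict_loop[OF assms(1)] mem_loop_class[OF assms(1)] by blast
  moreover have "F q = C" if "q \<in> loop_class T x p" for q
    using that assms loop_at_loops by (auto simp: mem_loop_class)
  ultimately show ?thesis by blast
qed

lemma loop_class_mult:
  assumes p: "loop_at T x p" and q: "loop_at T x q"
  shows "loop_class T x p \<otimes>\<^bsub>fundamental_group T x\<^esub> loop_class T x q = loop_class T x (p +++ q)"
proof -
  have "(\<Union>p'\<in>loop_class T x p. \<Union>q'\<in>loop_class T x q. loop_class T x (p' +++ q')) = loop_class T x (p +++ q)"
  proof (intro UN_loop_class_const p q)
    fix p' q' assume "loop_at T x p'" "path_homotopic T p p'" "loop_at T x q'" "path_homotopic T q q'"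
    then have "path_homotopic T (p +++ q) (p' +++ q')"
      using p q by (intro path_homotopic_join) (auto simp: loop_at_def)
    then show "loop_class T x (p' +++ q') = loop_class T x (p +++ q)"
      using loop_class_eqI[OF loop_at_join[OF p q]] by blast
  qed
  then show ?thesis
    by (simp add: fundamental_group_def)
qed

lemma one_fundamental_group: "\<one>\<^bsub>fundamental_group T x\<^esub> = loop_class T x (\<lambda>t. x)"
  by (simp add: fundamental_group_def)

lemma loop_class_linv:
  assumes p: "loop_at T x p"
  shows "loop_class T x (reversepath p) \<otimes>\<^bsub>fundamental_group T x\<^esub> loop_class T x p = \<one>\<^bsub>fundamental_group T x\<^esub>"
proof -
  have "path_homotopic T (reversepath p +++ p) (\<lambda>t. x)"
    using p path_homotopic_linv[of T p] by (auto simp: loop_at_def)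
  then show ?thesis
    using p by (simp add: one_fundamental_group loop_class_mult loop_class_eqI loop_at_join loop_at_reversepath)
qed

lemma group_fundamental_group:
  assumes x: "x \<in> topspace T"
  shows "group (fundamental_group T x)" (is "group ?G")
proof (rule groupI)
  show "\<one>\<^bsub>?G\<^esub> \<in> carrier ?G"
    unfolding one_fundamental_group using x by (intro loop_class_in_carrier loop_at_const)
next
  fix A B assume "A \<in> carrier ?G" "B \<in> carrier ?G"
  then obtain p q where *: "loop_at T x p" "A = loop_class T x p" "loop_at T x q" "B = loop_class T x q"
    by (meson carrier_fundamental_groupE)
  then show "A \<otimes>\<^bsub>?G\<^esub> B \<in> carrier ?G"
    by (simp add: loop_class_mult loop_class_in_carrier loop_at_join)
next
  fix A B C assume "A \<in> carrier ?G" "B \<in> carrier ?G" "C \<in> carrier ?G"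
  then obtain p q r where *: "loop_at T x p" "A = loop_class T x p" "loop_at T x q" "B = loop_class T x q"
    "loop_at T x r" "C = loop_class T x r"
    by (meson carrier_fundamental_groupE)
  have "path_homotopic T (p +++ (q +++ r)) ((p +++ q) +++ r)"
    using * by (intro path_homotopic_assoc) (auto simp: loop_at_def)
  then have "loop_class T x (p +++ (q +++ r)) = loop_class T x ((p +++ q) +++ r)"
    using * by (intro loop_class_eqI loop_at_join)
  then show "A \<otimes>\<^bsub>?G\<^esub> B \<otimes>\<^bsub>?G\<^esub> C = A \<otimes>\<^bsub>?G\<^esub> (B \<otimes>\<^bsub>?G\<^esub> C)"
    using * by (simp add: loop_class_mult loop_at_join)
next
  fix A assume "A \<in> carrier ?G"
  then obtain p where p: "loop_at T x p" "A = loop_class T x p"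
    by (meson carrier_fundamental_groupE)
  note lp = loop_at_const[OF x]
  have "path_homotopic T ((\<lambda>t. x) +++ p) p"
    using p by (intro path_homotopic_lid) (auto simp: loop_at_def)
  then show "\<one>\<^bsub>?G\<^esub> \<otimes>\<^bsub>?G\<^esub> A = A"
    using p lp by (simp add: one_fundamental_group loop_class_mult loop_class_eqI loop_at_join)
  show "\<exists>B\<in>carrier ?G. B \<otimes>\<^bsub>?G\<^esub> A = \<one>\<^bsub>?G\<^esub>"
    using p loop_class_linv loop_class_in_carrier loop_at_reversepath by blast
qed

lemma loop_class_inv:
  assumes x: "x \<in> topspace T" and p: "loop_at T x p"
  shows "inv\<^bsub>fundamental_group T x\<^esub> (loop_class T x p) = loop_class T x (reversepath p)"
  using loop_class_linv[OF p] group.inv_equality[OF group_fundamental_group[OF x]]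
    loop_class_in_carrier p loop_at_reversepath by blast

section \<open>Lollipops: a stick \<open>r\<close> with a small loop \<open>l\<close> at its end,
  generating the Spanier group of a cover\<close>

lemma loop_at_lollipop:
  assumes "pathin T r" "pathstart r = x" "loop_at T (pathfinish r) l"
  shows "loop_at T x (r +++ l +++ reversepath r)"
  using assms by (auto simp: loop_at_def)

text \<open>Unlike in the definition, the loop \<open>l\<close> need not be extensional.\<close>

lemma lollipop_in_generators:
  assumes "pathin T r" "pathstart r = x" "loop_at T (pathfinish r) l" "U \<in> \<U>" "path_image l \<subseteq> U"
  shows "loop_class T x (r +++ l +++ reversepath r) \<in> spanier_generators T x \<U>"
proof -
  let ?l = "restrict l {0..1}"
  note l = restrict_loop[OF assms(3)]
  have "path_homotopic T (r +++ l +++ reversepath r) (r +++ ?l +++ reversepath r)"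
    using assms l(2) by (intro path_homotopic_join) (auto simp: loop_at_def)
  then have eq: "loop_class T x (r +++ l +++ reversepath r) = loop_class T x (r +++ ?l +++ reversepath r)"
    using loop_class_eqI[OF loop_at_lollipop[OF assms(1-3)]] by blast
  have im: "path_image ?l = path_image l"
    by (auto simp: path_image_def)
  show ?thesis
    unfolding spanier_generators_def eq using assms l(1) im by blast
qed

lemma spanier_generatorsE:
  assumes "A \<in> spanier_generators T x \<U>"
  obtains r l U where "pathin T r" "pathstart r = x" "loop_at T (pathfinish r) l"
    "U \<in> \<U>" "path_image l \<subseteq> U" "A = loop_class T x (r +++ l +++ reversepath r)"
  using assms loop_at_loops unfolding spanier_generators_def by blast

lemma spanier_generators_subset: "spanier_generators T x \<U> \<subseteq> carrier (fundamental_group T x)"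
  by (auto elim!: spanier_generatorsE intro!: loop_class_in_carrier loop_at_lollipop)

text \<open>Conjugating a lollipop by \<open>p\<close> yields the lollipop with the same head and
  the longer stick \<open>p +++ r\<close>; a generating set stable under conjugation generates a
  normal subgroup.\<close>

lemma spanier_group_cover_normal:
  assumes x: "x \<in> topspace T"
  shows "spanier_group_cover T x \<U> \<lhd> fundamental_group T x" (is "_ \<lhd> ?G")
  unfolding spanier_group_cover_def
proof (rule group.normal_generateI[OF group_fundamental_group[OF x] spanier_generators_subset])
  interpret group ?G by (rule group_fundamental_group[OF x])
  fix A B assume A: "A \<in> spanier_generators T x \<U>" and B: "B \<in> carrier ?G"
  obtain r l U where rl: "pathin T r" "pathstart r = x" "loop_at T (pathfinish r) l"
    "U \<in> \<U>" "path_image l \<subseteq> U" "A = loop_class T x (r +++ l +++ reversepath r)"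
    using spanier_generatorsE[OF A] by metis
  obtain p where p: "loop_at T x p" "B = loop_class T x p"
    using carrier_fundamental_groupE[OF B] by metis
  note L = loop_at_lollipop[OF rl(1-3)]
  have e: "B \<otimes>\<^bsub>?G\<^esub> A \<otimes>\<^bsub>?G\<^esub> inv\<^bsub>?G\<^esub> B = loop_class T x ((p +++ (r +++ l +++ reversepath r)) +++ reversepath p)"
    using p rl(6) by (simp add: loop_class_mult loop_class_inv[OF x] loop_at_join loop_at_reversepath L)
  note [simp] = loop_atD[OF p(1)] loop_atD[OF rl(3)] rl(1-2)
  have "path_homotopic T ((p +++ (r +++ l +++ reversepath r)) +++ reversepath p)
     (((p +++ r) +++ (l +++ reversepath r)) +++ reversepath p)"
    by (intro path_homotopic_join path_homotopic_assoc) auto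
  also have "path_homotopic T (((p +++ r) +++ (l +++ reversepath r)) +++ reversepath p)
     ((p +++ r) +++ ((l +++ reversepath r) +++ reversepath p))"
    by (intro path_homotopic_sym[OF path_homotopic_assoc]) auto
  also have "path_homotopic T \<dots> ((p +++ r) +++ l +++ (reversepath r +++ reversepath p))"
    by (intro path_homotopic_join path_homotopic_sym[OF path_homotopic_assoc]) auto
  finally have "path_homotopic T ((p +++ (r +++ l +++ reversepath r)) +++ reversepath p)
     ((p +++ r) +++ l +++ reversepath (p +++ r))"
    by (simp add: reversepath_joinpaths)
  then have "loop_class T x ((p +++ (r +++ l +++ reversepath r)) +++ reversepath p) =
      loop_class T x ((p +++ r) +++ l +++ reversepath (p +++ r))"
    using loop_class_eqI[OF loop_at_join[OF loop_at_join[OF p(1) L] loop_at_reversepath[OF p(1)]]] by blast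
  moreover have "loop_class T x ((p +++ r) +++ l +++ reversepath (p +++ r)) \<in> spanier_generators T x \<U>"
    by (rule lollipop_in_generators[of _ _ _ _ U]) (use rl in auto)
  ultimately show "B \<otimes>\<^bsub>?G\<^esub> A \<otimes>\<^bsub>?G\<^esub> inv\<^bsub>?G\<^esub> B \<in> spanier_generators T x \<U>"
    using e by simp
qed

lemma spanier_group_cover_subset:
  "x \<in> topspace T \<Longrightarrow> spanier_group_cover T x \<U> \<subseteq> carrier (fundamental_group T x)"
  by (meson normal_imp_subgroup spanier_group_cover_normal subgroup.subset)

text \<open>The inverse of a lollipop has the same stick and the reversed head, which runs in the
  same element of the cover.\<close>

lemma spanier_generators_inv:
  assumes x: "x \<in> topspace T" and A: "A \<in> spanier_generators T x \<U>"
  shows "inv\<^bsub>fundamental_group T x\<^esub> A \<in> spanier_generators T x \<U>"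
proof -
  obtain r l U where rl: "pathin T r" "pathstart r = x" "loop_at T (pathfinish r) l"
    "U \<in> \<U>" "path_image l \<subseteq> U" "A = loop_class T x (r +++ l +++ reversepath r)"
    using spanier_generatorsE[OF A] by metis
  note [simp] = loop_atD[OF rl(3)] rl(1-2)
  note L = loop_at_lollipop[OF rl(1-3)]
  have "path_homotopic T (reversepath (r +++ l +++ reversepath r)) (r +++ reversepath l +++ reversepath r)"
    using path_homotopic_sym[OF path_homotopic_assoc[of T r "reversepath l" "reversepath r"]]
    by (simp add: reversepath_joinpaths)
  then have "loop_class T x (reversepath (r +++ l +++ reversepath r)) = loop_class T x (r +++ reversepath l +++ reversepath r)"
    by (rule loop_class_eqI[OF loop_at_reversepath[OF L]])
  moreover have "loop_class T x (r +++ reversepath l +++ reversepath r) \<in> spanier_generators T x \<U>"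
    by (rule lollipop_in_generators[of _ _ _ _ U]) (use rl in \<open>auto intro: loop_at_reversepath\<close>)
  ultimately show ?thesis
    using rl(6) by (simp add: loop_class_inv[OF x L])
qed

text \<open>Since the generators are closed under inversion, only products occur in the induction.\<close>

lemma spanier_group_cover_induct [consumes 3, case_names const lollipop join homotopic]:
  assumes "loop_class T x p \<in> spanier_group_cover T x \<U>" and p: "loop_at T x p" and x: "x \<in> topspace T"
    and const: "P (\<lambda>t. x)"
    and lollipop: "\<And>r l U. pathin T r \<Longrightarrow> pathstart r = x \<Longrightarrow> loop_at T (pathfinish r) l \<Longrightarrow>
       U \<in> \<U> \<Longrightarrow> path_image l \<subseteq> U \<Longrightarrow> P (r +++ l +++ reversepath r)"
    and join: "\<And>p q. loop_at T x p \<Longrightarrow> loop_at T x q \<Longrightarrow> P p \<Longrightarrow> P q \<Longrightarrow> P (p +++ q)"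
    and hom: "\<And>p q. loop_at T x p \<Longrightarrow> loop_at T x q \<Longrightarrow> path_homotopic T p q \<Longrightarrow> P p \<Longrightarrow> P q"
  shows "P p"
proof -
  let ?G = "fundamental_group T x"
  have gen: "\<exists>p. A = loop_class T x p \<and> loop_at T x p \<and> P p" if "A \<in> spanier_generators T x \<U>" for A
    using spanier_generatorsE[OF that] lollipop loop_at_lollipop by metis
  have "\<exists>p. A = loop_class T x p \<and> loop_at T x p \<and> P p" if "A \<in> generate ?G (spanier_generators T x \<U>)" for A
    using that
  proof induction
    case one
    then show ?case using const loop_at_const[OF x] one_fundamental_group by blast
  next
    case (incl h)
    then show ?case by (rule gen)
  next
    case (inv h)
    then show ?case using gen spanier_generators_inv[OF x] by blast
  next
    case (eng h1 h2)
    then obtain p q where "h1 = loop_class T x p" "loop_at T x p" "P p" "h2 = loop_class T x q" "loop_at T x q" "P q"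
      by blast
    then show ?case
      using join loop_at_join loop_class_mult by metis
  qed
  then obtain q where "loop_class T x p = loop_class T x q" "loop_at T x q" "P q"
    using assms(1) unfolding spanier_group_cover_def by blast
  then show ?thesis
    using hom p by (metis loop_class_eq_iff)
qed


section \<open>Holonomy modulo the Spanier group of a cover\<close>

text \<open>Prescribing the constant path at \<open>x\<close> makes the holonomy of a loop at
  \<open>x\<close> the plain coset of its class, without conjugation by an arbitrary loop.\<close>

definition base_path :: "'a::topological_space topology \<Rightarrow> 'a \<Rightarrow> 'a \<Rightarrow> real \<Rightarrow> 'a" where
  "base_path T x z = (if z = x then (\<lambda>t. x) else SOME r. pathin T r \<and> pathstart r = x \<and> pathfinish r = z)"

text \<open>
  Closing up a path by base paths turns it into a loop. Modulo the normal subgroup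
  \<open>\<pi>\<^sub>1(\<U>, x)\<close> this is a functor from the path groupoid that only depends on the endpoints of
  paths running in one element of \<open>\<U>\<close>.
\<close>

definition holonomy ::
    "'a::topological_space topology \<Rightarrow> 'a \<Rightarrow> 'a set set \<Rightarrow> (real \<Rightarrow> 'a) \<Rightarrow> (real \<Rightarrow> 'a) set set" where
  "holonomy T x \<U> p = spanier_group_cover T x \<U> #>\<^bsub>fundamental_group T x\<^esub>
     loop_class T x (base_path T x (pathstart p) +++ p +++ reversepath (base_path T x (pathfinish p)))"

definition holonomy_group ::
    "'a::topological_space topology \<Rightarrow> 'a \<Rightarrow> 'a set set \<Rightarrow> (real \<Rightarrow> 'a) set set monoid" where
  "holonomy_group T x \<U> = fundamental_group T x Mod spanier_group_cover T x \<U>"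

locale pointed_space =
  fixes T :: "'a::topological_space topology" and x :: 'a
  assumes pconn: "path_connected_space T" and x: "x \<in> topspace T"
begin

lemma base_path [simp]:
  assumes "z \<in> topspace T"
  shows "pathin T (base_path T x z)" "pathstart (base_path T x z) = x" "pathfinish (base_path T x z) = z"
proof -
  obtain r where "pathin T r \<and> pathstart r = x \<and> pathfinish r = z"
    using pconn assms x unfolding path_connected_space_def pathstart_def pathfinish_def by blast
  from someI[of "\<lambda>r. pathin T r \<and> pathstart r = x \<and> pathfinish r = z", OF this]
  show "pathin T (base_path T x z)" "pathstart (base_path T x z) = x" "pathfinish (base_path T x z) = z"
    using x unfolding base_path_def by auto
qed

lemma pathin_ends:
  assumes "pathin T p"
  shows "pathstart p \<in> topspace T" "pathfinish p \<in> topspace T"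
  using assms pathin_subset[of T p] by (auto simp: pathstart_def pathfinish_def)

lemma loop_at_closed_up:
  assumes "pathin T p"
  shows "loop_at T x (base_path T x (pathstart p) +++ p +++ reversepath (base_path T x (pathfinish p)))"
  using assms pathin_ends[OF assms] base_path by (auto simp: loop_at_def)

lemmas spanier_normal = spanier_group_cover_normal[OF x]

lemma group_holonomy_group: "group (holonomy_group T x \<U>)"
  unfolding holonomy_group_def by (rule normal.factorgroup_is_group[OF spanier_normal])

lemma holonomy_carrier: "pathin T p \<Longrightarrow> holonomy T x \<U> p \<in> carrier (holonomy_group T x \<U>)"
  using loop_class_in_carrier[OF loop_at_closed_up]
  by (auto simp: holonomy_group_def holonomy_def FactGroup_def RCOSETS_def)

lemma holonomy_homotopic:
  assumes "path_homotopic T p q"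
  shows "holonomy T x \<U> p = holonomy T x \<U> q"
proof -
  let ?a = "base_path T x (pathstart p)" and ?b = "base_path T x (pathfinish p)"
  note pq = path_homotopicD[OF assms]
  note b = base_path[OF pathin_ends(1)[OF pq(1)]] base_path[OF pathin_ends(2)[OF pq(1)]]
  have "path_homotopic T (?a +++ p +++ reversepath ?b) (?a +++ q +++ reversepath ?b)"
    using assms b by (intro path_homotopic_join) auto
  then show ?thesis
    unfolding holonomy_def pq(3,4) using loop_class_eqI[OF loop_at_closed_up[OF pq(1)]] by simp
qed

text \<open>The base path of the middle point is traversed backwards and then forwards, hence
  cancels; normality lets the cosets be multiplied.\<close>

lemma holonomy_join:
  assumes pq: "pathin T p" "pathin T q" "pathfinish p = pathstart q"
  shows "holonomy T x \<U> (p +++ q) = holonomy T x \<U> p \<otimes>\<^bsub>holonomy_group T x \<U>\<^esub> holonomy T x \<U> q"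
proof -
  let ?a = "base_path T x (pathstart p)" and ?b = "base_path T x (pathfinish p)" and ?c = "base_path T x (pathfinish q)"
  note [simp] = pq pathin_ends[OF pq(1)] pathin_ends[OF pq(2)]
  have "path_homotopic T ((?a +++ (p +++ reversepath ?b)) +++ (?b +++ (q +++ reversepath ?c)))
      (?a +++ ((p +++ reversepath ?b) +++ (?b +++ (q +++ reversepath ?c))))"
    by (intro path_homotopic_sym[OF path_homotopic_assoc]) auto
  also have "path_homotopic T \<dots> (?a +++ (p +++ (reversepath ?b +++ (?b +++ (q +++ reversepath ?c)))))"
    by (intro path_homotopic_join path_homotopic_sym[OF path_homotopic_assoc]) auto
  also have "path_homotopic T \<dots> (?a +++ (p +++ ((reversepath ?b +++ ?b) +++ (q +++ reversepath ?c))))"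
    by (intro path_homotopic_join path_homotopic_assoc) auto
  also have "path_homotopic T \<dots> (?a +++ (p +++ ((\<lambda>t. pathstart q) +++ (q +++ reversepath ?c))))"
    by (intro path_homotopic_join path_homotopic_linv) auto
  also have "path_homotopic T \<dots> (?a +++ (p +++ (q +++ reversepath ?c)))"
    by (intro path_homotopic_join path_homotopic_lid) auto
  also have "path_homotopic T \<dots> (?a +++ ((p +++ q) +++ reversepath ?c))"
    by (intro path_homotopic_join path_homotopic_assoc) auto
  finally have h: "path_homotopic T ((?a +++ p +++ reversepath ?b) +++ (?b +++ q +++ reversepath ?c))
     (?a +++ (p +++ q) +++ reversepath ?c)" .
  have L: "loop_at T x (?a +++ p +++ reversepath ?b)" "loop_at T x (?b +++ q +++ reversepath ?c)"
    using loop_at_closed_up[OF pq(1)] loop_at_closed_up[OF pq(2)] by simp_all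
  have "holonomy T x \<U> (p +++ q) = spanier_group_cover T x \<U> #>\<^bsub>fundamental_group T x\<^esub>
      (loop_class T x (?a +++ p +++ reversepath ?b) \<otimes>\<^bsub>fundamental_group T x\<^esub> loop_class T x (?b +++ q +++ reversepath ?c))"
    using loop_class_eqI[OF loop_at_join[OF L] h] loop_class_mult[OF L] by (simp add: holonomy_def)
  also have "\<dots> = holonomy T x \<U> p \<otimes>\<^bsub>holonomy_group T x \<U>\<^esub> holonomy T x \<U> q"
    using normal.rcos_sum[OF spanier_normal loop_class_in_carrier[OF L(1)] loop_class_in_carrier[OF L(2)]]
    by (simp add: holonomy_def holonomy_group_def FactGroup_def)
  finally show ?thesis .
qed

lemma holonomy_loop_in:
  assumes l: "pathin T l" "pathfinish l = pathstart l" "U \<in> \<U>" "path_image l \<subseteq> U"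
  shows "holonomy T x \<U> l = \<one>\<^bsub>holonomy_group T x \<U>\<^esub>"
proof -
  let ?a = "base_path T x (pathstart l)"
  note a = base_path[OF pathin_ends(1)[OF l(1)]]
  have "loop_class T x (?a +++ l +++ reversepath ?a) \<in> spanier_generators T x \<U>"
    using l a by (intro lollipop_in_generators[of _ _ _ _ U]) (auto simp: loop_at_def)
  then have "loop_class T x (?a +++ l +++ reversepath ?a) \<in> spanier_group_cover T x \<U>"
    unfolding spanier_group_cover_def by (rule generate.incl)
  then show ?thesis
    using group.coset_join2[OF group_fundamental_group[OF x] loop_class_in_carrier[OF loop_at_closed_up[OF l(1)]]
        normal_imp_subgroup[OF spanier_normal]] l(2)
    by (simp add: holonomy_def holonomy_group_def)
qed

text \<open>Running along \<open>p\<close> and back along \<open>q\<close> is a loop inside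
  \<open>U\<close>, so its holonomy is trivial, and \<open>p\<close> is homotopic to this loop
  followed by \<open>q\<close>.\<close>

lemma holonomy_eq:
  assumes p: "pathin T p" and q: "pathin T q" and ends: "pathstart p = pathstart q" "pathfinish p = pathfinish q"
    and U: "U \<in> \<U>" "path_image p \<subseteq> U" "path_image q \<subseteq> U"
  shows "holonomy T x \<U> p = holonomy T x \<U> q"
proof -
  interpret group "holonomy_group T x \<U>" by (rule group_holonomy_group)
  note [simp] = p q ends pathin_ends[OF q]
  have "path_homotopic T p (p +++ (\<lambda>t. pathfinish q))"
    by (intro path_homotopic_sym[OF path_homotopic_rid]) auto
  also have "path_homotopic T \<dots> (p +++ (reversepath q +++ q))"
    by (intro path_homotopic_join path_homotopic_sym[OF path_homotopic_linv]) auto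
  also have "path_homotopic T \<dots> ((p +++ reversepath q) +++ q)"
    by (intro path_homotopic_assoc) auto
  finally have "holonomy T x \<U> p = holonomy T x \<U> ((p +++ reversepath q) +++ q)"
    by (rule holonomy_homotopic)
  also have "\<dots> = holonomy T x \<U> (p +++ reversepath q) \<otimes>\<^bsub>holonomy_group T x \<U>\<^esub> holonomy T x \<U> q"
    by (rule holonomy_join) auto
  also have "holonomy T x \<U> (p +++ reversepath q) = \<one>\<^bsub>holonomy_group T x \<U>\<^esub>"
    using U by (intro holonomy_loop_in[of _ U]) (auto simp: path_image_join)
  finally show ?thesis
    using holonomy_carrier[OF q] by simp
qed

text \<open>The base path at \<open>x\<close> is constant, so closing up changes \<open>p\<close>
  only by a homotopy, and a coset is trivial exactly when its representative lies in the
  subgroup.\<close>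

lemma holonomy_eq_one_iff:
  assumes p: "loop_at T x p"
  shows "holonomy T x \<U> p = \<one>\<^bsub>holonomy_group T x \<U>\<^esub> \<longleftrightarrow> loop_class T x p \<in> spanier_group_cover T x \<U>"
proof -
  note [simp] = loop_atD[OF p] x
  have b: "base_path T x x = (\<lambda>t. x)"
    by (simp add: base_path_def)
  have "path_homotopic T ((\<lambda>t. x) +++ p +++ (\<lambda>t. x)) (p +++ (\<lambda>t. x))"
    by (intro path_homotopic_lid) auto
  also have "path_homotopic T \<dots> p"
    by (intro path_homotopic_rid) auto
  finally have "loop_class T x ((\<lambda>t. x) +++ p +++ (\<lambda>t. x)) = loop_class T x p"
    using loop_class_eqI[OF p] path_homotopic_sym by metis
  then have "holonomy T x \<U> p = spanier_group_cover T x \<U> #>\<^bsub>fundamental_group T x\<^esub> loop_class T x p"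
    by (simp add: holonomy_def b)
  then show ?thesis
    using group.coset_join2[OF group_fundamental_group[OF x] loop_class_in_carrier[OF p] normal_imp_subgroup[OF spanier_normal]]
      group.coset_join1[OF group_fundamental_group[OF x] _ loop_class_in_carrier[OF p] normal_imp_subgroup[OF spanier_normal]]
    by (auto simp: holonomy_group_def)
qed

end


section \<open>Monodromy\<close>

text \<open>
  The primitive at \<open>q\<close> is the product of the cocycle along the subdivided segment from a base
  point to \<open>q\<close>; the cocycle identity on the rungs of the ladder between two nearby segments shows
  that it does what it should.
\<close>

lemma uniformly_local_cocycle_is_coboundary:
  fixes Q :: "'b::real_normed_vector set" and K (structure)
  assumes "group K" "bounded Q" "convex Q" "e > 0"
    and c: "\<And>q q1 q2 q3. q \<in> Q \<Longrightarrow> {q1, q2, q3} \<subseteq> Q \<inter> ball q e \<Longrightarrow>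
       c q1 q2 \<in> carrier K \<and> c q1 q3 = c q1 q2 \<otimes> c q2 q3"
  obtains s d where "d > 0" "\<And>q. q \<in> Q \<Longrightarrow> s q \<in> carrier K"
    "\<And>q q'. q \<in> Q \<Longrightarrow> q' \<in> Q \<Longrightarrow> dist q q' < d \<Longrightarrow> s q' = s q \<otimes> c q q'"
proof (cases "Q = {}")
  case True
  then show ?thesis using that[of 1 undefined] by auto
next
  case False
  then obtain b where b: "b \<in> Q" by blast
  interpret group K by fact
  obtain B where B: "\<And>q. q \<in> Q \<Longrightarrow> norm (q - b) < B"
    using \<open>bounded Q\<close> unfolding bounded_any_center[where a=b] dist_norm
    by (metis gt_ex le_less_trans norm_minus_commute)
  \<comment> \<open>Boundedness of \<open>Q\<close> allows one number of subdivisions for all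
    segments from \<open>b\<close>, with consecutive points closer than
    \<open>e / 4\<close>.\<close>
  obtain n :: nat where n: "B / (e / 4) < n" using reals_Archimedean2 by blast
  have "0 < B" using B[OF b] by simp
  then have n0: "0 < real n" using n \<open>e > 0\<close> by (meson divide_pos_pos less_trans zero_less_divide_iff zero_less_numeral)
  define z where "z k q = b + (real k / real n) *\<^sub>R (q - b)" for k q
  have zQ: "z k q \<in> Q" if "k \<le> n" "q \<in> Q" for k q
  proof -
    have "z k q = (1 - real k / real n) *\<^sub>R b + (real k / real n) *\<^sub>R q"
      by (simp add: z_def algebra_simps)
    then show ?thesis
      using convexD_alt[OF \<open>convex Q\<close> b that(2), of "real k / real n"] that n0 by simp
  qed
  have z_step: "dist (z k q) (z (Suc k) q) < e / 4" if "q \<in> Q" for k q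
  proof -
    have "z (Suc k) q - z k q = (1 / real n) *\<^sub>R (q - b)"
      by (simp add: z_def add_divide_distrib scaleR_left_distrib)
    then have "dist (z k q) (z (Suc k) q) = norm (q - b) / n"
      using n0 by (simp add: dist_norm norm_minus_commute[of "z k q"])
    also have "\<dots> < B / n" using B[OF that] n0 by (simp add: divide_strict_right_mono)
    also have "\<dots> < e / 4" using n n0 \<open>e > 0\<close> by (simp add: field_simps)
    finally show ?thesis .
  qed
  have z_close: "dist (z k q) (z k q') \<le> dist q q'" if "k \<le> n" for k q q'
  proof -
    have "z k q - z k q' = (real k / real n) *\<^sub>R (q - q')"
      by (simp add: z_def algebra_simps)
    then have "dist (z k q) (z k q') = (real k / real n) * dist q q'"
      by (simp add: dist_norm)
    also have "\<dots> \<le> 1 * dist q q'"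
      using that n0 by (intro mult_right_mono) auto
    finally show ?thesis by simp
  qed
  \<comment> \<open>Product of the cocycle along the first \<open>k\<close> pieces of the segment
    from \<open>b\<close> to \<open>q\<close>; the primitive is \<open>P q n\<close>.\<close>
  define P where "P q k = rec_nat \<one> (\<lambda>k a. a \<otimes> c (z k q) (z (Suc k) q)) k" for q k
  have P0: "P q 0 = \<one>" and PS: "P q (Suc k) = P q k \<otimes> c (z k q) (z (Suc k) q)" for q k
    by (simp_all add: P_def)
  have cc: "c q1 q2 \<in> carrier K" "c q1 q3 = c q1 q2 \<otimes> c q2 q3"
    if "q1 \<in> Q" "q2 \<in> Q" "q3 \<in> Q" "dist q1 q2 < e" "dist q1 q3 < e" for q1 q2 q3
    using c[of q1 q1 q2 q3] that \<open>e > 0\<close> by auto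
  have Pc: "P q k \<in> carrier K" if "k \<le> n" "q \<in> Q" for q k
    using that
  proof (induction k)
    case (Suc k)
    have "dist (z k q) (z (Suc k) q) < e" using z_step[OF Suc.prems(2), of k] \<open>e > 0\<close> by simp
    then show ?case
      using Suc cc(1)[OF zQ zQ zQ, of k q "Suc k" q "Suc k" q] by (simp add: PS)
  qed (simp add: P0)
  have main: "P q' k = P q k \<otimes> c (z k q) (z k q')" if "k \<le> n" "q \<in> Q" "q' \<in> Q" "dist q q' < e / 4" for q q' k
    using that(1)
  proof (induction k)
    case 0
    \<comment> \<open>All segments start at \<open>b\<close>, so the first rung of the ladder is
      \<open>c b b\<close>, an idempotent and hence the unit.\<close>
    have "c b b = c b b \<otimes> c b b" "c b b \<in> carrier K" using cc[OF b b b] \<open>e > 0\<close> by auto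
    then have "c b b = \<one>" using l_cancel_one' by metis
    then show ?case by (simp add: P0 z_def)
  next
    case (Suc k)
    let ?a = "z k q" and ?a' = "z (Suc k) q" and ?d = "z k q'" and ?d' = "z (Suc k) q'"
    have Q: "?a \<in> Q" "?a' \<in> Q" "?d \<in> Q" "?d' \<in> Q"
      using Suc that by (auto intro!: zQ)
    have "dist ?a ?d < e / 4" "dist ?a' ?d' < e / 4"
      using z_close[of k q q'] z_close[of "Suc k" q q'] Suc.prems that(4) by auto
    moreover have "dist ?a ?a' < e / 4" "dist ?d ?d' < e / 4"
      using z_step that by auto
    ultimately have D: "dist ?a ?a' < e" "dist ?a ?d < e" "dist ?a ?d' < e" "dist ?d ?d' < e" "dist ?a' ?d' < e"
      using dist_triangle[of ?a ?d' ?d] \<open>e > 0\<close> by linarith+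
    have car: "c ?a ?a' \<in> carrier K" "c ?a ?d \<in> carrier K" "c ?d ?d' \<in> carrier K" "c ?a' ?d' \<in> carrier K"
      using Q D by (auto intro: cc(1))
    \<comment> \<open>One square of the ladder: the route \<open>?a\<close>, \<open>?d\<close>,
      \<open>?d'\<close> is replaced by the diagonal and then by the route \<open>?a\<close>,
      \<open>?a'\<close>, \<open>?d'\<close>. Sides below \<open>e / 4\<close> keep the diagonal
      within \<open>e\<close>, where the cocycle law holds.\<close>
    have "P q' (Suc k) = P q k \<otimes> c ?a ?d \<otimes> c ?d ?d'"
      using Suc by (simp add: PS)
    also have "\<dots> = P q k \<otimes> c ?a ?d'"
      using cc(2)[OF Q(1,3,4) D(2,3)] car Pc[of k q] Suc.prems that by (simp add: m_assoc)
    also have "\<dots> = P q (Suc k) \<otimes> c ?a' ?d'"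
      using cc(2)[OF Q(1,2,4) D(1,3)] car Pc[of k q] Suc.prems that by (simp add: m_assoc PS)
    finally show ?case .
  qed
  have zn: "z n q = q" for q using n0 by (simp add: z_def)
  show ?thesis
  proof (rule that[of "e / 4" "\<lambda>q. P q n"])
    show "0 < e / 4" using \<open>e > 0\<close> by simp
    show "P q n \<in> carrier K" if "q \<in> Q" for q using Pc that by blast
    show "P q' n = P q n \<otimes> c q q'" if "q \<in> Q" "q' \<in> Q" "dist q q' < e / 4" for q q'
      using main[OF order_refl that] by (simp add: zn)
  qed
qed

text \<open>By \<open>star\<close>, all members of \<open>\<W>\<close> through one point fit into
  one member of \<open>\<U>\<close>, where holonomy sees only endpoints. This yields the cocycle law
  for members with a common point. The centers \<open>ctr\<close> fix one endpoint per member, so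
  that the values compose.\<close>

locale nice_cover = pointed_space T x for T :: "'a::topological_space topology" and x +
  fixes \<U> \<W> :: "'a set set" and ctr :: "'a set \<Rightarrow> 'a"
  assumes W: "\<And>W. W \<in> \<W> \<Longrightarrow> path_connectedin T W \<and> ctr W \<in> W"
    and star: "\<And>y. y \<in> topspace T \<Longrightarrow> \<exists>U\<in>\<U>. \<forall>W\<in>\<W>. y \<in> W \<longrightarrow> W \<subseteq> U"
begin

abbreviation "K \<equiv> holonomy_group T x \<U>"
abbreviation "hol \<equiv> holonomy T x \<U>"

sublocale K: group K by (rule group_holonomy_group)

definition link :: "'a set \<Rightarrow> 'a \<Rightarrow> 'a \<Rightarrow> real \<Rightarrow> 'a" where
  "link W y y' = (SOME p. pathin T p \<and> path_image p \<subseteq> W \<and> pathstart p = y \<and> pathfinish p = y')"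

lemma link:
  assumes "W \<in> \<W>" "y \<in> W" "y' \<in> W"
  shows "pathin T (link W y y')" "path_image (link W y y') \<subseteq> W"
    "pathstart (link W y y') = y" "pathfinish (link W y y') = y'"
proof -
  have "\<exists>p. pathin T p \<and> path_image p \<subseteq> W \<and> pathstart p = y \<and> pathfinish p = y'"
    using W[OF assms(1)] assms(2,3) unfolding path_connectedin
    by (force simp: path_image_def pathstart_def pathfinish_def image_subset_iff_funcset)
  then show "pathin T (link W y y')" "path_image (link W y y') \<subseteq> W"
    "pathstart (link W y y') = y" "pathfinish (link W y y') = y'"
    unfolding link_def by (metis (mono_tags, lifting) someI_ex)+
qed

text \<open>The value of the cocycle on an edge of the nerve. The meeting point is arbitrary: by
  \<open>trans_eq\<close>, any path between the centers inside a member of \<open>\<U>\<close>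
  containing \<open>W\<close> and \<open>W'\<close> gives the same value.\<close>

definition trans :: "'a set \<Rightarrow> 'a set \<Rightarrow> (real \<Rightarrow> 'a) set set" where
  "trans W W' = (let y = SOME y. y \<in> W \<inter> W' in hol (link W (ctr W) y +++ link W' y (ctr W')))"

lemma trans_eq:
  assumes "W \<in> \<W>" "W' \<in> \<W>" "W \<inter> W' \<noteq> {}" "U \<in> \<U>" "W \<union> W' \<subseteq> U"
    "pathin T p" "path_image p \<subseteq> U" "pathstart p = ctr W" "pathfinish p = ctr W'"
  shows "hol p = trans W W'"
proof -
  define y where "y = (SOME y. y \<in> W \<inter> W')"
  have y: "y \<in> W" "y \<in> W'" using some_in_eq[of "W \<inter> W'"] assms(3) by (auto simp: y_def)
  note l = link[OF assms(1) conjunct2[OF W[OF assms(1)]] y(1)] link[OF assms(2) y(2) conjunct2[OF W[OF assms(2)]]]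
  show ?thesis
    unfolding trans_def Let_def y_def[symmetric]
    by (rule holonomy_eq[of _ _ U]) (use assms l in \<open>auto simp: path_image_join\<close>)
qed

text \<open>Routing all links through the common point \<open>y\<close> keeps them in one
  \<open>U\<close>. The concatenation, which makes a detour over the center of \<open>W'\<close>,
  still joins the centers of \<open>W\<close> and \<open>W''\<close> inside \<open>U\<close> and so
  computes \<open>trans W W''\<close>.\<close>

lemma trans_cocycle:
  assumes Ws: "W \<in> \<W>" "W' \<in> \<W>" "W'' \<in> \<W>" and y: "y \<in> W" "y \<in> W'" "y \<in> W''"
  shows "trans W W' \<in> carrier K" "trans W W'' = trans W W' \<otimes>\<^bsub>K\<^esub> trans W' W''"
proof -
  have "y \<in> topspace T" using W[OF Ws(1)] y(1) path_connectedin_subset_topspace by blast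
  then obtain U where U: "U \<in> \<U>" "W \<subseteq> U" "W' \<subseteq> U" "W'' \<subseteq> U" using star Ws y by metis
  note c = conjunct2[OF W[OF Ws(1)]] conjunct2[OF W[OF Ws(2)]] conjunct2[OF W[OF Ws(3)]]
  let ?p = "link W (ctr W) y +++ link W' y (ctr W')" and ?q = "link W' (ctr W') y +++ link W'' y (ctr W'')"
  note l = link[OF Ws(1) c(1) y(1)] link[OF Ws(2) y(2) c(2)] link[OF Ws(2) c(2) y(2)] link[OF Ws(3) y(3) c(3)]
  have p: "hol ?p = trans W W'"
    by (rule trans_eq[of _ _ U]) (use Ws y U l in \<open>auto simp: path_image_join\<close>)
  have q: "hol ?q = trans W' W''"
    by (rule trans_eq[of _ _ U]) (use Ws y U l in \<open>auto simp: path_image_join\<close>)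
  have pq: "hol (?p +++ ?q) = trans W W''"
    by (rule trans_eq[of _ _ U]) (use Ws y U l in \<open>auto simp: path_image_join\<close>)
  show "trans W W' \<in> carrier K"
    unfolding p[symmetric] by (rule holonomy_carrier) (use l in auto)
  show "trans W W'' = trans W W' \<otimes>\<^bsub>K\<^esub> trans W' W''"
    unfolding p[symmetric] q[symmetric] pq[symmetric] by (rule holonomy_join) (use l in auto)
qed

lemma trans_self:
  assumes "W \<in> \<W>"
  shows "trans W W = \<one>\<^bsub>K\<^esub>"
  using trans_cocycle[of W W W "ctr W"] W[OF assms] assms K.l_cancel_one' by metis

text \<open>The holonomy accumulated up to time \<open>t\<close>, read off at the center of a member
  containing \<open>p t\<close>. Moving the reading point to a center makes every later change a
  value of \<open>trans\<close>, independent of the finer course of \<open>p\<close>.\<close>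

definition lift :: "(real \<Rightarrow> 'a) \<Rightarrow> real \<Rightarrow> 'a set \<Rightarrow> (real \<Rightarrow> 'a) set set" where
  "lift p t W = hol (segpath 0 t p) \<otimes>\<^bsub>K\<^esub> hol (link W (p t) (ctr W))"

lemma lift_carrier:
  assumes "pathin T p" "t \<in> {0..1}" "W \<in> \<W>" "p t \<in> W"
  shows "lift p t W \<in> carrier K"
  unfolding lift_def using assms W link by (intro K.m_closed holonomy_carrier pathin_segpath) auto

lemma lift_step:
  assumes p: "pathin T p" and t: "t \<in> {0..1}" "t' \<in> {0..1}" "t \<le> t'"
    and Ws: "W \<in> \<W>" "W' \<in> \<W>" "W \<inter> W' \<noteq> {}" "p t \<in> W" "p t' \<in> W'"
    and U: "U \<in> \<U>" "W \<subseteq> U" "W' \<subseteq> U" "p ` {t..t'} \<subseteq> U"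
  shows "lift p t' W' = lift p t W \<otimes>\<^bsub>K\<^esub> trans W W'"
proof -
  let ?g = "link W (p t) (ctr W)" and ?g' = "link W' (p t') (ctr W')" and ?s = "segpath t t' p"
  note g = link[OF Ws(1,4) conjunct2[OF W[OF Ws(1)]]] link[OF Ws(2,5) conjunct2[OF W[OF Ws(2)]]]
  have s0: "pathin T (segpath 0 t p)" "pathin T ?s" using p t by auto
  have im: "path_image ?s \<subseteq> U" using U t by (simp add: path_image_segpath)
  \<comment> \<open>Leads from the center of \<open>W\<close> back to \<open>p t\<close>, along
    \<open>p\<close>, and on to the center of \<open>W'\<close>, all inside \<open>U\<close>; hence
    its holonomy is the transition.\<close>
  let ?r = "reversepath ?g +++ ?s +++ ?g'"
  have r: "hol ?r = trans W W'"
    by (rule trans_eq[of _ _ U]) (use Ws U g s0 im in \<open>auto simp: path_image_join\<close>)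
  have "hol (segpath 0 t' p) = hol (segpath 0 t p +++ ?s)"
    using t by (intro holonomy_homotopic path_homotopic_sym[OF path_homotopic_segpaths[OF p]]) auto
  also have "\<dots> = hol (segpath 0 t p) \<otimes>\<^bsub>K\<^esub> hol ?s"
    using s0 by (intro holonomy_join) auto
  finally have 1: "hol (segpath 0 t' p) = hol (segpath 0 t p) \<otimes>\<^bsub>K\<^esub> hol ?s" .
  have "hol ?s \<otimes>\<^bsub>K\<^esub> hol ?g' = hol (?s +++ ?g')"
    using s0 g by (intro holonomy_join[symmetric]) auto
  also have "\<dots> = hol (?g +++ ?r)"
    by (rule holonomy_eq[of _ _ U]) (use U g s0 im in \<open>auto simp: path_image_join\<close>)
  also have "\<dots> = hol ?g \<otimes>\<^bsub>K\<^esub> hol ?r"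
    using s0 g by (intro holonomy_join) auto
  finally have 2: "hol ?s \<otimes>\<^bsub>K\<^esub> hol ?g' = hol ?g \<otimes>\<^bsub>K\<^esub> hol ?r" .
  have "hol ?r \<in> carrier K" by (rule holonomy_carrier) (use s0 g in auto)
  then show ?thesis
    unfolding lift_def 1 using 2 r s0 g by (simp add: K.m_assoc holonomy_carrier)
qed

text \<open>Both ends are read off in the same \<open>W\<close>, so by cancellation
  \<open>hol p\<close> is trivial as soon as the two lifts agree.\<close>

lemma lift_start:
  assumes "loop_at T x p" "W \<in> \<W>" "x \<in> W"
  shows "lift p 0 W = hol (link W x (ctr W))" "lift p 1 W = hol p \<otimes>\<^bsub>K\<^esub> hol (link W x (ctr W))"
proof -
  have p: "p 0 = x" "p 1 = x" using assms(1) by (auto simp: loop_at_def pathstart_def pathfinish_def)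
  obtain U where U: "U \<in> \<U>" "W \<subseteq> U" using star[OF x] assms(2,3) by metis
  have "hol (\<lambda>t. x) = \<one>\<^bsub>K\<^esub>"
    by (rule holonomy_loop_in[OF _ _ U(1)]) (use assms U x in auto)
  moreover have "hol (link W x (ctr W)) \<in> carrier K"
    using link W assms by (intro holonomy_carrier) auto
  ultimately show "lift p 0 W = hol (link W x (ctr W))" by (simp add: lift_def segpath_trivial p)
  show "lift p 1 W = hol p \<otimes>\<^bsub>K\<^esub> hol (link W x (ctr W))" by (simp add: lift_def segpath_full p)
qed

text \<open>The first coordinate is the homotopy parameter, the second the loop parameter. By
  \<open>loc\<close>, nearby choices of \<open>\<omega>\<close> share a point, so
  \<open>trans\<close> along \<open>\<omega>\<close> is a local cocycle and has a primitive
  \<open>s\<close>. On the edge carrying \<open>p\<close>, the lift changes exactly as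
  \<open>s\<close> does; on the other three edges \<open>\<omega>\<close> and hence \<open>s\<close>
  are constant.\<close>

lemma monodromy:
  fixes \<omega> :: "real \<times> real \<Rightarrow> 'a set"
  assumes p: "loop_at T x p"
    and W\<omega>: "\<And>q. q \<in> {0..1} \<times> {0..1} \<Longrightarrow> \<omega> q \<in> \<W>"
    and loc: "\<And>q. q \<in> {0..1} \<times> {0..1} \<Longrightarrow> \<exists>N y. open N \<and> q \<in> N \<and> y \<in> topspace T \<and> (\<forall>q'\<in>N \<inter> {0..1} \<times> {0..1}. y \<in> \<omega> q')"
    and bottom: "\<And>t. t \<in> {0..1} \<Longrightarrow> p t \<in> \<omega> (0, t)"
    and sides: "\<And>t. t \<in> {0..1} \<Longrightarrow> \<omega> (1, t) = W0 \<and> \<omega> (t, 0) = W0 \<and> \<omega> (t, 1) = W0"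
  shows "hol p = \<one>\<^bsub>K\<^esub>"
proof -
  let ?Q = "{0..1::real} \<times> {0..1::real}"
  let ?\<N> = "{N. open N \<and> (\<exists>y\<in>topspace T. \<forall>q'\<in>N \<inter> ?Q. y \<in> \<omega> q')}"
  obtain e where e: "e > 0" "\<And>q. q \<in> ?Q \<Longrightarrow> \<exists>N\<in>?\<N>. ball q e \<subseteq> N"
  proof (rule Heine_Borel_lemma)
    show "compact ?Q" by (intro compact_Times) auto
    show "?Q \<subseteq> \<Union>?\<N>" using loc by blast
  qed auto
  have y: "\<exists>y\<in>topspace T. \<forall>q'\<in>ball q e \<inter> ?Q. y \<in> \<omega> q'" if "q \<in> ?Q" for q
    using e(2)[OF that] by blast
  define c where "c q q' = trans (\<omega> q) (\<omega> q')" for q q'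
  obtain s d where d: "d > 0" and s: "\<And>q. q \<in> ?Q \<Longrightarrow> s q \<in> carrier K"
    and sc: "\<And>q q'. q \<in> ?Q \<Longrightarrow> q' \<in> ?Q \<Longrightarrow> dist q q' < d \<Longrightarrow> s q' = s q \<otimes>\<^bsub>K\<^esub> c q q'"
  proof (rule uniformly_local_cocycle_is_coboundary[of K ?Q e c])
    show "group K" by (rule group_holonomy_group)
    show "bounded ?Q" "convex ?Q" by (auto intro!: bounded_Times convex_Times)
    fix q q1 q2 q3 assume q: "q \<in> ?Q" "{q1, q2, q3} \<subseteq> ?Q \<inter> ball q e"
    then obtain z where "\<forall>q'\<in>ball q e \<inter> ?Q. z \<in> \<omega> q'" using y by blast
    then have "z \<in> \<omega> q1" "z \<in> \<omega> q2" "z \<in> \<omega> q3" "\<omega> q1 \<in> \<W>" "\<omega> q2 \<in> \<W>" "\<omega> q3 \<in> \<W>"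
      using q W\<omega> by auto
    then show "c q1 q2 \<in> carrier K \<and> c q1 q3 = c q1 q2 \<otimes>\<^bsub>K\<^esub> c q2 q3"
      unfolding c_def using trans_cocycle by blast
  qed (use e(1) that in blast)+
  \<comment> \<open>The mesh is below \<open>d\<close> for the use of the primitive and below
    \<open>e\<close> for a common point of neighbouring members.\<close>
  obtain n :: nat where n: "inverse (real n) < min d e" "n \<noteq> 0"
    using ex_inverse_of_nat_less[of "min d e"] d e by auto
  define t where "t k = real k / real n" for k
  have t01: "t k \<in> {0..1}" if "k \<le> n" for k using that by (auto simp: t_def divide_simps)
  have t_dist: "dist (t k) (t (Suc k)) < min d e" for k
    using n by (simp add: t_def dist_real_def add_divide_distrib inverse_eq_divide)
  have t_ends: "t 0 = 0" "t n = 1" using n by (auto simp: t_def)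
  have t_mono: "t k \<le> t (Suc k)" for k by (simp add: t_def divide_right_mono)
  have const: "s (f k) = s (f 0)" if f: "\<And>k. k \<le> n \<Longrightarrow> f k \<in> ?Q \<and> \<omega> (f k) = W0"
    "\<And>k. dist (f k) (f (Suc k)) < d" and "k \<le> n" for f k
    using \<open>k \<le> n\<close>
  proof (induction k)
    case (Suc k)
    have "W0 \<in> \<W>" using f(1)[of 0] W\<omega> by force
    then have "c (f k) (f (Suc k)) = \<one>\<^bsub>K\<^esub>" using f(1)[of k] f(1)[of "Suc k"] Suc by (simp add: c_def trans_self)
    then show ?case using sc[OF _ _ f(2), of k] f(1)[of k] f(1)[of "Suc k"] Suc s[of "f 0"] f(1)[of 0] by simp
  qed simp
  \<comment> \<open>The detour over \<open>(1, 0)\<close> and \<open>(1, 1)\<close> stays where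
    \<open>\<omega>\<close> is \<open>W0\<close>, and \<open>trans W0 W0\<close> is the
    unit.\<close>
  have "s (0, 1) = s (0, 0)"
  proof -
    have "s (1, 0) = s (0, 0)"
      using const[of "\<lambda>k. (t k, 0)" n] t01 t_dist sides by (auto simp: t_ends dist_Pair_Pair)
    moreover have "s (1, 1) = s (1, 0)"
      using const[of "\<lambda>k. (1, t k)" n] t01 t_dist sides by (auto simp: t_ends dist_Pair_Pair)
    moreover have "s (1, 1) = s (0, 1)"
      using const[of "\<lambda>k. (t k, 1)" n] t01 t_dist sides by (auto simp: t_ends dist_Pair_Pair)
    ultimately show ?thesis by simp
  qed
  have pT: "pathin T p" using p by (simp add: loop_at_def)
  have car: "lift p 0 (\<omega> (0,0)) \<in> carrier K" "s (0, 0) \<in> carrier K"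
    using lift_carrier[OF pT] W\<omega> bottom s by auto
  \<comment> \<open>The lift and \<open>s\<close> are multiplied on the right by the same
    transitions, so they differ by a constant left factor.\<close>
  have "lift p (t k) (\<omega> (0, t k)) = lift p 0 (\<omega> (0,0)) \<otimes>\<^bsub>K\<^esub> inv\<^bsub>K\<^esub> s (0,0) \<otimes>\<^bsub>K\<^esub> s (0, t k)" if "k \<le> n" for k
    using that
  proof (induction k)
    case 0
    then show ?case using car by (simp add: t_ends K.m_assoc)
  next
    case (Suc k)
    let ?q = "(0, t k)" and ?q' = "(0, t (Suc k))"
    have Q: "?q \<in> ?Q" "?q' \<in> ?Q" using t01[of k] t01[of "Suc k"] Suc by auto
    obtain y where yT: "y \<in> topspace T" and y: "\<And>r. r \<in> ball ?q e \<inter> ?Q \<Longrightarrow> y \<in> \<omega> r" using y[OF Q(1)] by auto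
    obtain U where U: "U \<in> \<U>" "\<And>W. W \<in> \<W> \<Longrightarrow> y \<in> W \<Longrightarrow> W \<subseteq> U" using star[OF yT] by blast
    have near: "(0, r) \<in> ball ?q e \<inter> ?Q" if "r \<in> {t k..t (Suc k)}" for r
      using that t_dist[of k] t01[of k] t01[of "Suc k"] Suc.prems by (auto simp: dist_Pair_Pair dist_real_def)
    have yy: "y \<in> \<omega> ?q" "y \<in> \<omega> ?q'" and \<omega>\<W>: "\<omega> ?q \<in> \<W>" "\<omega> ?q' \<in> \<W>"
      using y[OF near[of "t k"]] y[OF near[of "t (Suc k)"]] t_mono[of k] W\<omega> Q by auto
    have *: "lift p (t (Suc k)) (\<omega> ?q') = lift p (t k) (\<omega> ?q) \<otimes>\<^bsub>K\<^esub> trans (\<omega> ?q) (\<omega> ?q')"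
    proof (rule lift_step[of _ _ _ _ _ U])
      show "\<omega> ?q \<inter> \<omega> ?q' \<noteq> {}" using yy by blast
      show "\<omega> ?q \<subseteq> U" "\<omega> ?q' \<subseteq> U" using U(2) yy \<omega>\<W> by blast+
      \<comment> \<open>Every \<open>\<omega> (0, r)\<close> with \<open>r\<close> in this interval
        contains \<open>y\<close>, so all of them, and with them the points \<open>p r\<close>, lie
        in the one \<open>U\<close> chosen for \<open>y\<close>.\<close>
      show "p ` {t k..t (Suc k)} \<subseteq> U"
      proof clarify
        fix r assume r: "r \<in> {t k..t (Suc k)}"
        have "p r \<in> \<omega> (0, r)" "\<omega> (0, r) \<in> \<W>" using near[OF r] bottom W\<omega> by auto
        moreover have "\<omega> (0, r) \<subseteq> U" using U(2) y[OF near[OF r]] calculation(2) by blast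
        ultimately show "p r \<in> U" by blast
      qed
    qed (use Q \<omega>\<W> bottom pT t_mono U(1) in auto)
    have "s ?q' = s ?q \<otimes>\<^bsub>K\<^esub> trans (\<omega> ?q) (\<omega> ?q')"
      using sc[OF Q] t_dist[of k] by (simp add: dist_Pair_Pair c_def)
    moreover have "trans (\<omega> ?q) (\<omega> ?q') \<in> carrier K"
      by (rule trans_cocycle(1)[of _ _ "\<omega> ?q'" y]) (use \<omega>\<W> yy in auto)
    ultimately show ?case
      using * Suc car s Q by (simp add: K.m_assoc)
  qed
  from this[of n] have "lift p 1 (\<omega> (0,1)) = lift p 0 (\<omega> (0,0))"
    using car \<open>s (0, 1) = s (0, 0)\<close> by (simp add: t_ends K.m_assoc)
  moreover have W0: "W0 \<in> \<W>" "x \<in> W0" "\<omega> (0,0) = W0" "\<omega> (0,1) = W0"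
    using W\<omega>[of "(0,0)"] sides bottom[of 0] p by (auto simp: loop_at_def pathstart_def)
  moreover have "hol (link W0 x (ctr W0)) \<in> carrier K" "hol p \<in> carrier K"
    using link W W0 pT by (auto intro!: holonomy_carrier)
  ultimately show ?thesis
    using lift_start[OF p W0(1,2)] by simp
qed

end


section \<open>Closedness for locally path connected spaces\<close>

text \<open>
  Around each point take a ball of almost maximal radius contained in an element of the cover.
  Balls of a fifth of these radii that share a point have comparable radii.
\<close>

lemma pointwise_star_refinement:
  fixes X :: "'a::metric_space set"
  assumes "open_cover (top_of_set X) \<U>"
  obtains r where "\<And>z. z \<in> X \<Longrightarrow> r z > 0"
    "\<And>y. y \<in> X \<Longrightarrow> \<exists>U\<in>\<U>. \<forall>z\<in>X. y \<in> ball z (r z) \<longrightarrow> ball z (r z) \<inter> X \<subseteq> U"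
proof -
  \<comment> \<open>The cap at \<open>1\<close> bounds the admissible radii, so their supremum
    exists even if an element of the cover contains all balls.\<close>
  define good where "good z r \<longleftrightarrow> 0 < r \<and> r \<le> 1 \<and> (\<exists>U\<in>\<U>. ball z r \<inter> X \<subseteq> U)" for z r
  have "\<exists>r. good z r \<and> (\<forall>r'. good z r' \<longrightarrow> r' < 2 * r)" if "z \<in> X" for z
  proof -
    have "z \<in> \<Union>\<U>" using assms that by (simp add: open_cover_def)
    then obtain U where U: "U \<in> \<U>" "z \<in> U" "openin (top_of_set X) U"
      using assms unfolding open_cover_def by blast
    then obtain e where "e > 0" "ball z e \<inter> X \<subseteq> U"
      unfolding openin_contains_ball by blast
    then have g: "good z (min e 1)"
      unfolding good_def using U(1) by (intro conjI bexI[of _ U]) auto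
    have bdd: "bdd_above (Collect (good z))" by (auto simp: good_def bdd_above_def)
    let ?S = "Sup (Collect (good z))"
    have "0 < ?S" using cSup_upper[OF _ bdd, of "min e 1"] g \<open>e > 0\<close> by (auto simp: min_def split: if_splits)
    then have "\<exists>r\<in>Collect (good z). ?S / 2 < r"
      using less_cSup_iff[OF _ bdd, of "?S / 2"] g by auto
    then obtain r where r: "good z r" "?S / 2 < r" by blast
    moreover have "r' < 2 * r" if "good z r'" for r'
      using cSup_upper[OF _ bdd, of r'] that r by auto
    ultimately show ?thesis by blast
  qed
  then obtain \<rho> where \<rho>: "\<And>z. z \<in> X \<Longrightarrow> good z (\<rho> z)" "\<And>z r'. z \<in> X \<Longrightarrow> good z r' \<Longrightarrow> r' < 2 * \<rho> z"
    by metis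
  show ?thesis
  proof (rule that[of "\<lambda>z. \<rho> z / 5"])
    show "\<rho> z / 5 > 0" if "z \<in> X" for z using \<rho>(1)[OF that] by (simp add: good_def)
    fix y assume y: "y \<in> X"
    obtain U where U: "U \<in> \<U>" "ball y (\<rho> y) \<inter> X \<subseteq> U" using \<rho>(1)[OF y] by (auto simp: good_def)
    have "ball z (\<rho> z / 5) \<inter> X \<subseteq> U" if z: "z \<in> X" "y \<in> ball z (\<rho> z / 5)" for z
    proof -
      have gz: "good z (\<rho> z)" using \<rho>(1) z by blast
      \<comment> \<open>Origin of the fifth: since \<open>4/5 = 1 - 1/5\<close>, this ball is
        admissible at \<open>y\<close>, whence \<open>4 * \<rho> z / 5 < 2 * \<rho> y\<close>. Half
        of this says that \<open>2 * \<rho> z / 5\<close>, the diameter bound of the small ball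
        around \<open>z\<close>, is below \<open>\<rho> y\<close>.\<close>
      have "ball y (4 * \<rho> z / 5) \<subseteq> ball z (\<rho> z)"
      proof
        fix w assume "w \<in> ball y (4 * \<rho> z / 5)"
        then show "w \<in> ball z (\<rho> z)" using z dist_triangle[of z w y] by simp
      qed
      then have "good y (4 * \<rho> z / 5)"
        using gz unfolding good_def by (auto intro: order_trans)
      then have "4 * \<rho> z / 5 < 2 * \<rho> y" using \<rho>(2)[OF y] by blast
      moreover have "dist y w < 2 * \<rho> z / 5" if "w \<in> ball z (\<rho> z / 5)" for w
        using that z dist_triangle[of y w z] by (auto simp: dist_commute)
      ultimately have "ball z (\<rho> z / 5) \<subseteq> ball y (\<rho> y)"
        by (force simp: subset_iff)
      then show ?thesis using U by blast
    qed
    then show "\<exists>U\<in>\<U>. \<forall>z\<in>X. y \<in> ball z (\<rho> z / 5) \<longrightarrow> ball z (\<rho> z / 5) \<inter> X \<subseteq> U"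
      using U(1) by blast
  qed
qed

text \<open>Shrinking each ball to the path component of its center preserves the star property, and
  local path connectedness keeps the components open.\<close>

lemma path_connected_star_refinement:
  fixes X :: "'a::metric_space set"
  assumes "open_cover (top_of_set X) \<U>" and lpc: "locally path_connected X"
  obtains \<W> where "open_cover (top_of_set X) \<W>" "\<And>W. W \<in> \<W> \<Longrightarrow> path_connected W \<and> W \<noteq> {}"
    "\<And>y. y \<in> X \<Longrightarrow> \<exists>U\<in>\<U>. \<forall>W\<in>\<W>. y \<in> W \<longrightarrow> W \<subseteq> U"
proof -
  obtain r where r: "\<And>z. z \<in> X \<Longrightarrow> r z > 0"
    "\<And>y. y \<in> X \<Longrightarrow> \<exists>U\<in>\<U>. \<forall>z\<in>X. y \<in> ball z (r z) \<longrightarrow> ball z (r z) \<inter> X \<subseteq> U"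
    using pointwise_star_refinement[OF assms(1)] by metis
  define C where "C z = path_component_set (ball z (r z) \<inter> X) z" for z
  have Csub: "C z \<subseteq> ball z (r z) \<inter> X" for z
    unfolding C_def by (rule path_component_subset)
  have zC: "z \<in> C z" if "z \<in> X" for z
    using that r(1)[OF that] by (simp add: C_def path_component_refl_eq)
  show ?thesis
  proof (rule that[of "C ` X"])
    have "openin (top_of_set X) (C z)" if "z \<in> X" for z
      using lpc r(1)[OF that] that unfolding C_def locally_path_connected_open_path_component
      by (metis IntI centre_in_ball inf_commute open_ball openin_open_Int)
    then show "open_cover (top_of_set X) (C ` X)"
      using zC Csub by (fastforce simp: open_cover_def)
    show "path_connected W \<and> W \<noteq> {}" if "W \<in> C ` X" for W
      using that zC path_connected_path_component by (auto simp: C_def)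
    fix y assume "y \<in> X"
    from r(2)[OF this] obtain U where U: "U \<in> \<U>" "\<forall>z\<in>X. y \<in> ball z (r z) \<longrightarrow> ball z (r z) \<inter> X \<subseteq> U" ..
    have "C z \<subseteq> U" if "z \<in> X" "y \<in> C z" for z
      using U(2) that Csub[of z] by fast
    then show "\<exists>U\<in>\<U>. \<forall>W\<in>C ` X. y \<in> W \<longrightarrow> W \<subseteq> U"
      using U(1) by (intro bexI[of _ U]) auto
  qed
qed

lemma pointed_space_top_of_set:
  assumes "path_connected X" "x \<in> X"
  shows "pointed_space (top_of_set X) x"
proof
  have "path_connectedin (top_of_set X) X"
    using assms by (simp add: path_connectedin_subtopology)
  then show "path_connected_space (top_of_set X)"
    by (simp add: path_connectedin_def subtopology_subtopology)
qed (use assms in simp)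

text \<open>Both loops pass through the same chain of members, so their lifts change by the same
  transitions and agree at every division point. The index \<open>n\<close> contributes only the
  time \<open>1\<close>, and \<open>V n = V 0\<close> lets both final lifts be read off where they
  started.\<close>

lemma (in nice_cover) holonomy_eq_chain:
  assumes p: "loop_at T x p" and q: "loop_at T x q" and n: "n > 0"
    and V: "\<And>k. k \<le> n \<Longrightarrow> V k \<in> \<W>" "V n = V 0"
    and pV: "\<And>k t. k \<le> n \<Longrightarrow> t \<in> {0..1} \<Longrightarrow> t \<in> {real k / n..real (Suc k) / n} \<Longrightarrow> p t \<in> V k \<and> q t \<in> V k"
  shows "hol p = hol q"
proof -
  define t where "t k = real k / real n" for k
  have t01: "t k \<in> {0..1}" if "k \<le> n" for k using that n by (auto simp: t_def divide_simps)
  have t_mono: "t k \<le> t (Suc k)" for k by (simp add: t_def divide_right_mono)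
  have t_ends: "t 0 = 0" "t n = 1" using n by (auto simp: t_def)
  have pT: "pathin T p" "pathin T q" "p 0 = x" "q 0 = x"
    using p q by (auto simp: loop_at_def pathstart_def)
  have x0: "x \<in> V 0" using pV[of 0 0] pT by simp
  have "lift p (t k) (V k) = lift q (t k) (V k)" if "k \<le> n" for k
    using that
  proof (induction k)
    case 0
    then show ?case using lift_start(1)[OF p _ x0] lift_start(1)[OF q _ x0] V by (simp add: t_ends)
  next
    case (Suc k)
    have pts: "p s \<in> V k" "q s \<in> V k" if "s \<in> {t k..t (Suc k)}" for s
    proof -
      have "s \<in> {0..1}" using that t01[of k] t01[of "Suc k"] Suc.prems by auto
      then show "p s \<in> V k" "q s \<in> V k" using pV[of k s] that Suc.prems by (auto simp: t_def)
    qed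
    have next_pts: "p (t (Suc k)) \<in> V (Suc k)" "q (t (Suc k)) \<in> V (Suc k)"
      using pV[of "Suc k" "t (Suc k)"] t01[of "Suc k"] Suc.prems t_mono[of "Suc k"] by (auto simp: t_def)
    let ?y = "p (t (Suc k))"
    have y: "?y \<in> V k" "?y \<in> V (Suc k)" using pts next_pts t_mono[of k] by auto
    have Vs: "V k \<in> \<W>" "V (Suc k) \<in> \<W>" using V Suc.prems by auto
    have im: "p ` {t k..t (Suc k)} \<subseteq> V k" "q ` {t k..t (Suc k)} \<subseteq> V k" using pts by auto
    have ne: "V k \<inter> V (Suc k) \<noteq> {}" using y by blast
    have "?y \<in> topspace T" using pathin_subset[OF pT(1) t01[OF Suc.prems]] .
    then obtain U where U: "U \<in> \<U>" "V k \<subseteq> U" "V (Suc k) \<subseteq> U" using star Vs y by metis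
    have "lift p (t (Suc k)) (V (Suc k)) = lift p (t k) (V k) \<otimes>\<^bsub>K\<^esub> trans (V k) (V (Suc k))"
      by (rule lift_step[of _ _ _ _ _ U])
        (use pT t01[of k] t01[of "Suc k"] Suc.prems t_mono Vs ne U pts[of "t k"] next_pts order_trans[OF im(1) U(2)] order_trans[OF im(2) U(2)] in simp_all)
    moreover have "lift q (t (Suc k)) (V (Suc k)) = lift q (t k) (V k) \<otimes>\<^bsub>K\<^esub> trans (V k) (V (Suc k))"
      by (rule lift_step[of _ _ _ _ _ U])
        (use pT t01[of k] t01[of "Suc k"] Suc.prems t_mono Vs ne U pts[of "t k"] next_pts order_trans[OF im(1) U(2)] order_trans[OF im(2) U(2)] in simp_all)
    ultimately show ?case using Suc by simp
  qed
  from this[of n] have "lift p 1 (V 0) = lift q 1 (V 0)" using V(2) by (simp add: t_ends)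
  moreover have "hol (link (V 0) x (ctr (V 0))) \<in> carrier K"
    using link W V(1)[of 0] x0 by (intro holonomy_carrier) auto
  ultimately show ?thesis
    using lift_start(2)[OF p _ x0] lift_start(2)[OF q _ x0] V(1)[of 0] pT
    by (simp add: holonomy_carrier)
qed

text \<open>A Lebesgue number for the compact image of \<open>p\<close> attaches a member of
  \<open>\<W>\<close> to each division point, and every sufficiently close loop runs through the
  same chain of members.\<close>

lemma holonomy_locally_constant:
  fixes X :: "'a::metric_space set"
  assumes \<W>: "nice_cover (top_of_set X) x \<U> \<W> ctr" "open_cover (top_of_set X) \<W>"
    and p: "loop_at (top_of_set X) x p"
  obtains e where "e > 0"
    "\<And>q. loop_at (top_of_set X) x q \<Longrightarrow> (\<And>t. t \<in> {0..1} \<Longrightarrow> dist (p t) (q t) < e) \<Longrightarrow>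
       holonomy (top_of_set X) x \<U> p = holonomy (top_of_set X) x \<U> q"
proof -
  interpret nice_cover "top_of_set X" x \<U> \<W> ctr by fact
  have pp: "path p" "path_image p \<subseteq> X" "p 0 = x" "p 1 = x"
    using p by (auto simp: loop_at_def pathin_top_of_set pathstart_def pathfinish_def)
  let ?\<O> = "{G. open G \<and> (\<exists>W\<in>\<W>. G \<inter> X \<subseteq> W)}"
  obtain e where e: "e > 0" "\<And>z. z \<in> path_image p \<Longrightarrow> \<exists>G\<in>?\<O>. ball z e \<subseteq> G"
  proof (rule Heine_Borel_lemma)
    show "compact (path_image p)" using pp by (simp add: compact_path_image)
    show "path_image p \<subseteq> \<Union>?\<O>"
    proof
      fix z assume "z \<in> path_image p"
      then obtain W where "W \<in> \<W>" "z \<in> W" "openin (top_of_set X) W"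
        using pp \<W>(2) unfolding open_cover_def by fastforce
      then show "z \<in> \<Union>?\<O>"
        unfolding openin_open by blast
    qed
  qed blast+
  have "\<exists>W\<in>\<W>. ball z e \<inter> X \<subseteq> W" if z: "z \<in> path_image p" for z
  proof -
    obtain G where G: "\<exists>W\<in>\<W>. G \<inter> X \<subseteq> W" "ball z e \<subseteq> G" using e(2)[OF z] by blast
    from G(1) obtain W where "W \<in> \<W>" "G \<inter> X \<subseteq> W" ..
    then show ?thesis using G(2) by (intro bexI[of _ W]) auto
  qed
  then obtain V where V: "\<And>z. z \<in> path_image p \<Longrightarrow> V z \<in> \<W> \<and> ball z e \<inter> X \<subseteq> V z" by metis
  have "uniformly_continuous_on {0..1} p"
    using pp by (intro compact_uniformly_continuous) (auto simp: path_def)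
  then obtain d where d: "d > 0" "\<And>s t. s \<in> {0..1} \<Longrightarrow> t \<in> {0..1} \<Longrightarrow> dist s t < d \<Longrightarrow> dist (p s) (p t) < e / 2"
    unfolding uniformly_continuous_on_def using e(1) by (metis half_gt_zero)
  obtain n :: nat where n: "inverse (real n) < d" "n \<noteq> 0"
    using ex_inverse_of_nat_less[OF d(1)] by auto
  show ?thesis
  \<comment> \<open>One half of \<open>e\<close> is spent on the oscillation of \<open>p\<close>
    over a division interval, the other on the distance from \<open>p\<close> to
    \<open>q\<close>.\<close>
  proof (rule that[of "e / 2"])
    fix q assume q: "loop_at (top_of_set X) x q" and pq: "\<And>t. t \<in> {0..1} \<Longrightarrow> dist (p t) (q t) < e / 2"
    show "hol p = hol q"
    proof (rule holonomy_eq_chain[OF p q, of n "\<lambda>k. V (p (real k / n))"])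
      show "V (p (real k / n)) \<in> \<W>" if "k \<le> n" for k
        using V[of "p (real k / n)"] that n by (auto simp: path_image_def)
      show "V (p (real n / real n)) = V (p (real 0 / real n))" using n pp by simp
      fix k t assume k: "k \<le> n" and t: "t \<in> {0..1}" "t \<in> {real k / n..real (Suc k) / n}"
      have kn: "real k / n \<in> {0..1}" using k n by auto
      have "dist (real k / n) t < d" using t n by (auto simp: dist_real_def add_divide_distrib inverse_eq_divide)
      then have "dist (p (real k / n)) (p t) < e / 2" using d(2)[OF kn t(1)] by blast
      moreover have "dist (p (real k / n)) (q t) < e"
        using calculation pq[OF t(1)] dist_triangle[of "p (real k / n)" "q t" "p t"] by linarith
      moreover have "p t \<in> X" "q t \<in> X"
        using q p t(1) by (auto simp: loop_at_def pathin_top_of_set path_image_def)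
      ultimately show "p t \<in> V (p (real k / n)) \<and> q t \<in> V (p (real k / n))"
        using V[of "p (real k / n)"] kn \<open>e > 0\<close> by (auto simp: path_image_def)
    qed (use n in auto)
  qed (use e in simp)
qed

section \<open>The sup metric on loops and closedness of the Spanier group\<close>

lemma mspace_dist_less:
  assumes "p \<in> loops (top_of_set X) x" "q \<in> loops (top_of_set X) x" "t \<in> {0..1}"
  shows "dist (p t) (q t) \<le> mdist (loop_metric X x) p q"
  unfolding mdist_loop_metric[OF assms(1,2)]
proof (rule cSUP_upper[OF assms(3)])
  have "path p" "path q" using assms by (auto simp: loops_def pathin_top_of_set)
  then have "compact ((\<lambda>t. dist (p t) (q t)) ` {0..1})"
    unfolding path_def by (intro compact_continuous_image continuous_intros) auto
  then show "bdd_above ((\<lambda>t. dist (p t) (q t)) ` {0..1})"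
    by (intro bounded_imp_bdd_above compact_imp_bounded)
qed

lemma topspace_loop_metric: "topspace (mtopology_of (loop_metric X x)) = loops (top_of_set X) x"
  by (metis mspace_loop_metric topspace_mtopology_of)

lemma openin_loop_metric:
  "openin (mtopology_of (loop_metric X x)) S \<longleftrightarrow> S \<subseteq> loops (top_of_set X) x \<and>
     (\<forall>p\<in>S. \<exists>e>0. \<forall>q\<in>loops (top_of_set X) x. mdist (loop_metric X x) p q < e \<longrightarrow> q \<in> S)"
proof -
  interpret Metric_space "loops (top_of_set X) x" "mdist (loop_metric X x)"
    by (metis Metric_space_mspace_mdist mspace_loop_metric)
  have eq: "mtopology_of (loop_metric X x) = mtopology"
    by (simp add: mtopology_of_def mspace_loop_metric)
  have "mball p e \<subseteq> S \<longleftrightarrow> (\<forall>q\<in>loops (top_of_set X) x. mdist (loop_metric X x) p q < e \<longrightarrow> q \<in> S)"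
    if "p \<in> loops (top_of_set X) x" for p e
    using that by auto
  then have "(\<exists>e>0. mball p e \<subseteq> S) \<longleftrightarrow>
      (\<exists>e>0. \<forall>q\<in>loops (top_of_set X) x. mdist (loop_metric X x) p q < e \<longrightarrow> q \<in> S)"
    if "p \<in> loops (top_of_set X) x" for p
    using that by simp
  then show ?thesis
    unfolding eq openin_mtopology by blast
qed

lemma spanier_group_subset:
  assumes "x \<in> topspace T"
  shows "spanier_group T x \<subseteq> carrier (fundamental_group T x)"
proof -
  have "open_cover T {topspace T}" by (simp add: open_cover_def)
  then show ?thesis
    using spanier_group_cover_subset[OF assms, of "{topspace T}"] unfolding spanier_group_def by blast
qed

lemma nice_cover_exists:
  fixes X :: "'a::metric_space set"
  assumes "open_cover (top_of_set X) \<U>" "locally path_connected X" "path_connected X" "x \<in> X"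
  obtains \<W> ctr where "open_cover (top_of_set X) \<W>" "nice_cover (top_of_set X) x \<U> \<W> ctr"
proof -
  obtain \<W> where \<W>: "open_cover (top_of_set X) \<W>" "\<And>W. W \<in> \<W> \<Longrightarrow> path_connected W \<and> W \<noteq> {}"
    "\<And>y. y \<in> X \<Longrightarrow> \<exists>U\<in>\<U>. \<forall>W\<in>\<W>. y \<in> W \<longrightarrow> W \<subseteq> U"
    using path_connected_star_refinement[OF assms(1,2)] by metis
  have "W \<subseteq> X" if "W \<in> \<W>" for W using \<W>(1) that by (auto simp: open_cover_def)
  then have "nice_cover (top_of_set X) x \<U> \<W> (\<lambda>W. SOME y. y \<in> W)"
    using \<W> pointed_space_top_of_set[OF assms(3,4)]
    by (intro nice_cover.intro nice_cover_axioms.intro) (auto simp: path_connectedin_subtopology some_in_eq)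
  then show ?thesis using that \<W>(1) by blast
qed

text \<open>A loop outside has nontrivial holonomy for some cover, and by local constancy so have
  all nearby loops.\<close>

lemma closed_spanier_group:
  fixes X :: "'a::metric_space set"
  assumes "path_connected X" "x \<in> X" "locally path_connected X"
  shows "closed_in_pi1 X x (spanier_group (top_of_set X) x)"
proof -
  let ?T = "top_of_set X" and ?L = "loops (top_of_set X) x" and ?M = "mtopology_of (loop_metric X x)"
  interpret pointed_space ?T x by (intro pointed_space_top_of_set assms)
  have *: "\<Union>(spanier_group ?T x) = {p \<in> ?L. \<forall>\<U>. open_cover ?T \<U> \<longrightarrow> holonomy ?T x \<U> p = \<one>\<^bsub>holonomy_group ?T x \<U>\<^esub>}"
  proof -
    have "A \<in> spanier_group ?T x \<longleftrightarrow> (\<forall>\<U>. open_cover ?T \<U> \<longrightarrow> A \<in> spanier_group_cover ?T x \<U>)" for A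
      by (auto simp: spanier_group_def)
    then show ?thesis
      unfolding Union_loop_classes[OF spanier_group_subset[OF x]]
      by (simp add: holonomy_eq_one_iff loop_at_loops cong: conj_cong)
  qed
  have "openin ?M (?L - \<Union>(spanier_group ?T x))"
    unfolding openin_loop_metric
  proof (intro conjI ballI)
    fix p assume p: "p \<in> ?L - \<Union>(spanier_group ?T x)"
    then obtain \<U> where \<U>: "open_cover ?T \<U>" "holonomy ?T x \<U> p \<noteq> \<one>\<^bsub>holonomy_group ?T x \<U>\<^esub>"
      unfolding * by blast
    obtain \<W> ctr where "open_cover ?T \<W>" "nice_cover ?T x \<U> \<W> ctr"
      using nice_cover_exists[OF \<U>(1) assms(3,1,2)] .
    then obtain e where e: "e > 0"
      "\<And>q. loop_at ?T x q \<Longrightarrow> (\<And>t. t \<in> {0..1} \<Longrightarrow> dist (p t) (q t) < e) \<Longrightarrow> holonomy ?T x \<U> p = holonomy ?T x \<U> q"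
      using holonomy_locally_constant[of X x \<U> \<W> ctr p] p loop_at_loops by blast
    have "q \<in> ?L - \<Union>(spanier_group ?T x)" if q: "q \<in> ?L" "mdist (loop_metric X x) p q < e" for q
    proof -
      have "holonomy ?T x \<U> p = holonomy ?T x \<U> q"
      proof (rule e(2)[OF loop_at_loops[OF q(1)]])
        show "dist (p t) (q t) < e" if "t \<in> {0..1}" for t
          using p le_less_trans[OF mspace_dist_less[OF _ q(1) that] q(2)] by blast
      qed
      then show ?thesis using \<U> q unfolding * by auto
    qed
    then show "\<exists>e>0. \<forall>q\<in>?L. mdist (loop_metric X x) p q < e \<longrightarrow> q \<in> ?L - \<Union>(spanier_group ?T x)"
      using e(1) by blast
  qed blast
  then show ?thesis
    unfolding closed_in_pi1_def closedin_def topspace_loop_metric using * by blast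
qed


section \<open>Maps into realizations\<close>

lemma topspace_realization: "topspace (realization K) = (\<Union>\<sigma>\<in>K. closed_simplex \<sigma>)"
proof
  show "topspace (realization K) \<subseteq> (\<Union>\<sigma>\<in>K. closed_simplex \<sigma>)"
    using openin_realization[of K "topspace (realization K)"] by simp
  have "(\<Union>\<tau>\<in>K. closed_simplex \<tau>) \<inter> closed_simplex \<sigma> = closed_simplex \<sigma>" if "\<sigma> \<in> K" for \<sigma> :: "'a set"
    using that by blast
  then have "openin (realization K) (\<Union>\<sigma>\<in>K. closed_simplex \<sigma>)"
    unfolding openin_realization by simp
  then show "(\<Union>\<sigma>\<in>K. closed_simplex \<sigma>) \<subseteq> topspace (realization K)"
    by (rule openin_subset)
qed

lemma continuous_map_from_realization:
  assumes "\<And>\<sigma>. \<sigma> \<in> K \<Longrightarrow> continuous_map (top_of_set (closed_simplex \<sigma>)) Y g"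
  shows "continuous_map (realization K) Y g"
  unfolding continuous_map_def
proof (intro conjI allI impI)
  show "g \<in> topspace (realization K) \<rightarrow> topspace Y"
    using assms unfolding topspace_realization continuous_map_def by fastforce
  fix W assume W: "openin Y W"
  have "{b \<in> topspace (realization K). g b \<in> W} \<inter> closed_simplex \<sigma> = {b \<in> closed_simplex \<sigma>. g b \<in> W}"
    if "\<sigma> \<in> K" for \<sigma>
    using that by (auto simp: topspace_realization)
  then show "openin (realization K) {b \<in> topspace (realization K). g b \<in> W}"
    unfolding openin_realization
    using openin_continuous_map_preimage[OF assms W] by (auto simp: topspace_realization)
qed

lemma continuous_map_closed_simplex_realization:
  assumes "\<sigma> \<in> K"
  shows "continuous_map (top_of_set (closed_simplex \<sigma>)) (realization K) (\<lambda>b. b)"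
  unfolding continuous_map_def
proof (intro conjI allI impI)
  show "(\<lambda>b. b) \<in> topspace (top_of_set (closed_simplex \<sigma>)) \<rightarrow> topspace (realization K)"
    using assms by (auto simp: topspace_realization)
  fix W assume "openin (realization K) W"
  then have "openin (top_of_set (closed_simplex \<sigma>)) (W \<inter> closed_simplex \<sigma>)"
    using assms by (simp add: openin_realization)
  moreover have "{b \<in> topspace (top_of_set (closed_simplex \<sigma>)). b \<in> W} = W \<inter> closed_simplex \<sigma>"
    by auto
  ultimately show "openin (top_of_set (closed_simplex \<sigma>)) {b \<in> topspace (top_of_set (closed_simplex \<sigma>)). b \<in> W}"
    by simp
qed

lemma continuous_map_coordinate_realization:
  "continuous_map (realization K) euclideanreal (\<lambda>b. b v)"
  by (intro continuous_map_from_realization)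
    (auto intro: continuous_on_product_coordinates continuous_on_subset)

lemma continuous_map_euclidean_funI:
  fixes h :: "'a \<Rightarrow> 'v \<Rightarrow> real"
  assumes "\<And>v. continuous_map S euclideanreal (\<lambda>z. h z v)"
  shows "continuous_map S euclidean h"
  using continuous_map_componentwise_UNIV[of S "\<lambda>_. euclideanreal" h] assms
  by (simp only: euclidean_product_topology simp_thms)

lemma closed_simplex_support:
  assumes "b \<in> closed_simplex \<tau>" "finite \<tau>" "finite \<sigma>" "{v. b v \<noteq> 0} \<subseteq> \<sigma>"
  shows "b \<in> closed_simplex \<sigma>"
proof -
  have "{v. b v \<noteq> 0} \<subseteq> \<tau>" using assms(1) by (auto simp: closed_simplex_def)
  then have "sum b \<sigma> = sum b {v. b v \<noteq> 0}" "sum b \<tau> = sum b {v. b v \<noteq> 0}"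
    using assms(2-4) by (simp_all add: sum.mono_neutral_right)
  then have "sum b \<sigma> = 1"
    using assms(1) by (simp add: closed_simplex_def)
  then show ?thesis
    using assms by (auto simp: closed_simplex_def)
qed

lemma closed_simplex_supportE:
  assumes "b \<in> closed_simplex \<sigma>" "finite \<sigma>"
  shows "{v. b v \<noteq> 0} \<subseteq> \<sigma>" "{v. b v \<noteq> 0} \<noteq> {}"
proof -
  have "sum b \<sigma> \<noteq> 0" "\<And>v. v \<notin> \<sigma> \<Longrightarrow> b v = 0" using assms by (auto simp: closed_simplex_def)
  then show "{v. b v \<noteq> 0} \<subseteq> \<sigma>" "{v. b v \<noteq> 0} \<noteq> {}"
    using sum.not_neutral_contains_not_neutral[of b \<sigma>] by blast+
qed

definition simplicial_complex :: "'v set set \<Rightarrow> bool" where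
  "simplicial_complex K \<longleftrightarrow> (\<forall>\<sigma>\<in>K. finite \<sigma> \<and> \<sigma> \<noteq> {} \<and> (\<forall>\<tau>\<subseteq>\<sigma>. \<tau> \<noteq> {} \<longrightarrow> \<tau> \<in> K))"

lemma simplicial_complex_support:
  assumes "simplicial_complex K" "b \<in> topspace (realization K)"
  shows "{v. b v \<noteq> 0} \<in> K" "finite {v. b v \<noteq> 0}" "b \<in> closed_simplex {v. b v \<noteq> 0}"
proof -
  obtain \<sigma> where \<sigma>: "\<sigma> \<in> K" "b \<in> closed_simplex \<sigma>" "finite \<sigma>"
    using assms by (auto simp: topspace_realization simplicial_complex_def)
  then show fin: "finite {v. b v \<noteq> 0}" "{v. b v \<noteq> 0} \<in> K"
    using closed_simplex_supportE[OF \<sigma>(2,3)] assms(1) finite_subset by (auto simp: simplicial_complex_def)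
  show "b \<in> closed_simplex {v. b v \<noteq> 0}"
    by (rule closed_simplex_support[OF \<sigma>(2,3) fin(1)]) simp
qed

text \<open>
  Locally, such a map runs in a finite subcomplex, where the weak topology is the topology of
  coordinatewise convergence. This makes it possible to construct homotopies into a realization
  without knowing its products.
\<close>

lemma continuous_map_into_realization:
  assumes K: "simplicial_complex K"
    and coord: "\<And>v. continuous_map S euclideanreal (\<lambda>z. h z v)"
    and into: "\<And>z. z \<in> topspace S \<Longrightarrow> h z \<in> topspace (realization K)"
    and lf: "\<And>z. z \<in> topspace S \<Longrightarrow> \<exists>N. openin S N \<and> z \<in> N \<and> finite {v. \<exists>y\<in>N. h y v \<noteq> 0}"
  shows "continuous_map S (realization K) h"
proof (rule pasting_lemma[where I = "{N. openin S N \<and> finite {v. \<exists>y\<in>N. h y v \<noteq> 0}}" and T = "\<lambda>N. N" and f = "\<lambda>_. h"])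
  fix N assume "N \<in> {N. openin S N \<and> finite {v. \<exists>y\<in>N. h y v \<noteq> 0}}"
  then have N: "openin S N" "finite {v. \<exists>y\<in>N. h y v \<noteq> 0}" by auto
  define F where "F = {v. \<exists>y\<in>N. h y v \<noteq> 0}"
  let ?S = "subtopology S N"
  have top: "topspace ?S = N" using openin_subset[OF N(1)] by auto
  show "continuous_map ?S (realization K) h"
  \<comment> \<open>Over \<open>N\<close> only the finite vertex set \<open>F\<close> is involved.
    The points whose support lies in a given simplex form a closed set, and finitely many such sets
    cover \<open>N\<close>; on each, coordinatewise continuity suffices.\<close>
  proof (rule pasting_lemma_closed[where I = "{\<sigma> \<in> K. \<sigma> \<subseteq> F}" and T = "\<lambda>\<sigma>. {z \<in> topspace ?S. \<forall>v\<in>F - \<sigma>. h z v = 0}" and f = "\<lambda>_. h"])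
    show "finite {\<sigma> \<in> K. \<sigma> \<subseteq> F}"
      using N(2) by (auto simp: F_def intro: finite_subset[OF _ finite_Pow_iff[THEN iffD2]])
    fix \<sigma> assume \<sigma>: "\<sigma> \<in> {\<sigma> \<in> K. \<sigma> \<subseteq> F}"
    have eq: "{z \<in> topspace ?S. \<forall>v\<in>F - \<sigma>. h z v = 0} = topspace ?S \<inter> (\<Inter>v\<in>F - \<sigma>. {z \<in> topspace ?S. h z v \<in> {0}})"
      by auto
    show "closedin ?S {z \<in> topspace ?S. \<forall>v\<in>F - \<sigma>. h z v = 0}"
    proof (cases "F - \<sigma> = {}")
      case False
      then show ?thesis
        unfolding eq
        by (intro closedin_Int closedin_topspace closedin_INT closedin_continuous_map_preimage[of _ euclideanreal]
            continuous_map_from_subtopology coord) auto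
    next
      case True
      then have "{z \<in> topspace ?S. \<forall>v\<in>F - \<sigma>. h z v = 0} = topspace ?S" by auto
      then show ?thesis by (simp only: closedin_topspace)
    qed
    let ?S' = "subtopology ?S {z \<in> topspace ?S. \<forall>v\<in>F - \<sigma>. h z v = 0}"
    have fin: "finite \<sigma>" using \<sigma> K by (auto simp: simplicial_complex_def)
    have "h z \<in> closed_simplex \<sigma>" if z: "z \<in> topspace ?S'" for z
    proof (rule closed_simplex_support)
      have "z \<in> topspace S" using z by auto
      note sc = simplicial_complex_support[OF K into[OF this]]
      show "h z \<in> closed_simplex {v. h z v \<noteq> 0}" "finite {v. h z v \<noteq> 0}" using sc by auto
      show "{v. h z v \<noteq> 0} \<subseteq> \<sigma>" using z top by (auto simp: F_def)
    qed (rule fin)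
    moreover have "continuous_map ?S' euclidean h"
      by (intro continuous_map_euclidean_funI continuous_map_from_subtopology coord)
    ultimately have "continuous_map ?S' (top_of_set (closed_simplex \<sigma>)) h"
      by (auto simp: continuous_map_in_subtopology)
    from continuous_map_compose[OF this continuous_map_closed_simplex_realization[of \<sigma> K]] \<sigma>
    show "continuous_map ?S' (realization K) h" by (simp add: o_def)
  next
    fix z assume z: "z \<in> topspace ?S"
    then have "z \<in> topspace S" by auto
    note sc = simplicial_complex_support[OF K into[OF this]]
    have "{v. h z v \<noteq> 0} \<subseteq> F" using z top by (auto simp: F_def)
    then show "\<exists>\<sigma>. \<sigma> \<in> {\<sigma> \<in> K. \<sigma> \<subseteq> F} \<and> z \<in> {z \<in> topspace ?S. \<forall>v\<in>F - \<sigma>. h z v = 0} \<and> h z = h z"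
      using sc z by (intro exI[of _ "{v. h z v \<noteq> 0}"]) auto
  qed simp
next
  fix z assume "z \<in> topspace S"
  then show "\<exists>N. N \<in> {N. openin S N \<and> finite {v. \<exists>y\<in>N. h y v \<noteq> 0}} \<and> z \<in> N \<and> h z = h z"
    using lf by blast
qed auto

text \<open>The index set in \<open>simplicial_map\<close> varies with \<open>b\<close>; on one
  closed simplex it can be replaced by a fixed finite set, which makes continuity visible.\<close>

lemma simplicial_map_eq_sum:
  assumes "b \<in> closed_simplex \<sigma>" "finite \<sigma>"
  shows "simplicial_map f b w = (\<Sum>v\<in>{v \<in> \<sigma>. f v = w}. b v)"
  unfolding simplicial_map_def using assms
  by (intro sum.mono_neutral_left) (auto simp: closed_simplex_def)

lemma simplicial_map_closed_simplex:
  assumes b: "b \<in> closed_simplex \<sigma>" and fin: "finite \<sigma>"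
  shows "simplicial_map f b \<in> closed_simplex (f ` \<sigma>)"
proof -
  have "(\<Sum>w\<in>f ` \<sigma>. \<Sum>v\<in>{v \<in> \<sigma>. f v = w}. b v) = 1"
    using b sum.image_gen[OF fin, of b f] by (simp add: closed_simplex_def)
  moreover have "(\<Sum>v\<in>{v \<in> \<sigma>. f v = w}. b v) = 0" if "w \<notin> f ` \<sigma>" for w
    using that by (intro sum.neutral) auto
  ultimately show ?thesis
    using b unfolding closed_simplex_def by (auto simp: simplicial_map_eq_sum[OF b fin] intro: sum_nonneg)
qed

lemma continuous_map_simplicial_map:
  assumes K: "simplicial_complex K" and f: "\<And>\<sigma>. \<sigma> \<in> K \<Longrightarrow> f ` \<sigma> \<in> L"
  shows "continuous_map (realization K) (realization L) (simplicial_map f)"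
proof (rule continuous_map_from_realization)
  fix \<sigma> assume \<sigma>: "\<sigma> \<in> K"
  let ?C = "top_of_set (closed_simplex \<sigma>)"
  have fin: "finite \<sigma>" using K \<sigma> by (auto simp: simplicial_complex_def)
  have "continuous_map ?C euclideanreal (\<lambda>b. simplicial_map f b w)" for w
  proof (rule continuous_map_eq)
    show "continuous_map ?C euclideanreal (\<lambda>b. \<Sum>v\<in>{v \<in> \<sigma>. f v = w}. b v)"
      using fin by (auto intro!: continuous_intros continuous_on_product_coordinates continuous_on_subset[OF continuous_on_product_coordinates])
  qed (simp add: simplicial_map_eq_sum[OF _ fin])
  then have "continuous_map ?C euclidean (simplicial_map f)"
    by (rule continuous_map_euclidean_funI)
  then have "continuous_map ?C (top_of_set (closed_simplex (f ` \<sigma>))) (simplicial_map f)"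
    using simplicial_map_closed_simplex[OF _ fin] by (auto simp: continuous_map_in_subtopology)
  from continuous_map_compose[OF this continuous_map_closed_simplex_realization[OF f[OF \<sigma>]]]
  show "continuous_map ?C (realization L) (simplicial_map f)" by (simp add: o_def)
qed

lemma simplicial_map_vertex: "simplicial_map f (vertex v) = vertex (f v)"
proof
  fix w
  have "{u. vertex v u \<noteq> 0 \<and> f u = w} = (if f v = w then {v} else {})"
    by (auto simp: vertex_def indicator_def split: if_splits)
  then show "simplicial_map f (vertex v) w = vertex (f v) w"
    by (auto simp: simplicial_map_def vertex_def)
qed

lemma simplicial_map_nonzero:
  assumes "simplicial_map f b w \<noteq> 0"
  obtains v where "b v \<noteq> 0" "f v = w"
  using sum.not_neutral_contains_not_neutral[OF assms[unfolded simplicial_map_def]] by blast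

section \<open>Nerves and the homomorphisms induced by continuous maps\<close>

lemma simplicial_complex_nerve: "simplicial_complex (nerve_simplices \<U>)"
  unfolding simplicial_complex_def
proof (intro ballI conjI allI impI)
  fix \<sigma> \<tau> assume "\<sigma> \<in> nerve_simplices \<U>" "\<tau> \<subseteq> \<sigma>" "\<tau> \<noteq> {}"
  then have "\<tau> \<subseteq> \<U>" "finite \<tau>" "\<Inter>\<tau> \<noteq> {}"
    using Inter_anti_mono[of \<tau> \<sigma>] finite_subset[of \<tau> \<sigma>] by (auto simp: nerve_simplices_def)
  then show "\<tau> \<in> nerve_simplices \<U>"
    using \<open>\<tau> \<noteq> {}\<close> by (simp add: nerve_simplices_def)
qed (auto simp: nerve_simplices_def)

lemma vertex_in_nerve:
  assumes "U \<in> \<U>" "U \<noteq> {}"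
  shows "vertex U \<in> topspace (nerve \<U>)"
  unfolding nerve_def topspace_realization using assms
  by (intro UN_I[of "{U}"]) (auto simp: nerve_simplices_def closed_simplex_def vertex_def)

text \<open>A common point of the members of a simplex also lies in their images under
  \<open>f\<close>, which are larger sets; hence simplices go to simplices.\<close>

lemma continuous_map_vertex_assignment:
  assumes "vertex_assignment (\<V>, V) (\<U>, U) f"
  shows "continuous_map (nerve \<V>) (nerve \<U>) (simplicial_map f)"
  unfolding nerve_def
proof (rule continuous_map_simplicial_map[OF simplicial_complex_nerve])
  fix \<sigma> assume "\<sigma> \<in> nerve_simplices \<V>"
  then obtain y where \<sigma>: "\<sigma> \<subseteq> \<V>" "finite \<sigma>" "\<sigma> \<noteq> {}" and y: "\<And>W. W \<in> \<sigma> \<Longrightarrow> y \<in> W"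
    by (auto simp: nerve_simplices_def)
  have "y \<in> \<Inter>(f ` \<sigma>)" using assms \<sigma> y by (fastforce simp: vertex_assignment_def)
  moreover have "f ` \<sigma> \<subseteq> \<U>" using assms \<sigma> by (auto simp: vertex_assignment_def)
  ultimately show "f ` \<sigma> \<in> nerve_simplices \<U>" using \<sigma> unfolding nerve_simplices_def by blast
qed

lemma induced_hom_loop_class:
  assumes p: "loop_at S x p" and f: "continuous_map S T f" "f x = y"
  shows "induced_hom T y f (loop_class S x p) = loop_class T y (f \<circ> p)" "loop_at T y (f \<circ> p)"
proof -
  have l: "loop_at T y (f \<circ> q)" if "loop_at S x q" for q
    using that f continuous_map_compose[of unit_interval S q T f]
    by (auto simp: loop_at_def pathin_def pathstart_def pathfinish_def)
  then show "loop_at T y (f \<circ> p)" using p by blast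
  show "induced_hom T y f (loop_class S x p) = loop_class T y (f \<circ> p)"
    unfolding induced_hom_def
    using loop_class_eqI[OF l[OF p] path_homotopic_image[OF _ f(1)]] by (intro UN_loop_class_const p) simp
qed


section \<open>Barycentric maps and open stars\<close>

definition weight :: "'a topology \<Rightarrow> 'a set set \<Rightarrow> 'a set \<Rightarrow> 'a \<Rightarrow> real" where
  "weight T \<V> = (SOME \<rho>. partition_of_unity T \<V> \<rho>)"

lemma barycentric_map_eq: "barycentric_map T \<V> z V = (if V \<in> \<V> then weight T \<V> V z else 0)"
  by (simp add: barycentric_map_def weight_def)

locale partitioned_cover =
  fixes T :: "'a::topological_space topology" and \<V> :: "'a set set"
  assumes cover: "open_cover T \<V>" and ex_partition: "\<exists>\<rho>. partition_of_unity T \<V> \<rho>"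
begin

abbreviation "\<rho> \<equiv> weight T \<V>"
abbreviation "b \<equiv> barycentric_map T \<V>"

lemma partition: "partition_of_unity T \<V> \<rho>"
  unfolding weight_def by (rule someI_ex[OF ex_partition])

lemma weight_nonzero: "V \<in> \<V> \<Longrightarrow> z \<in> topspace T \<Longrightarrow> \<rho> V z \<noteq> 0 \<Longrightarrow> z \<in> V"
  using partition closure_of_subset[of "{z \<in> topspace T. \<rho> V z \<noteq> 0}" T]
  unfolding partition_of_unity_def by blast

lemma barycentric_nonzero: "z \<in> topspace T \<Longrightarrow> b z V \<noteq> 0 \<Longrightarrow> V \<in> \<V> \<and> z \<in> V \<and> \<rho> V z \<noteq> 0"
  by (auto simp: barycentric_map_eq intro: weight_nonzero split: if_splits)

lemma locally_finite_support:
  assumes "z \<in> topspace T"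
  shows "\<exists>N. openin T N \<and> z \<in> N \<and> finite {V. \<exists>y\<in>N. b y V \<noteq> 0}"
proof -
  obtain N where "openin T N" "z \<in> N" "finite {V\<in>\<V>. \<exists>y\<in>N. \<rho> V y \<noteq> 0}"
    using partition assms unfolding partition_of_unity_def by blast
  moreover have "{V. \<exists>y\<in>N. b y V \<noteq> 0} = {V\<in>\<V>. \<exists>y\<in>N. \<rho> V y \<noteq> 0}"
    by (auto simp: barycentric_map_eq)
  ultimately show ?thesis by auto
qed

text \<open>The point \<open>z\<close> itself witnesses that the elements with nonzero weight at
  \<open>z\<close> have a common point.\<close>

lemma barycentric_in_simplex:
  assumes z: "z \<in> topspace T"
  shows "{V. b z V \<noteq> 0} \<in> nerve_simplices \<V>" "b z \<in> closed_simplex {V. b z V \<noteq> 0}"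
proof -
  let ?\<sigma> = "{V. b z V \<noteq> 0}"
  obtain N where "z \<in> N" "finite {V. \<exists>y\<in>N. b y V \<noteq> 0}"
    using locally_finite_support[OF z] by blast
  then have fin: "finite ?\<sigma>" by (auto elim: finite_subset[rotated])
  have eq: "?\<sigma> = {V. V \<in> \<V> \<and> \<rho> V z \<noteq> 0}" by (auto simp: barycentric_map_eq)
  have "(\<Sum>V\<in>?\<sigma>. b z V) = (\<Sum>V | V \<in> \<V> \<and> \<rho> V z \<noteq> 0. \<rho> V z)"
    unfolding eq by (intro sum.cong) (auto simp: barycentric_map_eq)
  then have sum: "(\<Sum>V\<in>?\<sigma>. b z V) = 1"
    using partition z by (simp add: partition_of_unity_def)
  have "0 \<le> b z V" for V
    using partition z by (simp add: partition_of_unity_def barycentric_map_eq)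
  with sum show "b z \<in> closed_simplex ?\<sigma>" by (simp add: closed_simplex_def)
  have "?\<sigma> \<noteq> {}" using sum by (metis sum.empty zero_neq_one)
  moreover have "z \<in> \<Inter>?\<sigma>" using barycentric_nonzero[OF z] by auto
  ultimately show "?\<sigma> \<in> nerve_simplices \<V>"
    using fin barycentric_nonzero[OF z] unfolding nerve_simplices_def by blast
qed

lemma barycentric_in_nerve: "z \<in> topspace T \<Longrightarrow> b z \<in> topspace (nerve \<V>)"
  unfolding nerve_def topspace_realization using barycentric_in_simplex by blast

lemma continuous_map_barycentric_coordinate: "continuous_map T euclideanreal (\<lambda>z. b z V)"
  using partition by (simp add: partition_of_unity_def barycentric_map_eq)

lemma continuous_map_barycentric: "continuous_map T (nerve \<V>) b"
  unfolding nerve_def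
  using barycentric_in_nerve[unfolded nerve_def]
  by (intro continuous_map_into_realization simplicial_complex_nerve
      continuous_map_barycentric_coordinate locally_finite_support)

lemma barycentric_vertex:
  assumes "z \<in> topspace T" "\<And>W. W \<in> \<V> \<Longrightarrow> z \<in> W \<Longrightarrow> W = V"
  shows "b z = vertex V"
proof -
  have "{W. b z W \<noteq> 0} = {V}"
    using barycentric_in_simplex(1)[OF assms(1)] barycentric_nonzero[OF assms(1)] assms(2)
    by (auto simp: nerve_simplices_def)
  then have "b z \<in> closed_simplex {V}"
    using barycentric_in_simplex(2)[OF assms(1)] by simp
  then show ?thesis
    by (auto simp: closed_simplex_def vertex_def indicator_def fun_eq_iff)
qed

definition cone :: "'a set \<Rightarrow> (real \<Rightarrow> 'a) \<Rightarrow> real \<times> real \<Rightarrow> 'a set \<Rightarrow> real" where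
  "cone V l q W = (1 - fst q) * b (l (snd q)) W + fst q * vertex V W"

text \<open>Since the weight of \<open>V\<close> does not vanish along \<open>l\<close>, the vertex
  \<open>V\<close> belongs to the support of each \<open>b (l t)\<close>. The segment from
  \<open>b (l t)\<close> to \<open>vertex V\<close> therefore stays in the closed simplex of that
  support, and no new simplices have to be found.\<close>

lemma continuous_map_cone:
  assumes l: "pathin T l" and V: "V \<in> \<V>" "\<And>t. t \<in> {0..1} \<Longrightarrow> \<rho> V (l t) \<noteq> 0"
  shows "continuous_map (top_of_set ({0..1} \<times> {0..1})) (nerve \<V>) (cone V l)"
  unfolding nerve_def
proof (rule continuous_map_into_realization[OF simplicial_complex_nerve])
  let ?Q = "top_of_set ({0..1::real} \<times> {0..1::real})"
  have snd: "continuous_map ?Q unit_interval snd"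
    by (auto intro: continuous_intros)
  have ls: "continuous_map ?Q T (\<lambda>q. l (snd q))"
    using continuous_map_compose[OF snd l[unfolded pathin_def]] by (simp add: o_def)
  show "continuous_map ?Q euclideanreal (\<lambda>q. cone V l q W)" for W
  proof -
    have "continuous_map ?Q euclideanreal (\<lambda>q. b (l (snd q)) W)"
      using continuous_map_compose[OF ls continuous_map_barycentric_coordinate[of W]] by (simp add: o_def)
    then show ?thesis
      unfolding cone_def by (auto intro!: continuous_intros)
  qed
  fix q assume q: "q \<in> topspace ?Q"
  define z where "z = l (snd q)"
  have z: "z \<in> topspace T" using q pathin_subset[OF l] by (auto simp: z_def)
  let ?\<sigma> = "{W. b z W \<noteq> 0}"
  note \<sigma> = barycentric_in_simplex[OF z]
  have V\<sigma>: "V \<in> ?\<sigma>" using V q by (auto simp: z_def barycentric_map_eq)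
  have fin: "finite ?\<sigma>" using \<sigma>(1) by (auto simp: nerve_simplices_def)
  have "(\<Sum>W\<in>?\<sigma>. cone V l q W) = (1 - fst q) * (\<Sum>W\<in>?\<sigma>. b z W) + fst q * (\<Sum>W\<in>?\<sigma>. vertex V W)"
    by (simp add: cone_def z_def sum.distrib sum_distrib_left)
  also have "(\<Sum>W\<in>?\<sigma>. vertex V W) = 1"
    using V\<sigma> fin by (simp add: vertex_def indicator_def sum.delta)
  finally have "(\<Sum>W\<in>?\<sigma>. cone V l q W) = 1"
    using \<sigma>(2) by (simp add: closed_simplex_def)
  moreover have "0 \<le> cone V l q W" for W
    using q \<sigma>(2) by (auto simp: cone_def closed_simplex_def vertex_def z_def)
  moreover have "cone V l q W = 0" if "W \<notin> ?\<sigma>" for W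
    using that V\<sigma> by (auto simp: cone_def vertex_def indicator_def z_def)
  ultimately have "cone V l q \<in> closed_simplex ?\<sigma>" by (simp add: closed_simplex_def)
  then show "cone V l q \<in> topspace (realization (nerve_simplices \<V>))"
    using \<sigma>(1) by (auto simp: topspace_realization)
  obtain N where N: "openin T N" "z \<in> N" "finite {V. \<exists>y\<in>N. b y V \<noteq> 0}"
    using locally_finite_support[OF z] by blast
  let ?N = "{q \<in> topspace ?Q. l (snd q) \<in> N}"
  have "{W. \<exists>q\<in>?N. cone V l q W \<noteq> 0} \<subseteq> insert V {V. \<exists>y\<in>N. b y V \<noteq> 0}"
    by (auto simp: cone_def vertex_def indicator_def split: if_splits)
  then have "finite {W. \<exists>q\<in>?N. cone V l q W \<noteq> 0}"
    using N(3) finite_subset by blast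
  moreover have "openin ?Q ?N" by (rule openin_continuous_map_preimage[OF ls N(1)])
  moreover have "q \<in> ?N" using q N(2) by (simp add: z_def)
  ultimately show "\<exists>N. openin ?Q N \<and> q \<in> N \<and> finite {W. \<exists>q\<in>N. cone V l q W \<noteq> 0}" by blast
qed

text \<open>Coning off to \<open>vertex V\<close> moves the base point, so it is not a based
  homotopy. Instead the path is pushed around the other three sides of the square: out along a ray,
  constant at the vertex, and back along the same ray.\<close>

lemma path_homotopic_in_star:
  assumes l: "pathin T l" "pathfinish l = pathstart l" and V: "V \<in> \<V>" "\<And>t. t \<in> {0..1} \<Longrightarrow> \<rho> V (l t) \<noteq> 0"
  shows "path_homotopic (nerve \<V>) (b \<circ> l) (\<lambda>t. b (pathstart l))"
proof -
  let ?Q = "{0..1::real} \<times> {0..1::real}"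
  \<comment> \<open>On the first third \<open>a\<close> rises to \<open>1\<close>, on the last it
    returns to \<open>0\<close>; \<open>u\<close> runs from \<open>0\<close> to \<open>1\<close> on
    the middle third.\<close>
  define a where "a t = max 0 (min 1 (min (3 * t) (3 - 3 * t)))" for t :: real
  define u where "u t = max 0 (min 1 (3 * t - 1))" for t :: real
  have c: "continuous_map (top_of_set ?Q) (nerve \<V>) (cone V l)"
    by (rule continuous_map_cone[OF l(1) V])
  have "homotopic_paths ?Q (\<lambda>t. (0, t)) (\<lambda>t. (a t, u t))"
  proof (rule homotopic_paths_linear)
    show "path (\<lambda>t::real. (0::real, t))" "path (\<lambda>t. (a t, u t))"
      by (auto simp: path_def a_def u_def intro!: continuous_intros)
    show "closed_segment (0, t) (a t, u t) \<subseteq> ?Q" if "t \<in> {0..1}" for t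
      using that by (intro closed_segment_subset convex_Times) (auto simp: a_def u_def)
  qed (auto simp: pathstart_def pathfinish_def a_def u_def)
  then have "path_homotopic (top_of_set ?Q) (\<lambda>t. (0, t)) (\<lambda>t. (a t, u t))"
    by (simp add: homotopic_paths_def path_homotopic_def)
  from path_homotopic_image[OF this c]
  have 1: "path_homotopic (nerve \<V>) (\<lambda>t. cone V l (0, t)) (\<lambda>t. cone V l (a t, u t))"
    by (simp add: o_def)
  \<comment> \<open>On the outer thirds \<open>u\<close> is \<open>0\<close> or \<open>1\<close>,
    where the closed path \<open>l\<close> has the same value; on the middle third \<open>a\<close>
    is \<open>1\<close>, where the cone is constant.\<close>
  have "cone V l (a t, u t) = cone V l (a t, 0)" if "t \<in> {0..1}" for t
  proof -
    consider "t \<le> 1/3" | "2/3 \<le> t" | "1/3 \<le> t" "t \<le> 2/3" by linarith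
    then show ?thesis
    proof cases
      case 1 then have "u t = 0" by (auto simp: u_def)
      then show ?thesis by simp
    next
      case 2 then have "u t = 1" by (auto simp: u_def)
      then show ?thesis using l(2) by (simp add: cone_def fun_eq_iff pathstart_def pathfinish_def)
    next
      case 3 then have "a t = 1" by (auto simp: a_def)
      then show ?thesis by (simp add: cone_def fun_eq_iff)
    qed
  qed
  moreover have "pathin (nerve \<V>) (\<lambda>t. cone V l (a t, u t))" using path_homotopicD(2)[OF 1] .
  ultimately have 2: "path_homotopic (nerve \<V>) (\<lambda>t. cone V l (a t, u t)) (\<lambda>t. cone V l (a t, 0))"
    by (intro path_homotopic_eq) auto
  have "continuous_map unit_interval (top_of_set ?Q) (\<lambda>s. (s, 0))"
    by (auto intro!: continuous_intros)
  then have "pathin (nerve \<V>) (\<lambda>s. cone V l (s, 0))"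
    using continuous_map_compose[OF _ c, of unit_interval "\<lambda>s. (s, 0)"] by (simp add: pathin_def o_def)
  moreover have "continuous_on {0..1} a" "a \<in> {0..1} \<rightarrow> {0..1}" "a 0 = 0" "a 1 = 0"
    by (auto simp: a_def[abs_def] intro!: continuous_intros)
  \<comment> \<open>What remains goes out and back along one ray, so it is contracted by
    reparametrisation.\<close>
  ultimately have 3: "path_homotopic (nerve \<V>) (\<lambda>t. cone V l (a t, 0)) (\<lambda>t. cone V l (0, 0))"
    using path_homotopic_reparam[of "nerve \<V>" "\<lambda>s. cone V l (s, 0)" a "\<lambda>t. 0"] by (simp add: o_def)
  have "cone V l (0, t) = (b \<circ> l) t" for t by (simp add: cone_def fun_eq_iff)
  then show ?thesis
    using path_homotopic_trans[OF path_homotopic_trans[OF 1 2] 3]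
    by (simp add: o_def pathstart_def)
qed

text \<open>The Spanier condition is applied to the sets of nonvanishing weight instead of
  \<open>\<V>\<close>: a head inside some \<open>V\<close> may leave the support of its weight,
  whereas a head in a nonvanishing set maps into an open star.\<close>

lemma spanier_null_in_nerve:
  assumes x: "x \<in> topspace T" and p: "loop_at T x p" "loop_class T x p \<in> spanier_group T x"
  shows "path_homotopic (nerve \<V>) (b \<circ> p) (\<lambda>t. b x)"
proof -
  let ?\<W> = "(\<lambda>V. {z \<in> topspace T. \<rho> V z \<noteq> 0}) ` \<V>"
  have "openin T {z \<in> topspace T. \<rho> V z \<noteq> 0}" if "V \<in> \<V>" for V
  proof -
    have "openin T {z \<in> topspace T. \<rho> V z \<in> - {0}}"
      using partition that by (intro openin_continuous_map_preimage[of T euclideanreal]) (auto simp: partition_of_unity_def)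
    then show ?thesis by simp
  qed
  moreover have "\<exists>V\<in>\<V>. \<rho> V z \<noteq> 0" if "z \<in> topspace T" for z
    using barycentric_in_simplex(1)[OF that] barycentric_nonzero[OF that]
    by (auto simp: nerve_simplices_def)
  ultimately have "open_cover T ?\<W>" unfolding open_cover_def by auto
  then have "loop_class T x p \<in> spanier_group_cover T x ?\<W>"
    using p(2) by (auto simp: spanier_group_def)
  from this p(1) x show ?thesis
  proof (induction rule: spanier_group_cover_induct)
    case const
    then show ?case using barycentric_in_nerve x by (simp add: o_def)
  next
    case (lollipop r l U)
    then obtain V where V: "V \<in> \<V>" "path_image l \<subseteq> {z \<in> topspace T. \<rho> V z \<noteq> 0}" by blast
    let ?r = "b \<circ> r" and ?y = "b (pathfinish r)"
    note [simp] = lollipop(1,2)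
    have r: "pathin (nerve \<V>) ?r" "pathfinish ?r = ?y" "pathstart ?r = b x"
      using continuous_map_compose[OF _ continuous_map_barycentric, of unit_interval r] lollipop(1,2)
      by (auto simp: pathin_def pathfinish_def pathstart_def)
    have l: "pathin T l" "pathfinish l = pathstart l" "pathstart l = pathfinish r"
      using lollipop(3) by (auto simp: loop_at_def)
    have "path_homotopic (nerve \<V>) (b \<circ> l) (\<lambda>t. ?y)"
    proof -
      have "\<rho> V (l t) \<noteq> 0" if "t \<in> {0..1}" for t
        using V(2) that by (simp add: path_image_def image_subset_iff)
      then show ?thesis using path_homotopic_in_star[OF l(1,2) V(1)] l(3) by simp
    qed
    then have "path_homotopic (nerve \<V>) (?r +++ ((b \<circ> l) +++ reversepath ?r)) (?r +++ ((\<lambda>t. ?y) +++ reversepath ?r))"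
      using r l by (intro path_homotopic_join) (auto simp: pathstart_compose pathfinish_compose)
    also have "path_homotopic (nerve \<V>) \<dots> (?r +++ reversepath ?r)"
      using r by (intro path_homotopic_join path_homotopic_lid) auto
    also have "path_homotopic (nerve \<V>) \<dots> (\<lambda>t. b x)"
      using r by (intro path_homotopic_rinv) auto
    finally show ?case
      by (simp add: path_compose_join path_compose_reversepath)
  next
    case (join p q)
    have "path_homotopic (nerve \<V>) ((b \<circ> p) +++ (b \<circ> q)) ((\<lambda>t. b x) +++ (\<lambda>t. b x))"
      using join by (intro path_homotopic_join) (auto simp: loop_at_def o_def pathstart_def pathfinish_def)
    also have "path_homotopic (nerve \<V>) \<dots> (\<lambda>t. b x)"
      using barycentric_in_nerve[OF x] by (intro path_homotopic_rid) auto
    finally show ?case by (simp add: path_compose_join)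
  next
    case (homotopic p q)
    then show ?case
      using path_homotopic_image[OF _ continuous_map_barycentric] path_homotopic_sym path_homotopic_trans
      by blast
  qed
qed

end


section \<open>Shape kernel and Spanier group\<close>

lemma special_refinement_exists:
  assumes x: "closedin T {x}" and i: "i \<in> pointed_covers T x"
  shows "\<exists>j. j \<in> special_covers T x \<and> refines j i"
proof -
  obtain \<U> U where U: "i = (\<U>, U)" "open_cover T \<U>" "U \<in> \<U>" "x \<in> U"
    using i by (auto simp: pointed_covers_def)
  \<comment> \<open>Puncturing every element at \<open>x\<close> and restoring \<open>U\<close>
    leaves \<open>U\<close> as the only element containing \<open>x\<close>; since
    \<open>{x}\<close> is closed the cover stays open.\<close>
  let ?\<V> = "insert U ((\<lambda>W. W - {x}) ` \<U>)"
  have "open_cover T ?\<V>"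
    using U x unfolding open_cover_def by (auto intro: openin_diff)
  then have "(?\<V>, U) \<in> special_covers T x" "refines (?\<V>, U) i"
    using U by (auto simp: special_covers_def pointed_covers_def refines_def)
  then show ?thesis by blast
qed

lemma vertex_assignment_exists:
  assumes "refines (\<V>, V) (\<U>, U)" "U \<in> \<U>"
  shows "\<exists>f. vertex_assignment (\<V>, V) (\<U>, U) f"
proof -
  have "\<forall>W\<in>\<V>. \<exists>U'. U' \<in> \<U> \<and> W \<subseteq> U'" using assms by (auto simp: refines_def)
  then obtain f where "\<forall>W\<in>\<V>. f W \<in> \<U> \<and> W \<subseteq> f W" by metis
  then have "vertex_assignment (\<V>, V) (\<U>, U) (f(V := U))"
    using assms by (auto simp: vertex_assignment_def refines_def)
  then show ?thesis by blast
qed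

lemma one_shape_group: "\<one>\<^bsub>shape_group T x\<^esub> = (\<lambda>i\<in>pointed_covers T x. \<one>\<^bsub>nerve_group i\<^esub>)"
  by (simp add: shape_group_def product_group_def)

locale paracompact_pointed =
  fixes T :: "'a::topological_space topology" and x :: 'a
  assumes x: "x \<in> topspace T" "closedin T {x}"
    and partition_exists: "\<And>\<V>. open_cover T \<V> \<Longrightarrow> \<exists>\<rho>. partition_of_unity T \<V> \<rho>"
begin

text \<open>Unfolds the choices behind a component of the shape homomorphism once and for all.
  Afterwards it is just composition of a barycentric map with a simplicial map, for some
  \<open>\<V>\<close> and \<open>f\<close> with the listed properties.\<close>

lemma shape_hom_component:
  assumes i: "(\<U>, U) \<in> pointed_covers T x"
  obtains \<V> V f where "partitioned_cover T \<V>" "vertex_assignment (\<V>, V) (\<U>, U) f"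
    "barycentric_map T \<V> x = vertex V"
    "\<And>p. loop_at T x p \<Longrightarrow> loop_at (nerve \<U>) (vertex U) (simplicial_map f \<circ> (barycentric_map T \<V> \<circ> p))"
    "\<And>p. loop_at T x p \<Longrightarrow> shape_hom T x (loop_class T x p) (\<U>, U) =
       loop_class (nerve \<U>) (vertex U) (simplicial_map f \<circ> (barycentric_map T \<V> \<circ> p))"
proof -
  define j where "j = (SOME j. j \<in> special_covers T x \<and> refines j (\<U>, U))"
  have j: "j \<in> special_covers T x" "refines j (\<U>, U)"
    using someI_ex[OF special_refinement_exists[OF x(2) i]] by (auto simp: j_def)
  obtain \<V> V where jV: "j = (\<V>, V)" by fastforce
  define f where "f = (SOME f. vertex_assignment j (\<U>, U) f)"
  have U: "U \<in> \<U>" using i by (simp add: pointed_covers_def)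
  have f: "vertex_assignment (\<V>, V) (\<U>, U) f"
    using someI_ex[OF vertex_assignment_exists[OF j(2)[unfolded jV] U]] by (simp add: f_def jV)
  have \<V>: "open_cover T \<V>" "V \<in> \<V>" "x \<in> V" "\<And>W. W \<in> \<V> \<Longrightarrow> x \<in> W \<Longrightarrow> W = V"
    using j(1) by (auto simp: jV special_covers_def pointed_covers_def)
  have pc: "partitioned_cover T \<V>"
    by unfold_locales (use \<V>(1) partition_exists in auto)
  then interpret partitioned_cover T \<V> .
  have bx: "b x = vertex V" using barycentric_vertex[OF x(1)] \<V>(4) by blast
  have c: "continuous_map (nerve \<V>) (nerve \<U>) (simplicial_map f)"
    by (rule continuous_map_vertex_assignment[OF f])
  have fV: "simplicial_map f (vertex V) = vertex U"
    using f by (simp add: simplicial_map_vertex vertex_assignment_def)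
  have 1: "induced_hom (nerve \<V>) (vertex V) b (loop_class T x p) = loop_class (nerve \<V>) (vertex V) (b \<circ> p)"
    "loop_at (nerve \<V>) (vertex V) (b \<circ> p)" if "loop_at T x p" for p
    using induced_hom_loop_class[where f = b, OF that continuous_map_barycentric bx] by auto
  have 2: "induced_hom (nerve \<U>) (vertex U) (simplicial_map f) (loop_class (nerve \<V>) (vertex V) q) =
      loop_class (nerve \<U>) (vertex U) (simplicial_map f \<circ> q)"
    "loop_at (nerve \<U>) (vertex U) (simplicial_map f \<circ> q)" if "loop_at (nerve \<V>) (vertex V) q" for q
    using induced_hom_loop_class[where f = "simplicial_map f", OF that c fV] by auto
  show ?thesis
  proof (rule that[OF pc f bx])
    fix p assume p: "loop_at T x p"
    show "loop_at (nerve \<U>) (vertex U) (simplicial_map f \<circ> (b \<circ> p))"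
      using 1 2 p by blast
    have "shape_hom T x (loop_class T x p) (\<U>, U) =
        bonding_hom j (\<U>, U) (barycentric_hom T j (loop_class T x p))"
      using i by (simp add: shape_hom_def j_def Let_def)
    also have "barycentric_hom T j (loop_class T x p) = loop_class (nerve \<V>) (vertex V) (b \<circ> p)"
      using 1(1)[OF p] by (simp add: barycentric_hom_def jV)
    also have "bonding_hom j (\<U>, U) \<dots> = loop_class (nerve \<U>) (vertex U) (simplicial_map f \<circ> (b \<circ> p))"
      using 2(1)[OF 1(2)[OF p]] by (simp add: bonding_hom_def bonding_map_def f_def)
    finally show "shape_hom T x (loop_class T x p) (\<U>, U) = \<dots>" .
  qed
qed

lemma shape_kernel_iff:
  "c \<in> shape_kernel T x \<longleftrightarrow> c \<in> carrier (fundamental_group T x) \<and>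
     (\<forall>(\<U>, U)\<in>pointed_covers T x. shape_hom T x c (\<U>, U) = loop_class (nerve \<U>) (vertex U) (\<lambda>t. vertex U))"
  unfolding shape_kernel_def kernel_def one_shape_group
  by (auto simp: shape_hom_def fun_eq_iff nerve_group_def one_fundamental_group)

text \<open>Such a loop already contracts in the nerve of the special refinement, and the bonding
  map carries the contraction along.\<close>

lemma spanier_group_subset_shape_kernel: "spanier_group T x \<subseteq> shape_kernel T x"
proof
  fix c assume c: "c \<in> spanier_group T x"
  then have carrier: "c \<in> carrier (fundamental_group T x)"
    using spanier_group_subset[OF x(1)] by blast
  then obtain p where p: "loop_at T x p" "c = loop_class T x p"
    using carrier_fundamental_groupE by metis
  have "shape_hom T x c (\<U>, U) = loop_class (nerve \<U>) (vertex U) (\<lambda>t. vertex U)"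
    if i: "(\<U>, U) \<in> pointed_covers T x" for \<U> U
  proof -
    obtain \<V> V f where *: "partitioned_cover T \<V>" "vertex_assignment (\<V>, V) (\<U>, U) f"
      "barycentric_map T \<V> x = vertex V"
      "loop_at (nerve \<U>) (vertex U) (simplicial_map f \<circ> (barycentric_map T \<V> \<circ> p))"
      "shape_hom T x c (\<U>, U) =
       loop_class (nerve \<U>) (vertex U) (simplicial_map f \<circ> (barycentric_map T \<V> \<circ> p))"
      using shape_hom_component[OF i] p by metis
    interpret partitioned_cover T \<V> by fact
    have "path_homotopic (nerve \<V>) (b \<circ> p) (\<lambda>t. b x)"
      using spanier_null_in_nerve[OF x(1) p(1)] c p(2) by blast
    from path_homotopic_image[OF this continuous_map_vertex_assignment[OF *(2)]]
    have "path_homotopic (nerve \<U>) (simplicial_map f \<circ> (b \<circ> p)) (\<lambda>t. vertex U)"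
      using *(2,3) by (simp add: simplicial_map_vertex vertex_assignment_def o_def)
    then show ?thesis
      using *(5) loop_class_eqI[OF *(4)] by simp
  qed
  then show "c \<in> shape_kernel T x"
    unfolding shape_kernel_iff using carrier by auto
qed

end

text \<open>
  At every point of the homotopy, choose a vertex with maximal barycentric coordinate. Nearby
  points then yield vertices of one simplex, that is, elements of the cover with a common point.
\<close>

lemma maximal_coordinate:
  assumes K: "simplicial_complex K" and b: "b \<in> topspace (realization K)"
  obtains v where "b v \<noteq> 0" "\<And>w. b w \<le> b v"
proof -
  note s = simplicial_complex_support[OF K b]
  have ne: "{v. b v \<noteq> 0} \<noteq> {}" using s(1) K by (auto simp: simplicial_complex_def)
  have pos: "\<And>w. 0 \<le> b w" using s(3) by (simp add: closed_simplex_def)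
  have "Max (b ` {v. b v \<noteq> 0}) \<in> b ` {v. b v \<noteq> 0}"
    using s(2) ne by (intro Max_in) auto
  then obtain v where v: "b v \<noteq> 0" "b v = Max (b ` {v. b v \<noteq> 0})" by auto
  have "b w \<le> b v" for w
  proof (cases "b w = 0")
    case False
    then show ?thesis using v s(2) by (simp add: Max_ge)
  qed (simp add: pos)
  then show ?thesis using that v(1) by blast
qed

text \<open>Near \<open>q\<close> the coordinates over the support of \<open>H q\<close> still sum
  to more than \<open>1 - H q m / 2\<close>, so every coordinate outside that support is below
  \<open>H q m / 2\<close>. The coordinate at \<open>m\<close> stays above this value and rules such
  a vertex out as a maximum.\<close>

lemma maximal_coordinate_nearby:
  assumes K: "simplicial_complex K" and H: "continuous_map S (realization K) H" and q: "q \<in> topspace S"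
  obtains N where "openin S N" "q \<in> N"
    "\<And>q' v. q' \<in> N \<Longrightarrow> (\<And>w. H q' w \<le> H q' v) \<Longrightarrow> H q v \<noteq> 0"
proof -
  have H': "H q' \<in> topspace (realization K)" if "q' \<in> topspace S" for q'
    using H that by (auto simp: continuous_map_def)
  let ?\<sigma> = "{v. H q v \<noteq> 0}"
  note s = simplicial_complex_support[OF K H'[OF q]]
  obtain m where m: "H q m \<noteq> 0" using maximal_coordinate[OF K H'[OF q]] by metis
  have m0: "0 < H q m" using s(3) m by (simp add: closed_simplex_def less_le)
  have cont: "continuous_map S euclideanreal (\<lambda>q. H q v)" for v
    using continuous_map_compose[OF H continuous_map_coordinate_realization] by (simp add: o_def)
  define N where "N = {q' \<in> topspace S. H q' m \<in> {H q m / 2<..}} \<inter> {q' \<in> topspace S. (\<Sum>v\<in>?\<sigma>. H q' v) \<in> {1 - H q m / 2<..}}"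
  show ?thesis
  proof (rule that[of N])
    have "continuous_map S euclideanreal (\<lambda>q'. \<Sum>v\<in>?\<sigma>. H q' v)"
      using cont s(2) by (intro continuous_map_sum) auto
    then show "openin S N"
      unfolding N_def by (intro openin_Int openin_continuous_map_preimage[of _ euclideanreal] cont) auto
    show "q \<in> N" using q m0 s(3) by (simp add: N_def closed_simplex_def)
    fix q' v assume q': "q' \<in> N" "\<And>w. H q' w \<le> H q' v"
    show "H q v \<noteq> 0"
    proof
      assume "H q v = 0"
      have "q' \<in> topspace S" using q' by (simp add: N_def)
      note s' = simplicial_complex_support[OF K H'[OF this]]
      have pos: "0 \<le> H q' w" for w using s'(3) by (simp add: closed_simplex_def)
      have "(\<Sum>w\<in>insert v ?\<sigma>. H q' w) \<le> (\<Sum>w\<in>?\<sigma> \<union> {w. H q' w \<noteq> 0} \<union> {v}. H q' w)"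
        using s(2) s'(2) pos by (intro sum_mono2) auto
      also have "\<dots> = (\<Sum>w\<in>{w. H q' w \<noteq> 0}. H q' w)"
        using s(2) s'(2) by (intro sum.mono_neutral_right) auto
      also have "\<dots> = 1" using s'(3) by (simp add: closed_simplex_def)
      finally have "H q' v + (\<Sum>w\<in>?\<sigma>. H q' w) \<le> 1"
        using \<open>H q v = 0\<close> s(2) by simp
      then show False using q' q'(2)[of m] by (auto simp: N_def)
    qed
  qed
qed

text \<open>Triviality of the component at a nice cover \<open>\<W>\<close> gives a null homotopy in
  its nerve; choosing vertices of maximal coordinate on the square supplies the map
  \<open>\<omega>\<close> for \<open>monodromy\<close>.\<close>

lemma shape_kernel_subset_spanier_group:
  fixes X :: "'a::metric_space set"
  assumes "paracompact_pointed (top_of_set X) x" "path_connected X" "locally path_connected X"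
  shows "shape_kernel (top_of_set X) x \<subseteq> spanier_group (top_of_set X) x"
proof
  let ?T = "top_of_set X" and ?Q = "{0..1::real} \<times> {0..1::real}"
  interpret paracompact_pointed ?T x by fact
  fix c assume c: "c \<in> shape_kernel ?T x"
  then obtain p where p: "loop_at ?T x p" "c = loop_class ?T x p"
    unfolding shape_kernel_iff using carrier_fundamental_groupE by metis
  have "c \<in> spanier_group_cover ?T x \<U>" if \<U>: "open_cover ?T \<U>" for \<U>
  proof -
    obtain \<W> ctr where \<W>: "open_cover ?T \<W>" "nice_cover ?T x \<U> \<W> ctr"
      using nice_cover_exists[OF \<U> assms(3,2)] x(1) by auto
    interpret nice_cover ?T x \<U> \<W> ctr by fact
    obtain W0 where W0: "W0 \<in> \<W>" "x \<in> W0"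
      using \<W>(1) x(1) unfolding open_cover_def by (metis UnionE)
    then have i: "(\<W>, W0) \<in> pointed_covers ?T x"
      using \<W>(1) by (simp add: pointed_covers_def)
    obtain \<V> V f where *: "partitioned_cover ?T \<V>" "vertex_assignment (\<V>, V) (\<W>, W0) f"
      "loop_at (nerve \<W>) (vertex W0) (simplicial_map f \<circ> (barycentric_map ?T \<V> \<circ> p))"
      "shape_hom ?T x c (\<W>, W0) =
       loop_class (nerve \<W>) (vertex W0) (simplicial_map f \<circ> (barycentric_map ?T \<V> \<circ> p))"
      using shape_hom_component[OF i] p by metis
    interpret part: partitioned_cover ?T \<V> by fact
    let ?g = "simplicial_map f \<circ> (barycentric_map ?T \<V> \<circ> p)"
    have "path_homotopic (nerve \<W>) ?g (\<lambda>t. vertex W0)"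
    proof -
      have "W0 \<noteq> {}" using W0(2) by blast
      then show ?thesis
        using c i *(4) loop_class_eq_iff[OF *(3) loop_at_const[OF vertex_in_nerve[OF W0(1)]]]
        unfolding shape_kernel_iff by auto
    qed
    then obtain H where H: "continuous_map (top_of_set ?Q) (nerve \<W>) H" "\<And>t. H (0,t) = ?g t" "\<And>t. H (1,t) = vertex W0"
      and sides: "\<And>s. s \<in> {0..1} \<Longrightarrow> H (s,0) = vertex W0 \<and> H (s,1) = vertex W0"
      using loop_atD[OF *(3)] unfolding path_homotopic_def homotopic_with_def
      by (auto simp: pathstart_def pathfinish_def)
    note K = simplicial_complex_nerve[of \<W>]
    have HN: "H q \<in> topspace (realization (nerve_simplices \<W>))" if "q \<in> ?Q" for q
      using H(1) that by (auto simp: continuous_map_def nerve_def Pi_iff)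
    then have "\<exists>W. H q W \<noteq> 0 \<and> (\<forall>W'. H q W' \<le> H q W)" if "q \<in> ?Q" for q
      using maximal_coordinate[OF K] that by metis
    then obtain \<omega> where \<omega>: "\<And>q. q \<in> ?Q \<Longrightarrow> H q (\<omega> q) \<noteq> 0" "\<And>q W'. q \<in> ?Q \<Longrightarrow> H q W' \<le> H q (\<omega> q)"
      by metis
    have supp: "{W. H q W \<noteq> 0} \<in> nerve_simplices \<W>" if "q \<in> ?Q" for q
      using simplicial_complex_support(1)[OF K HN[OF that]] .
    have "hol p = \<one>\<^bsub>K\<^esub>"
    proof (rule monodromy[OF p(1), of \<omega> W0])
      show "\<omega> q \<in> \<W>" if "q \<in> ?Q" for q
        using supp[OF that] \<omega>(1)[OF that] by (auto simp: nerve_simplices_def)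
      show "\<exists>N y. open N \<and> q \<in> N \<and> y \<in> topspace ?T \<and> (\<forall>q'\<in>N \<inter> {0..1} \<times> {0..1}. y \<in> \<omega> q')" if q: "q \<in> ?Q" for q
      proof -
        obtain N where N: "openin (top_of_set ?Q) N" "q \<in> N"
          "\<And>q' W. q' \<in> N \<Longrightarrow> (\<And>W'. H q' W' \<le> H q' W) \<Longrightarrow> H q W \<noteq> 0"
          using maximal_coordinate_nearby[OF K H(1)[unfolded nerve_def], of q] q by auto
        obtain y where y: "\<And>W. H q W \<noteq> 0 \<Longrightarrow> y \<in> W"
          using supp[OF q] by (auto simp: nerve_simplices_def)
        obtain G where G: "open G" "N = ?Q \<inter> G" using N(1) openin_open by metis
        have "y \<in> \<omega> q'" if "q' \<in> G \<inter> ?Q" for q'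
        proof -
          have "H q (\<omega> q') \<noteq> 0"
            by (rule N(3)[of q']) (use that G \<omega>(2) in auto)
          then show ?thesis by (rule y)
        qed
        moreover have "y \<in> topspace ?T"
        proof -
          have "\<omega> q \<in> \<W>" using supp[OF q] \<omega>(1)[OF q] by (auto simp: nerve_simplices_def)
          then show ?thesis using y[OF \<omega>(1)[OF q]] \<W>(1) unfolding open_cover_def by blast
        qed
        moreover have "q \<in> G" using N(2) G by blast
        ultimately show ?thesis using G(1) by blast
      qed
      show "p t \<in> \<omega> (0, t)" if t: "t \<in> {0..1}" for t
      proof -
        \<comment> \<open>A nonzero coordinate of the image comes from some \<open>V'\<close> of
          nonzero weight at \<open>p t\<close> with \<open>f V' = \<omega> (0, t)\<close>. Hence
          \<open>p t\<close> lies in \<open>V'\<close>, which is contained in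
          \<open>\<omega> (0, t)\<close>.\<close>
        have "simplicial_map f (barycentric_map ?T \<V> (p t)) (\<omega> (0, t)) \<noteq> 0"
          using \<omega>(1)[of "(0, t)"] t H(2)[of t] by simp
        then obtain V' where V': "barycentric_map ?T \<V> (p t) V' \<noteq> 0" "f V' = \<omega> (0, t)"
          using simplicial_map_nonzero by metis
        have "p t \<in> topspace ?T" using p(1) t pathin_subset unfolding loop_at_def by blast
        from part.barycentric_nonzero[OF this V'(1)] show ?thesis
          using *(2) V'(2) by (auto simp: vertex_assignment_def)
      qed
      have vertex: "\<omega> q = W0" if "q \<in> ?Q" "H q = vertex W0" for q
        using \<omega>(1)[OF that(1)] that(2) by (auto simp: vertex_def indicator_def split: if_splits)
      show "\<omega> (1, t) = W0 \<and> \<omega> (t, 0) = W0 \<and> \<omega> (t, 1) = W0" if "t \<in> {0..1}" for t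
        using that sides H(3) by (auto intro!: vertex)
    qed
    then show ?thesis using holonomy_eq_one_iff[OF p(1)] p(2) by simp
  qed
  then show "c \<in> spanier_group ?T x" by (simp add: spanier_group_def)
qed


section \<open>Partitions of unity on metric spaces\<close>

text \<open>Each point receives the first element containing it in a well-order of the cover. If two
  points lie in each other's elements, each of these elements precedes the other, so they
  coincide.\<close>

lemma first_member_choice:
  assumes "\<And>z. z \<in> X \<Longrightarrow> \<exists>V\<in>\<V>. z \<in> V"
  obtains \<phi> where "\<And>z. z \<in> X \<Longrightarrow> \<phi> z \<in> \<V> \<and> z \<in> \<phi> z"
    "\<And>y z. y \<in> X \<Longrightarrow> z \<in> X \<Longrightarrow> z \<in> \<phi> y \<Longrightarrow> y \<in> \<phi> z \<Longrightarrow> \<phi> y = \<phi> z"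
proof -
  obtain r where r: "well_order_on \<V> r" using well_order_on by blast
  then have lin: "linear_order_on \<V> r" and wf: "wf (r - Id)" by (auto simp: well_order_on_def)
  have "\<exists>V\<in>\<V>. z \<in> V \<and> (\<forall>W\<in>\<V>. z \<in> W \<longrightarrow> (V, W) \<in> r)" if z: "z \<in> X" for z
  proof -
    obtain V where V: "V \<in> \<V>" "z \<in> V" "\<And>W. (W, V) \<in> r - Id \<Longrightarrow> W \<notin> {V \<in> \<V>. z \<in> V}"
      using wfE_min'[OF wf, of "{V \<in> \<V>. z \<in> V}"] assms[OF z] by blast
    have "(V, W) \<in> r" if "W \<in> \<V>" "z \<in> W" for W
    proof (cases "V = W")
      case True
      then show ?thesis using lin V(1) by (auto simp: order_on_defs refl_on_def)
    next
      case False
      then have "(V, W) \<in> r \<or> (W, V) \<in> r"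
        using lin V(1) that(1) by (auto simp: order_on_defs total_on_def)
      then show ?thesis using V(3)[of W] that False by auto
    qed
    then show ?thesis using V by blast
  qed
  then obtain \<phi> where \<phi>: "\<And>z. z \<in> X \<Longrightarrow> \<phi> z \<in> \<V> \<and> z \<in> \<phi> z"
    "\<And>z W. z \<in> X \<Longrightarrow> W \<in> \<V> \<Longrightarrow> z \<in> W \<Longrightarrow> (\<phi> z, W) \<in> r"
    by metis
  have "\<phi> y = \<phi> z" if "y \<in> X" "z \<in> X" "z \<in> \<phi> y" "y \<in> \<phi> z" for y z
    using \<phi>(2)[of y "\<phi> z"] \<phi>(2)[of z "\<phi> y"] \<phi>(1) that lin
    by (auto simp: order_on_defs antisym_def)
  then show ?thesis using that \<phi>(1) by blast
qed

text \<open>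
  M. E. Rudin's construction: at stage \<open>n\<close> every point \<open>c\<close> not yet covered, whose ball of radius
  \<open>3/2\<^sup>n\<close> fits into the first element \<open>V\<close> of the cover containing \<open>c\<close>, contributes its ball of
  radius \<open>1/2\<^sup>n\<close> to the set indexed by \<open>V\<close>.
\<close>

lemma metric_locally_finite_refinement:
  fixes X :: "'a::metric_space set"
  assumes "open_cover (top_of_set X) \<V>"
  obtains E where "\<And>V. open (E V)" "X \<subseteq> (\<Union>V\<in>\<V>. E V)"
    "\<And>z. z \<in> X \<Longrightarrow> \<exists>N. open N \<and> z \<in> N \<and> finite {V. E V \<inter> N \<noteq> {}}"
    "\<And>V. closure (E V) \<inter> X \<subseteq> V"
proof -
  have "\<exists>V\<in>\<V>. z \<in> V" if "z \<in> X" for z using assms that by (auto simp: open_cover_def)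
  from first_member_choice[of X \<V>, OF this]
  obtain \<phi> where \<phi>: "\<And>z. z \<in> X \<Longrightarrow> \<phi> z \<in> \<V> \<and> z \<in> \<phi> z"
    "\<And>y z. y \<in> X \<Longrightarrow> z \<in> X \<Longrightarrow> z \<in> \<phi> y \<Longrightarrow> y \<in> \<phi> z \<Longrightarrow> \<phi> y = \<phi> z"
    by metis
  define step where "step n A = {c \<in> X. c \<notin> A \<and> ball c (3 * (1/2)^n) \<inter> X \<subseteq> \<phi> c}" for n A
  define A where "A = rec_nat {} (\<lambda>n A. A \<union> (\<Union>c\<in>step n A. ball c ((1/2)^n)))"
  define C where "C n = step n (A n)" for n
  have AS: "A (Suc n) = A n \<union> (\<Union>c\<in>C n. ball c ((1/2)^n))" and A0: "A 0 = {}" for n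
    by (simp_all add: A_def C_def)
  have Amono: "A m \<subseteq> A n" if "m \<le> n" for m n
    using that by (rule lift_Suc_mono_le[rotated]) (auto simp: AS)
  have C: "c \<in> X" "c \<notin> A n" "ball c (3 * (1/2)^n) \<inter> X \<subseteq> \<phi> c" if "c \<in> C n" for c n
    using that by (auto simp: C_def step_def)
  define D where "D n V = (\<Union>c\<in>{c \<in> C n. \<phi> c = V}. ball c ((1/2)^n))" for n V
  define E where "E V = (\<Union>n. D n V)" for V
  have DA: "D n V \<subseteq> A (Suc n)" for n V by (auto simp: D_def AS)
  have openD: "open (D n V)" for n V by (auto simp: D_def)
  have A_D: "\<exists>m V. z \<in> D m V \<and> V \<in> \<V>" if "z \<in> A n" for z n
    using that
  proof (induction n)
    case (Suc n)
    then show ?case using C(1) \<phi>(1) by (fastforce simp: AS D_def)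
  qed (simp add: A0)
  have cover: "\<exists>m V. z \<in> D m V \<and> V \<in> \<V>" if z: "z \<in> X" for z
  proof -
    have "openin (top_of_set X) (\<phi> z)" using \<phi>(1)[OF z] assms by (simp add: open_cover_def)
    then obtain e where e: "e > 0" "ball z e \<inter> X \<subseteq> \<phi> z"
      using \<phi>(1)[OF z] unfolding openin_contains_ball by blast
    obtain n where n: "(1/2::real) ^ n < e / 3" using real_arch_pow_inv[of "e/3" "1/2"] e(1) by auto
    have "ball z (3 * (1/2)^n) \<subseteq> ball z e" using n by (intro subset_ball) simp
    then have "z \<in> A n \<or> z \<in> C n" using e z by (auto simp: C_def step_def)
    moreover have "z \<in> ball z ((1/2)^n)" by simp
    ultimately have "z \<in> A (Suc n)" unfolding AS by blast
    then show ?thesis by (rule A_D)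
  qed
  have locfin: "\<exists>m. (\<forall>i V. D i V \<inter> ball z ((1/2)^m) \<noteq> {} \<longrightarrow> i < m) \<and>
      (\<forall>i V V'. D i V \<inter> ball z ((1/2)^m) \<noteq> {} \<longrightarrow> D i V' \<inter> ball z ((1/2)^m) \<noteq> {} \<longrightarrow> V = V')"
    if z: "z \<in> X" for z
  proof -
    obtain n V0 where "z \<in> D n V0" using cover[OF z] by blast
    then obtain e where e: "e > 0" "ball z e \<subseteq> D n V0" using openD openE by metis
    obtain j where j: "(1/2::real) ^ j < e" using real_arch_pow_inv[of e "1/2"] e(1) by auto
    \<comment> \<open>A center \<open>c\<close> of a stage \<open>i \<ge> m\<close> avoids the
      earlier set around \<open>z\<close>, hence has distance at least \<open>e > (1/2)^j\<close>
      from \<open>z\<close>. If its ball met the ball of radius \<open>(1/2)^m\<close>, the distance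
      would be below \<open>2 * (1/2)^m \<le> (1/2)^j\<close>.\<close>
    define m where "m = n + j + 1"
    have lt: "i < m" if pD: "p \<in> D i V" "p \<in> ball z ((1/2)^m)" for i V p
    proof (rule ccontr)
      assume "\<not> i < m"
      then have im: "m \<le> i" by simp
      obtain c where c: "c \<in> C i" "dist c p < (1/2)^i" using pD(1) by (auto simp: D_def)
      have "Suc n \<le> i" using im by (simp add: m_def)
      then have "c \<notin> D n V0" using C(2)[OF c(1)] Amono[of "Suc n" i] DA by blast
      then have "e \<le> dist z c" using e(2) by (auto simp: subset_iff not_less)
      moreover have "dist z c < (1/2)^m + (1/2)^i"
        using c(2) pD(2) dist_triangle[of z c p] by (simp add: dist_commute)
      moreover have "(1/2::real)^i \<le> (1/2)^m" using im by (intro power_decreasing) auto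
      moreover have "(1/2::real)^m \<le> (1/2)^(Suc j)" unfolding m_def by (intro power_decreasing) auto
      ultimately show False using j unfolding power_Suc by linarith
    qed
    have eq: "V = V'" if pq: "p \<in> D i V" "p \<in> ball z ((1/2)^m)" "q \<in> D i V'" "q \<in> ball z ((1/2)^m)" for i V V' p q
    proof -
      obtain c where c: "c \<in> C i" "\<phi> c = V" "dist c p < (1/2)^i" using pq(1) by (auto simp: D_def)
      obtain c' where c': "c' \<in> C i" "\<phi> c' = V'" "dist c' q < (1/2)^i" using pq(3) by (auto simp: D_def)
      have "Suc i \<le> m" using lt[OF pq(1,2)] by simp
      then have "(1/2::real)^m \<le> (1/2)^(Suc i)" by (intro power_decreasing) auto
      \<comment> \<open>Origin of the factor \<open>3\<close> in \<open>step\<close>: the two stage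
        radii contribute \<open>2 * (1/2)^i\<close>, and two points of the small ball around
        \<open>z\<close> differ by at most another \<open>(1/2)^i\<close>. So each center lies in
        the element chosen for the other.\<close>
      moreover have "dist c c' \<le> dist c p + dist z p + dist z q + dist c' q"
        using dist_triangle[of c c' p] dist_triangle[of p c' z] dist_triangle[of z c' q]
        by (simp add: dist_commute)
      ultimately have "dist c c' < 3 * (1/2)^i"
        using c(3) c'(3) pq(2,4) by (simp add: dist_commute)
      then have "c' \<in> \<phi> c" "c \<in> \<phi> c'"
        using C[OF c(1)] C[OF c'(1)] by (auto simp: dist_commute)
      then show ?thesis using \<phi>(2) C(1) c c' by metis
    qed
    show ?thesis
      by (intro exI[of _ m] conjI allI impI) (use lt eq in blast)+
  qed
  show ?thesis
  proof (rule that[of E])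
    show "open (E V)" for V unfolding E_def using openD by blast
    show "X \<subseteq> (\<Union>V\<in>\<V>. E V)" using cover by (fastforce simp: E_def)
    fix z assume "z \<in> X"
    from locfin[OF this] obtain m where
      m: "\<And>i V. D i V \<inter> ball z ((1/2)^m) \<noteq> {} \<Longrightarrow> i < m"
      "\<And>i V V'. D i V \<inter> ball z ((1/2)^m) \<noteq> {} \<Longrightarrow> D i V' \<inter> ball z ((1/2)^m) \<noteq> {} \<Longrightarrow> V = V'"
      by metis
    let ?N = "ball z ((1/2)^m)"
    have "finite {V. D i V \<inter> ?N \<noteq> {}}" for i
    proof (cases "\<exists>V. D i V \<inter> ?N \<noteq> {}")
      case True
      then obtain V where "D i V \<inter> ?N \<noteq> {}" by blast
      then have "{V. D i V \<inter> ?N \<noteq> {}} = {V}" using m(2) by blast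
      then show ?thesis by simp
    qed simp
    then have "finite (\<Union>i<m. {V. D i V \<inter> ?N \<noteq> {}})" by blast
    moreover have "{V. E V \<inter> ?N \<noteq> {}} \<subseteq> (\<Union>i<m. {V. D i V \<inter> ?N \<noteq> {}})"
      using m(1) by (fastforce simp: E_def)
    ultimately have "finite {V. E V \<inter> ?N \<noteq> {}}" using finite_subset by blast
    then show "\<exists>N. open N \<and> z \<in> N \<and> finite {V. E V \<inter> N \<noteq> {}}"
      by (intro exI[of _ ?N]) auto
  next
    fix V show "closure (E V) \<inter> X \<subseteq> V"
    proof clarify
      fix z assume z: "z \<in> closure (E V)" "z \<in> X"
      from locfin[OF z(2)] obtain m where m: "\<And>i V. D i V \<inter> ball z ((1/2)^m) \<noteq> {} \<Longrightarrow> i < m"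
        by metis
      \<comment> \<open>A nearby point of \<open>E V\<close> comes from a stage
        \<open>i < m\<close>. This puts \<open>z\<close> within twice the stage radius of a center,
        where the ball of triple radius still lies in \<open>V\<close>.\<close>
      obtain p where p: "p \<in> E V" "dist p z < (1/2)^m"
        using z(1) unfolding closure_approachable by (metis half_gt_zero_iff zero_less_one zero_less_power)
      then obtain i where i: "p \<in> D i V" by (auto simp: E_def)
      moreover have "p \<in> ball z ((1/2)^m)" using p(2) by (simp add: dist_commute)
      ultimately have "i < m" using m by blast
      then have "(1/2::real)^m \<le> (1/2)^i" by (intro power_decreasing) auto
      moreover obtain c where c: "c \<in> C i" "\<phi> c = V" "dist c p < (1/2)^i" using i by (auto simp: D_def)
      ultimately have "dist c z < 3 * (1/2)^i"
        using p(2) dist_triangle[of c z p] zero_less_power[of "1/2::real" i] by linarith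
      then show "z \<in> V" using C(3)[OF c(1)] c(2) z(2) by auto
    qed
  qed
qed

text \<open>The partition \<open>F\<close> is indexed by the sets \<open>E V\<close>, and different
  \<open>V\<close> may give the same set. One representative \<open>rep\<close> of each set receives
  its function, all other indices receive zero, so nothing is counted twice.\<close>

lemma metric_partition_of_unity:
  fixes X :: "'a::metric_space set"
  assumes \<V>: "open_cover (top_of_set X) \<V>"
  shows "\<exists>\<rho>. partition_of_unity (top_of_set X) \<V> \<rho>"
proof -
  obtain E where E: "\<And>V. open (E V)" "X \<subseteq> (\<Union>V\<in>\<V>. E V)"
    "\<And>z. z \<in> X \<Longrightarrow> \<exists>N. open N \<and> z \<in> N \<and> finite {V. E V \<inter> N \<noteq> {}}"
    "\<And>V. closure (E V) \<inter> X \<subseteq> V"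
    by (rule metric_locally_finite_refinement[OF \<V>]) blast
  have fin: "\<exists>N. open N \<and> z \<in> N \<and> finite {U \<in> E ` \<V>. U \<inter> N \<noteq> {}}" if "z \<in> X" for z
  proof -
    obtain N where N: "open N" "z \<in> N" "finite {V. E V \<inter> N \<noteq> {}}" using E(3)[OF \<open>z \<in> X\<close>] by blast
    have "{U \<in> E ` \<V>. U \<inter> N \<noteq> {}} \<subseteq> E ` {V. E V \<inter> N \<noteq> {}}" by blast
    then show ?thesis using N finite_surj by blast
  qed
  obtain F :: "'a set \<Rightarrow> 'a \<Rightarrow> real" where
    F: "\<And>U. U \<in> E ` \<V> \<Longrightarrow> continuous_on X (F U) \<and> (\<forall>x\<in>X. 0 \<le> F U x)"
    "\<And>x U. U \<in> E ` \<V> \<Longrightarrow> x \<in> X \<Longrightarrow> x \<notin> U \<Longrightarrow> F U x = 0"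
    "\<And>x. x \<in> X \<Longrightarrow> supp_sum (\<lambda>W. F W x) (E ` \<V>) = 1"
    "\<And>x. x \<in> X \<Longrightarrow> \<exists>N. open N \<and> x \<in> N \<and> finite {U \<in> E ` \<V>. \<exists>x\<in>N. F U x \<noteq> 0}"
    using subordinate_partition_of_unity[of X "E ` \<V>"] E(1,2) fin by blast
  define rep where "rep U = (SOME V. V \<in> \<V> \<and> E V = U)" for U
  have rep: "rep U \<in> \<V> \<and> E (rep U) = U" if "U \<in> E ` \<V>" for U
    unfolding rep_def by (rule someI_ex) (use that in blast)
  define \<rho> where "\<rho> V = (if rep (E V) = V then F (E V) else (\<lambda>z. 0))" for V
  have \<rho>: "rep (E V) = V \<and> F (E V) z \<noteq> 0" if "\<rho> V z \<noteq> 0" for V z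
    using that by (auto simp: \<rho>_def split: if_splits)
  have "partition_of_unity (top_of_set X) \<V> \<rho>"
    unfolding partition_of_unity_def
  proof (intro conjI ballI)
    fix V assume V: "V \<in> \<V>"
    show "continuous_map (top_of_set X) euclideanreal (\<rho> V)"
      using F(1)[of "E V"] V by (auto simp: \<rho>_def)
    show "0 \<le> \<rho> V z" if "z \<in> topspace (top_of_set X)" for z
      using F(1)[of "E V"] V that by (auto simp: \<rho>_def)
    have "{z \<in> topspace (top_of_set X). \<rho> V z \<noteq> 0} \<subseteq> E V"
      using F(2)[of "E V"] V \<rho> by fastforce
    then have "closure {z \<in> topspace (top_of_set X). \<rho> V z \<noteq> 0} \<subseteq> closure (E V)"
      by (rule closure_mono)
    then show "(top_of_set X) closure_of {z \<in> topspace (top_of_set X). \<rho> V z \<noteq> 0} \<subseteq> V"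
      using E(4)[of V] closure_mono[of "X \<inter> {z \<in> topspace (top_of_set X). \<rho> V z \<noteq> 0}" "{z \<in> topspace (top_of_set X). \<rho> V z \<noteq> 0}"]
      unfolding closure_of_subtopology_open closure_of_subtopology by auto
  next
    fix z assume "z \<in> topspace (top_of_set X)"
    then have z: "z \<in> X" by simp
    obtain N where N: "open N" "z \<in> N" "finite {U \<in> E ` \<V>. \<exists>x\<in>N. F U x \<noteq> 0}" using F(4)[OF z] by blast
    have "{V \<in> \<V>. \<exists>y\<in>X \<inter> N. \<rho> V y \<noteq> 0} \<subseteq> rep ` {U \<in> E ` \<V>. \<exists>x\<in>N. F U x \<noteq> 0}"
    proof
      fix V assume "V \<in> {V \<in> \<V>. \<exists>y\<in>X \<inter> N. \<rho> V y \<noteq> 0}"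
      then have "E V \<in> {U \<in> E ` \<V>. \<exists>x\<in>N. F U x \<noteq> 0}" "V = rep (E V)" using \<rho> by auto
      then show "V \<in> rep ` {U \<in> E ` \<V>. \<exists>x\<in>N. F U x \<noteq> 0}" by blast
    qed
    then have "finite {V \<in> \<V>. \<exists>y\<in>X \<inter> N. \<rho> V y \<noteq> 0}" using N(3) finite_surj by blast
    then show "\<exists>N. openin (top_of_set X) N \<and> z \<in> N \<and> finite {V \<in> \<V>. \<exists>y\<in>N. \<rho> V y \<noteq> 0}"
      using N z by (intro exI[of _ "X \<inter> N"]) (auto intro: openin_open_Int)
    have "bij_betw E {V. V \<in> \<V> \<and> \<rho> V z \<noteq> 0} {U \<in> E ` \<V>. F U z \<noteq> 0}"
    proof (rule bij_betw_byWitness[where f' = rep])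
      show "\<forall>V\<in>{V. V \<in> \<V> \<and> \<rho> V z \<noteq> 0}. rep (E V) = V" using \<rho> by blast
      show "\<forall>U\<in>{U \<in> E ` \<V>. F U z \<noteq> 0}. E (rep U) = U" using rep by blast
      show "E ` {V. V \<in> \<V> \<and> \<rho> V z \<noteq> 0} \<subseteq> {U \<in> E ` \<V>. F U z \<noteq> 0}" using \<rho> by blast
      have "\<rho> (rep U) = F U" if "U \<in> E ` \<V>" for U using rep[OF that] by (simp add: \<rho>_def)
      then show "rep ` {U \<in> E ` \<V>. F U z \<noteq> 0} \<subseteq> {V. V \<in> \<V> \<and> \<rho> V z \<noteq> 0}" using rep by auto
    qed
    then have "(\<Sum>V | V \<in> \<V> \<and> \<rho> V z \<noteq> 0. F (E V) z) = (\<Sum>U\<in>{U \<in> E ` \<V>. F U z \<noteq> 0}. F U z)"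
      by (rule sum.reindex_bij_betw)
    also have "\<dots> = 1" using F(3)[OF z] by (simp add: supp_sum_def support_on_def)
    finally have "(\<Sum>V | V \<in> \<V> \<and> \<rho> V z \<noteq> 0. F (E V) z) = 1" .
    moreover have "\<rho> V z = F (E V) z" if "\<rho> V z \<noteq> 0" for V using \<rho>[OF that] by (simp add: \<rho>_def)
    ultimately show "(\<Sum>V | V \<in> \<V> \<and> \<rho> V z \<noteq> 0. \<rho> V z) = 1" by simp
  qed
  then show ?thesis by blast
qed

lemma spanier_group_eq_shape_kernel:
  fixes X :: "'a::metric_space set"
  assumes "path_connected X" "locally path_connected X" "x \<in> X"
  shows "spanier_group (top_of_set X) x = shape_kernel (top_of_set X) x"
proof -
  have "closedin (top_of_set X) {x}" using assms(3) by (simp add: closed_subset)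
  then have p: "paracompact_pointed (top_of_set X) x"
    using assms(3) metric_partition_of_unity by unfold_locales auto
  show ?thesis
    using paracompact_pointed.spanier_group_subset_shape_kernel[OF p]
      shape_kernel_subset_spanier_group[OF p assms(1,2)] by blast
qed


section \<open>Polish spaces and analytic sets\<close>

text \<open>Second countability is inherited by subspaces and countable products, and for metrizable
  spaces it is equivalent to separability.\<close>

definition Polish :: "'a topology \<Rightarrow> bool" where
  "Polish T \<longleftrightarrow> completely_metrizable_space T \<and> second_countable T"

lemma metrizable_separable_imp_second_countable:
  assumes "metrizable_space T" "separable_space T"
  shows "second_countable T"
proof -
  obtain M d where "Metric_space M d" and T: "T = Metric_space.mtopology M d"
    using assms(1) by (auto simp: metrizable_space_def)
  interpret Metric_space M d by fact
  obtain C where C: "countable C" "C \<subseteq> M" "mtopology closure_of C = M"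
    using assms(2) by (auto simp: separable_space_def T)
  let ?\<B> = "(\<lambda>(c, n). mball c (inverse (Suc n))) ` (C \<times> (UNIV :: nat set))"
  show ?thesis
    unfolding second_countable_def
  proof (intro exI[of _ ?\<B>] conjI ballI allI impI)
    show "countable ?\<B>" using C(1) by (intro countable_image countable_SIGMA) auto
    show "openin T V" if "V \<in> ?\<B>" for V using that by (auto simp: T)
    fix U z assume "openin T U \<and> z \<in> U"
    then obtain e where e: "e > 0" "mball z e \<subseteq> U" and z: "z \<in> M"
      unfolding T openin_mtopology by blast
    obtain n where n: "inverse (real (Suc n)) < e / 2" using reals_Archimedean[of "e/2"] e(1) by auto
    have "z \<in> mtopology closure_of C" using C(3) z by simp
    then have "\<forall>r>0. \<exists>c\<in>C. c \<in> mball z r" unfolding metric_closure_of by blast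
    moreover have "inverse (real (Suc n)) > 0" by simp
    ultimately obtain c where c: "c \<in> C" "c \<in> mball z (inverse (Suc n))" by blast
    have "mball c (inverse (Suc n)) \<subseteq> U"
    proof
      fix w assume w: "w \<in> mball c (inverse (Suc n))"
      then have "d z w < e" using c(2) n triangle[of z c w] by auto
      then show "w \<in> U" using e(2) w z by auto
    qed
    moreover have "z \<in> mball c (inverse (Suc n))" using c(2) by (auto simp: commute)
    ultimately show "\<exists>V\<in>?\<B>. z \<in> V \<and> V \<subseteq> U" using c(1) by auto
  qed
qed

lemma Polish_space_iff: "Polish_space T \<longleftrightarrow> Polish T"
  using metrizable_separable_imp_second_countable second_countable_imp_separable_space
    completely_metrizable_imp_metrizable_space
  unfolding Polish_space_def Polish_def by blast

lemma second_countable_prod_topology: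
  assumes "second_countable X" "second_countable Y"
  shows "second_countable (prod_topology X Y)"
proof -
  obtain \<B> where \<B>: "countable \<B>" "\<And>V. V \<in> \<B> \<Longrightarrow> openin X V" "\<And>U z. openin X U \<Longrightarrow> z \<in> U \<Longrightarrow> \<exists>V\<in>\<B>. z \<in> V \<and> V \<subseteq> U"
    using assms(1) unfolding second_countable_def by metis
  obtain \<C> where \<C>: "countable \<C>" "\<And>V. V \<in> \<C> \<Longrightarrow> openin Y V" "\<And>U z. openin Y U \<Longrightarrow> z \<in> U \<Longrightarrow> \<exists>V\<in>\<C>. z \<in> V \<and> V \<subseteq> U"
    using assms(2) unfolding second_countable_def by metis
  show ?thesis
    unfolding second_countable_def
  proof (intro exI[of _ "(\<lambda>(V, W). V \<times> W) ` (\<B> \<times> \<C>)"] conjI ballI allI impI)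
    show "countable ((\<lambda>(V, W). V \<times> W) ` (\<B> \<times> \<C>))" using \<B>(1) \<C>(1) by blast
    show "openin (prod_topology X Y) V" if "V \<in> (\<lambda>(V, W). V \<times> W) ` (\<B> \<times> \<C>)" for V
      using that \<B>(2) \<C>(2) by (auto simp: openin_prod_Times_iff)
    fix U z assume U: "openin (prod_topology X Y) U \<and> z \<in> U"
    obtain a b where z: "z = (a, b)" by fastforce
    obtain V W where VW: "openin X V" "openin Y W" "a \<in> V" "b \<in> W" "V \<times> W \<subseteq> U"
      using U unfolding openin_prod_topology_alt z by blast
    obtain V' W' where "V' \<in> \<B>" "a \<in> V'" "V' \<subseteq> V" "W' \<in> \<C>" "b \<in> W'" "W' \<subseteq> W"
      using \<B>(3)[OF VW(1,3)] \<C>(3)[OF VW(2,4)] by blast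
    then show "\<exists>V\<in>(\<lambda>(V, W). V \<times> W) ` (\<B> \<times> \<C>). z \<in> V \<and> V \<subseteq> U"
      using VW(5) z by (intro bexI[of _ "V' \<times> W'"]) auto
  qed
qed

lemma second_countable_product_topology:
  fixes X :: "'i::countable \<Rightarrow> 'a topology"
  assumes "\<And>i. second_countable (X i)"
  shows "second_countable (product_topology X UNIV)"
proof -
  have "\<exists>\<B>. countable \<B> \<and> (\<forall>V\<in>\<B>. openin (X i) V) \<and> (\<forall>U z. openin (X i) U \<and> z \<in> U \<longrightarrow> (\<exists>V\<in>\<B>. z \<in> V \<and> V \<subseteq> U))" for i
    using assms unfolding second_countable_def by blast
  then obtain \<B> where \<B>: "\<And>i. countable (\<B> i)" "\<And>i V. V \<in> \<B> i \<Longrightarrow> openin (X i) V"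
    "\<And>i U z. openin (X i) U \<Longrightarrow> z \<in> U \<Longrightarrow> \<exists>V\<in>\<B> i. z \<in> V \<and> V \<subseteq> U"
    by metis
  define cyl where "cyl l = {f \<in> topspace (product_topology X UNIV). \<forall>(i, V)\<in>set l. f i \<in> V}" for l
  let ?\<C> = "cyl ` lists (SIGMA i:UNIV. \<B> i)"
  show ?thesis
    unfolding second_countable_def
  proof (intro exI[of _ ?\<C>] conjI ballI allI impI)
    show "countable ?\<C>" using \<B>(1) by (intro countable_image countable_lists countable_SIGMA) auto
    fix W assume "W \<in> ?\<C>"
    then obtain l where l: "l \<in> lists (SIGMA i:UNIV. \<B> i)" "W = cyl l" by blast
    from l(1) have "openin (product_topology X UNIV) (cyl l)"
    proof (induction l)
      case Nil
      have "cyl [] = topspace (product_topology X UNIV)" by (simp add: cyl_def del: topspace_product_topology)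
      then show ?case by (simp only: openin_topspace)
    next
      case (Cons a l)
      obtain i V where a: "a = (i, V)" by fastforce
      have "openin (product_topology X UNIV) {f \<in> topspace (product_topology X UNIV). f i \<in> V}"
        using Cons.hyps(1) \<B>(2)[of V i] a
        by (intro openin_continuous_map_preimage[of _ "X i"] continuous_map_product_projection) auto
      moreover have "cyl (a # l) = {f \<in> topspace (product_topology X UNIV). f i \<in> V} \<inter> cyl l"
        by (auto simp: cyl_def a)
      ultimately show ?case using Cons by auto
    qed
    then show "openin (product_topology X UNIV) W" using l by simp
  next
    fix U f assume "openin (product_topology X UNIV) U \<and> f \<in> U"
    then have "openin (product_topology X UNIV) U" and fU: "f \<in> U" by auto
    then obtain W where W: "finite {i. W i \<noteq> topspace (X i)}" "\<And>i. openin (X i) (W i)" "f \<in> Pi\<^sub>E UNIV W" "Pi\<^sub>E UNIV W \<subseteq> U"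
      unfolding openin_product_topology_alt by auto
    have f: "f \<in> topspace (product_topology X UNIV)"
      using W(2,3) openin_subset by (fastforce simp: PiE_iff)
    have "\<exists>V\<in>\<B> i. f i \<in> V \<and> V \<subseteq> W i" for i
      using \<B>(3)[OF W(2)] W(3) by (simp add: PiE_iff)
    then obtain V where V: "\<And>i. V i \<in> \<B> i \<and> f i \<in> V i \<and> V i \<subseteq> W i" by metis
    obtain l where l: "set l = {i. W i \<noteq> topspace (X i)}" using W(1) finite_list by blast
    let ?l = "map (\<lambda>i. (i, V i)) l"
    have "cyl ?l \<subseteq> U"
    proof
      fix g assume g: "g \<in> cyl ?l"
      have "g i \<in> W i" for i
        using g V[of i] l by (cases "W i = topspace (X i)") (auto simp: cyl_def PiE_iff)
      then show "g \<in> U" using W(4) by (auto simp: PiE_iff)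
    qed
    moreover have "f \<in> cyl ?l" using f V by (auto simp: cyl_def)
    moreover have "?l \<in> lists (SIGMA i:UNIV. \<B> i)" using V by auto
    ultimately show "\<exists>V\<in>?\<C>. f \<in> V \<and> V \<subseteq> U" by blast
  qed
qed

lemma Polish_prod_topology: "Polish X \<Longrightarrow> Polish Y \<Longrightarrow> Polish (prod_topology X Y)"
  by (simp add: Polish_def completely_metrizable_space_prod_topology second_countable_prod_topology)

lemma Polish_product_topology:
  fixes X :: "'i::countable \<Rightarrow> 'a topology"
  shows "(\<And>i. Polish (X i)) \<Longrightarrow> Polish (product_topology X UNIV)"
  by (simp add: Polish_def completely_metrizable_space_product_topology second_countable_product_topology)

lemma Polish_closedin: "Polish X \<Longrightarrow> closedin X S \<Longrightarrow> Polish (subtopology X S)"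
  by (simp add: Polish_def completely_metrizable_space_closedin second_countable_subtopology)

lemma Polish_Hausdorff: "Polish X \<Longrightarrow> Hausdorff_space X"
  by (simp add: Polish_def completely_metrizable_imp_metrizable_space metrizable_imp_Hausdorff_space)

text \<open>A point is coded by the indicator values of the basic open sets; disjoint neighbourhoods
  of two points yield a basic set that tells them apart.\<close>

lemma second_countable_Hausdorff_injection:
  assumes "second_countable X" "Hausdorff_space X"
  obtains j :: "'a \<Rightarrow> nat \<Rightarrow> real" where "inj_on j (topspace X)"
proof -
  obtain \<B> where \<B>: "countable \<B>" "\<And>V. V \<in> \<B> \<Longrightarrow> openin X V" "\<And>U z. openin X U \<Longrightarrow> z \<in> U \<Longrightarrow> \<exists>V\<in>\<B>. z \<in> V \<and> V \<subseteq> U"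
    using assms(1) unfolding second_countable_def by metis
  define V where "V = from_nat_into (insert {} \<B>)"
  have rV: "range V = insert {} \<B>" unfolding V_def using \<B>(1) by (intro range_from_nat_into) auto
  have "inj_on (\<lambda>z n. indicat_real (V n) z) (topspace X)"
  proof (rule inj_onI, rule ccontr)
    fix y z assume yz: "y \<in> topspace X" "z \<in> topspace X" "(\<lambda>n. indicat_real (V n) y) = (\<lambda>n. indicat_real (V n) z)" "y \<noteq> z"
    then obtain U U' where "openin X U" "openin X U'" "y \<in> U" "z \<in> U'" "disjnt U U'"
      using assms(2) unfolding Hausdorff_space_def by blast
    then obtain W where W: "W \<in> \<B>" "y \<in> W" "z \<notin> W" using \<B>(3) by (metis disjnt_iff subsetD)
    then obtain n where "V n = W" using rV by (metis insertI2 rangeE)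
    then show False using fun_cong[OF yz(3), of n] W by simp
  qed
  then show ?thesis by (rule that)
qed

text \<open>
  A Polish space has at most the cardinality of the continuum, so its topology can be transported
  to a subset of the type of real sequences.
\<close>

lemma analytic_inI:
  assumes P: "Polish P" and f: "continuous_map P T f" and A: "f ` topspace P = A"
  shows "analytic_in T A"
proof -
  obtain j :: "_ \<Rightarrow> nat \<Rightarrow> real" where j: "inj_on j (topspace P)"
    using second_countable_Hausdorff_injection P Polish_Hausdorff unfolding Polish_def by metis
  define j' where "j' = inv_into (topspace P) j"
  \<comment> \<open>The topology is pulled back along the inverse of \<open>j\<close>, which makes
    \<open>j\<close> a homeomorphism by construction although it need not be continuous into the
    real sequences.\<close>
  define P' where "P' = pullback_topology (j ` topspace P) j' P"
  have jj: "j' (j z) = z" if "z \<in> topspace P" for z using j that by (simp add: j'_def)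
  have top: "topspace P' = j ` topspace P"
    unfolding P'_def topspace_pullback_topology using jj by auto
  have 1: "continuous_map P' P j'"
    using continuous_map_pullback[OF continuous_map_id, of "j ` topspace P" j' P] by (simp add: P'_def)
  have "continuous_map P P (j' \<circ> j)"
    by (rule continuous_map_eq[OF continuous_map_id]) (simp add: jj)
  then have 2: "continuous_map P P' j"
    unfolding P'_def by (rule continuous_map_pullback') auto
  have "homeomorphic_maps P P' j j'"
    using 1 2 jj top by (auto simp: homeomorphic_maps_def)
  then have "P homeomorphic_space P'" by (auto simp: homeomorphic_space_def)
  then have "Polish P'"
    using P homeomorphic_completely_metrizable_space homeomorphic_space_second_countability
    unfolding Polish_def by blast
  moreover have "continuous_map P' T (f \<circ> j')" using continuous_map_compose[OF 1 f] .
  moreover have "(f \<circ> j') ` topspace P' = A" unfolding top A[symmetric] using jj by (force simp: image_iff)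
  ultimately show ?thesis unfolding analytic_in_def Polish_space_iff by blast
qed

section \<open>Closure properties of analytic sets\<close>

lemma analytic_inE:
  assumes "analytic_in T A"
  obtains P :: "(nat \<Rightarrow> real) topology" and f where "Polish P" "continuous_map P T f" "f ` topspace P = A"
  using assms unfolding analytic_in_def Polish_space_iff by blast

lemma analytic_in_closedin:
  assumes "Polish T" "closedin T A"
  shows "analytic_in T A"
proof (rule analytic_inI)
  show "Polish (subtopology T A)" using assms by (rule Polish_closedin)
  show "continuous_map (subtopology T A) T id" by (simp add: continuous_map_from_subtopology)
  show "id ` topspace (subtopology T A) = A" using closedin_subset[OF assms(2)] by auto
qed

text \<open>Parametrised by the sequences of parameters on which all maps \<open>f n\<close> take
  the same value, a closed subset of the product in a Hausdorff target.\<close>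

lemma analytic_in_INT:
  assumes "Hausdorff_space T" "\<And>n::nat. analytic_in T (A n)"
  shows "analytic_in T (\<Inter>n. A n)"
proof -
  have "\<exists>P f. Polish (P :: (nat \<Rightarrow> real) topology) \<and> continuous_map P T f \<and> f ` topspace P = A n" for n
    using analytic_inE[OF assms(2)] by metis
  then obtain P :: "nat \<Rightarrow> (nat \<Rightarrow> real) topology" and f where
    P: "\<And>n. Polish (P n)" "\<And>n. continuous_map (P n) T (f n)" "\<And>n. f n ` topspace (P n) = A n" by metis
  let ?\<Pi> = "product_topology P UNIV"
  let ?f = "\<lambda>n y. f n (y n)"
  have cf: "continuous_map ?\<Pi> T (?f n)" for n
    using continuous_map_compose[OF continuous_map_product_projection[of n UNIV P] P(2)] by (simp add: o_def)
  define S where "S = {y \<in> topspace ?\<Pi>. \<forall>n. ?f n y = ?f 0 y}"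
  have S: "S = (\<Inter>n. {y \<in> topspace ?\<Pi>. ?f n y = ?f 0 y})" by (auto simp: S_def)
  have "closedin ?\<Pi> S"
    unfolding S by (intro closedin_INT closedin_continuous_maps_eq[OF assms(1)] cf) auto
  have top: "topspace (subtopology ?\<Pi> S) = S" by (auto simp: S_def)
  show ?thesis
  proof (rule analytic_inI)
    show "Polish (subtopology ?\<Pi> S)" using \<open>closedin ?\<Pi> S\<close> P(1) by (intro Polish_closedin Polish_product_topology)
    show "continuous_map (subtopology ?\<Pi> S) T (?f 0)" by (rule continuous_map_from_subtopology[OF cf])
    show "?f 0 ` topspace (subtopology ?\<Pi> S) = (\<Inter>n. A n)"
    proof (intro equalityI subsetI)
      fix z assume "z \<in> ?f 0 ` topspace (subtopology ?\<Pi> S)"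
      then obtain y where y: "y \<in> S" "z = ?f 0 y" unfolding top by blast
      have "z \<in> A n" for n
      proof -
        have "y n \<in> topspace (P n)" "f n (y n) = f 0 (y 0)" using y(1) by (simp_all add: S_def PiE_iff)
        then show ?thesis using y(2) P(3)[of n] by (metis imageI)
      qed
      then show "z \<in> (\<Inter>n. A n)" by blast
    next
      fix z assume "z \<in> (\<Inter>n. A n)"
      then have "\<exists>y. y \<in> topspace (P n) \<and> f n y = z" for n using P(3)[of n] by blast
      then obtain y where "\<And>n. y n \<in> topspace (P n) \<and> f n (y n) = z" by metis
      then show "z \<in> ?f 0 ` topspace (subtopology ?\<Pi> S)"
        unfolding top by (intro image_eqI[of _ _ y]) (auto simp: S_def)
    qed
  qed
qed

text \<open>A parameter is an index \<open>n\<close> with a whole sequence of which only the entry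
  at \<open>n\<close> is read. The other entries are padding, available because no
  \<open>A n\<close> is empty.\<close>

lemma analytic_in_UN_nonempty:
  assumes "\<And>n::nat. analytic_in T (A n)" "\<And>n. A n \<noteq> {}"
  shows "analytic_in T (\<Union>n. A n)"
proof -
  have "\<exists>P f. Polish (P :: (nat \<Rightarrow> real) topology) \<and> continuous_map P T f \<and> f ` topspace P = A n" for n
    using analytic_inE[OF assms(1)] by metis
  then obtain P :: "nat \<Rightarrow> (nat \<Rightarrow> real) topology" and f where
    P: "\<And>n. Polish (P n)" "\<And>n. continuous_map (P n) T (f n)" "\<And>n. f n ` topspace (P n) = A n" by metis
  let ?\<Pi> = "product_topology P UNIV"
  let ?Q = "prod_topology (discrete_topology (UNIV :: nat set)) ?\<Pi>"
  have "\<exists>y. y \<in> topspace (P n)" for n using P(3)[of n] assms(2)[of n] by blast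
  then obtain y0 where y0: "\<And>n. y0 n \<in> topspace (P n)" by metis
  show ?thesis
  proof (rule analytic_inI)
    have "Polish (discrete_topology (UNIV :: nat set))"
      by (simp add: Polish_def completely_metrizable_space_discrete_topology second_countable_discrete_topology)
    then show "Polish ?Q" using P(1) by (intro Polish_prod_topology Polish_product_topology)
    show "continuous_map ?Q T (\<lambda>(n, y). f n (y n))"
    proof (rule pasting_lemma[where I = UNIV and T = "\<lambda>n. {n} \<times> topspace ?\<Pi>" and f = "\<lambda>n z. f n (snd z n)"])
      show "openin ?Q ({n} \<times> topspace ?\<Pi>)" for n
        using openin_topspace[of ?\<Pi>] unfolding openin_prod_Times_iff by (simp del: topspace_product_topology)
      have "continuous_map ?Q T (\<lambda>z. f n (snd z n))" for n
        using continuous_map_compose[OF continuous_map_compose[OF continuous_map_snd continuous_map_product_projection[of n UNIV P]] P(2)]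
        by (simp add: o_def)
      then show "continuous_map (subtopology ?Q ({n} \<times> topspace ?\<Pi>)) T (\<lambda>z. f n (snd z n))" for n
        by (rule continuous_map_from_subtopology)
    qed auto
    show "(\<lambda>(n, y). f n (y n)) ` topspace ?Q = (\<Union>n. A n)"
    proof (intro equalityI subsetI)
      fix z assume "z \<in> (\<lambda>(n, y). f n (y n)) ` topspace ?Q"
      then obtain n y where "y \<in> topspace ?\<Pi>" "z = f n (y n)" by auto
      then show "z \<in> (\<Union>n. A n)" using P(3)[of n] by (force simp: PiE_iff)
    next
      fix z assume "z \<in> (\<Union>n. A n)"
      then obtain n where "z \<in> f n ` topspace (P n)" unfolding P(3) by blast
      then obtain w where "w \<in> topspace (P n)" "f n w = z" by blast
      then show "z \<in> (\<lambda>(n, y). f n (y n)) ` topspace ?Q"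
        using y0 by (intro image_eqI[of _ _ "(n, y0(n := w))"]) auto
    qed
  qed
qed

lemma analytic_in_UN:
  assumes "\<And>n::nat. analytic_in T (A n)"
  shows "analytic_in T (\<Union>n. A n)"
proof (cases "\<exists>m. A m \<noteq> {}")
  case True
  then obtain m where m: "A m \<noteq> {}" by blast
  define B where "B n = (if A n = {} then A m else A n)" for n
  have "analytic_in T (\<Union>n. B n)" using assms m by (intro analytic_in_UN_nonempty) (auto simp: B_def)
  moreover have "(\<Union>n. B n) = (\<Union>n. A n)"
    by (auto simp: B_def split: if_splits)
  ultimately show ?thesis by simp
next
  case False
  then have "(\<Union>n. A n) = A 0" by blast
  then show ?thesis using assms[of 0] by simp
qed

text \<open>The pairs of a point \<open>p\<close> and a parameter whose value is related to
  \<open>p\<close> form a closed set in a product of Polish spaces; the preimage is its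
  projection.\<close>

lemma analytic_in_relation_preimage:
  assumes T: "Polish T" and R: "closedin (prod_topology T T) R" and A: "analytic_in T A"
  shows "analytic_in T {p. \<exists>q\<in>A. (p, q) \<in> R}"
proof -
  obtain P :: "(nat \<Rightarrow> real) topology" and f where P: "Polish P" "continuous_map P T f" "f ` topspace P = A"
    using analytic_inE[OF A] .
  let ?Q = "prod_topology T P"
  let ?g = "\<lambda>z. (fst z, f (snd z))"
  have g: "continuous_map ?Q (prod_topology T T) ?g"
    using continuous_map_compose[OF continuous_map_snd P(2)]
    by (intro continuous_map_pairedI continuous_map_fst) (simp add: o_def)
  define S where "S = {z \<in> topspace ?Q. ?g z \<in> R}"
  have S: "closedin ?Q S" unfolding S_def by (rule closedin_continuous_map_preimage[OF g R])
  have top: "topspace (subtopology ?Q S) = S" by (auto simp: S_def)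
  show ?thesis
  proof (rule analytic_inI)
    show "Polish (subtopology ?Q S)" by (intro Polish_closedin Polish_prod_topology T P S)
    show "continuous_map (subtopology ?Q S) T fst" by (intro continuous_map_from_subtopology continuous_map_fst)
    show "fst ` topspace (subtopology ?Q S) = {p. \<exists>q\<in>A. (p, q) \<in> R}"
      unfolding top P(3)[symmetric] S_def using closedin_subset[OF R] by force
  qed
qed


section \<open>The Polish space of loops\<close>

lemma continuous_map_loop_evaluation:
  fixes X :: "'a::metric_space set"
  assumes "t \<in> {0..1}"
  shows "continuous_map (mtopology_of (loop_metric X x)) euclidean (\<lambda>p. p t)"
  unfolding continuous_map_def
proof (intro conjI allI impI)
  fix U :: "'a set" assume "openin euclidean U"
  then have U: "open U" by simp
  show "openin (mtopology_of (loop_metric X x)) {p \<in> topspace (mtopology_of (loop_metric X x)). p t \<in> U}"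
    unfolding openin_loop_metric topspace_loop_metric
  proof (intro conjI ballI)
    fix p assume p: "p \<in> {p \<in> loops (top_of_set X) x. p t \<in> U}"
    then obtain e where e: "e > 0" "ball (p t) e \<subseteq> U" using U openE by blast
    have "q t \<in> U" if q: "q \<in> loops (top_of_set X) x" "mdist (loop_metric X x) p q < e" for q
    proof -
      have "dist (p t) (q t) < e" using mspace_dist_less[of p X x q t] p q assms by auto
      then show ?thesis using e(2) by auto
    qed
    then show "\<exists>e>0. \<forall>q\<in>loops (top_of_set X) x. mdist (loop_metric X x) p q < e \<longrightarrow>
        q \<in> {p \<in> loops (top_of_set X) x. p t \<in> U}"
      using e(1) by blast
  qed blast
qed simp

text \<open>Compactness makes \<open>X\<close> complete, hence also the function space, in which the
  endpoint conditions are closed.\<close>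

lemma completely_metrizable_loop_space:
  fixes X :: "'a::metric_space set"
  assumes "compact X"
  shows "completely_metrizable_space (mtopology_of (loop_metric X x))"
proof -
  let ?m = "submetric euclidean_metric X" and ?I = "top_of_set {0..1::real}"
  interpret X: Metric_space X dist
    by unfold_locales (auto simp: dist_commute dist_triangle)
  have m: "?m = X.Self" by (simp add: submetric_def X.Self_def euclidean_metric_def)
  have mt: "mtopology_of ?m = top_of_set X" by (simp add: mtopology_of_submetric)
  then have xt: "X.mtopology = top_of_set X" using m by (simp add: mtopology_of_def)
  have "compact_space X.mtopology" unfolding xt using assms by (simp add: compact_space_subtopology)
  then have "X.mcomplete" by (rule X.compact_space_imp_mcomplete)
  then have mc: "mcomplete_of (cfunspace ?I ?m)" unfolding m by (rule X.mcomplete_cfunspace)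
  let ?c = "cfunspace ?I ?m"
  interpret C: Metric_space "mspace ?c" "mdist ?c" by (rule Metric_space_mspace_mdist)
  have Ct: "mtopology_of ?c = C.mtopology" by (simp add: mtopology_of_def)
  have "completely_metrizable_space (mtopology_of ?c)"
    using mc C.Metric_space_axioms unfolding completely_metrizable_space_def mcomplete_of_def Ct by blast
  moreover have "closedin (mtopology_of ?c) (loops (top_of_set X) x)"
    unfolding Ct C.closedin_metric
  proof (intro conjI allI impI)
    let ?L = "loops (top_of_set X) x"
    have sub: "?L = mspace ?c \<inter> ?L"
      using mspace_loop_metric[of X x] unfolding loop_metric_def by auto
    then show "?L \<subseteq> mspace ?c" by blast
    fix p assume p: "p \<in> mspace ?c - ?L"
    have pc: "p \<in> extensional {0..1}" "continuous_map ?I (top_of_set X) p"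
      using p unfolding mspace_cfunspace mt by auto
    then have "p 0 \<noteq> x \<or> p 1 \<noteq> x"
      using p by (auto simp: loops_def pathin_def pathstart_def pathfinish_def)
    then have "\<exists>t. t \<in> {0..1} \<and> (t = 0 \<or> t = 1) \<and> p t \<noteq> x"
      by (metis atLeastAtMost_iff order_refl zero_le_one)
    then obtain t where t: "t \<in> {0..1}" "t = 0 \<or> t = 1" "p t \<noteq> x" by blast
    have "disjnt ?L (C.mball p (dist (p t) x))"
      unfolding disjnt_iff
    proof (intro allI notI, elim conjE)
      fix q assume q: "q \<in> ?L" "q \<in> C.mball p (dist (p t) x)"
      have pm: "p \<in> mspace ?c" using p by blast
      have qm: "q \<in> mspace ?c" using q(1) sub by blast
      have "mdist ?m (p t) (q t) \<le> mdist ?c p q"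
        by (rule mdist_cfunspace_imp_mdist_le[OF pm qm order_refl]) (use t(1) in simp)
      moreover have "mdist ?c p q < dist (p t) x" using q(2) unfolding C.in_mball by blast
      moreover have "q t = x" using q(1) t(2) by (auto simp: loops_def pathstart_def pathfinish_def)
      ultimately show False by (simp del: mspace_cfunspace)
    qed
    moreover have "dist (p t) x > 0" using t by simp
    ultimately show "\<exists>r>0. disjnt ?L (C.mball p r)" by blast
  qed
  ultimately show ?thesis
    unfolding loop_metric_def mtopology_of_submetric by (rule completely_metrizable_space_closedin)
qed

lemma mdist_loop_metric_le:
  assumes "p \<in> loops (top_of_set X) x" "q \<in> loops (top_of_set X) x" "\<And>t. t \<in> {0..1} \<Longrightarrow> dist (p t) (q t) \<le> B"
  shows "mdist (loop_metric X x) p q \<le> B"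
  unfolding mdist_loop_metric[OF assms(1,2)] using assms(3) by (intro cSUP_least) auto

text \<open>Step functions with values in finite nets approximate loops but are not loops. So they
  serve only as codes, and one loop is selected for every code that some loop realises.\<close>

lemma separable_loop_space:
  fixes X :: "'a::metric_space set"
  assumes "compact X"
  shows "separable_space (mtopology_of (loop_metric X x))"
proof -
  let ?L = "loops (top_of_set X) x"
  have "\<exists>C. finite C \<and> C \<subseteq> X \<and> X \<subseteq> (\<Union>c\<in>C. ball c (inverse (Suc k)))" for k :: nat
    using compact_imp_seq_compact[OF assms] seq_compact_imp_totally_bounded[of X]
    by (metis inverse_positive_iff_positive of_nat_0_less_iff zero_less_Suc)
  then obtain C where C: "\<And>k::nat. finite (C k)" "\<And>k. X \<subseteq> (\<Union>c\<in>C k. ball c (inverse (Suc k)))" by metis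
  \<comment> \<open>The factor \<open>2\<close> combines the distance to the net with the
    oscillation over a subinterval; two loops with the same code then differ by at most four
    units.\<close>
  define code where "code k l p \<longleftrightarrow> p \<in> ?L \<and> length l > 0 \<and>
     (\<forall>i<length l. \<forall>s\<in>{0..1::real}. real i \<le> s * length l \<and> s * length l \<le> real (Suc i) \<longrightarrow> dist (l ! i) (p s) \<le> 2 * inverse (Suc k))"
    for k :: nat and l :: "'a list" and p
  let ?D = "{p. \<exists>k l. l \<in> lists (C k) \<and> (\<exists>p. code k l p) \<and> p = (SOME p. code k l p)}"
  have D_code: "\<exists>q\<in>?D. code k l q" if "code k l p" "l \<in> lists (C k)" for k l p
    using that someI[of "code k l" p] by blast
  have cell: "\<exists>i<n. real i \<le> t * n \<and> t * n \<le> real (Suc i)" if "t \<in> {0..1}" "n > 0" for t :: real and n :: nat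
  proof (cases "t = 1")
    case True
    then show ?thesis using that by (intro exI[of _ "n - 1"]) auto
  next
    case False
    then have t: "0 \<le> t * n" "t * n < n" using that by auto
    then have "nat \<lfloor>t * n\<rfloor> < n" by linarith
    moreover have "real (nat \<lfloor>t * n\<rfloor>) \<le> t * n" "t * n \<le> real (Suc (nat \<lfloor>t * n\<rfloor>))"
      using t by linarith+
    ultimately show ?thesis by blast
  qed
  have close: "mdist (loop_metric X x) p q \<le> 4 * inverse (Suc k)" if pq: "code k l p" "code k l q" for k l p q
  proof (rule mdist_loop_metric_le)
    show "p \<in> ?L" "q \<in> ?L" using pq by (auto simp: code_def)
    fix t :: real assume t: "t \<in> {0..1}"
    have "length l > 0" using pq(1) by (simp add: code_def)
    from cell[OF t this] obtain i where i: "i < length l" "real i \<le> t * length l" "t * length l \<le> real (Suc i)"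
      by blast
    then have "dist (l ! i) (p t) \<le> 2 * inverse (Suc k)" "dist (l ! i) (q t) \<le> 2 * inverse (Suc k)"
      using pq t unfolding code_def by blast+
    then show "dist (p t) (q t) \<le> 4 * inverse (Suc k)"
      using dist_triangle3[of "p t" "q t" "l ! i"] by linarith
  qed
  have coded: "\<exists>l\<in>lists (C k). code k l p" if p: "p \<in> ?L" for p k
  proof -
    have pp: "path p" "path_image p \<subseteq> X" using p by (auto simp: loops_def pathin_top_of_set)
    have "uniformly_continuous_on {0..1} p"
      using pp by (intro compact_uniformly_continuous) (auto simp: path_def)
    then obtain d where d: "d > 0" "\<And>s t. s \<in> {0..1} \<Longrightarrow> t \<in> {0..1} \<Longrightarrow> dist s t < d \<Longrightarrow> dist (p s) (p t) < inverse (Suc k)"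
      unfolding uniformly_continuous_on_def by (metis inverse_positive_iff_positive of_nat_0_less_iff zero_less_Suc)
    obtain n :: nat where n: "inverse (real n) < d" "n \<noteq> 0"
      using ex_inverse_of_nat_less[OF d(1)] by auto
    have "\<exists>c\<in>C k. dist c (p (real i / n)) < inverse (Suc k)" if "i < n" for i
    proof -
      have "p (real i / n) \<in> X" using pp(2) that n by (auto simp: path_image_def image_subset_iff)
      then obtain c where "c \<in> C k" "p (real i / n) \<in> ball c (inverse (Suc k))" using C(2)[of k] by blast
      then show ?thesis by (intro bexI[of _ c]) auto
    qed
    then obtain c where c: "\<And>i. i < n \<Longrightarrow> c i \<in> C k \<and> dist (c i) (p (real i / n)) < inverse (Suc k)" by metis
    let ?l = "map c [0..<n]"
    have "dist (c i) (p s) \<le> 2 * inverse (Suc k)"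
      if i: "i < n" and s: "s \<in> {0..1}" "real i \<le> s * n" "s * n \<le> real (Suc i)" for i and s :: real
    proof -
      have "\<bar>real i / n - s\<bar> \<le> inverse (real n)"
      proof -
        have "real i / n - s = (real i - s * n) / n" using n(2) by (simp add: field_simps)
        moreover have "\<bar>real i - s * n\<bar> \<le> 1" using s by simp
        ultimately show ?thesis using n(2) by (simp add: inverse_eq_divide divide_right_mono)
      qed
      then have "dist (p (real i / n)) (p s) < inverse (Suc k)"
        using d(2)[of "real i / n" s] i s(1) n by (simp add: dist_real_def)
      then show ?thesis using c[OF i] dist_triangle[of "c i" "p s" "p (real i / n)"] by linarith
    qed
    then have "code k ?l p" using p n(2) by (simp add: code_def)
    moreover have "?l \<in> lists (C k)" using c by auto
    ultimately show ?thesis by blast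
  qed
  show ?thesis
    unfolding separable_space_def topspace_loop_metric
  proof (intro exI[of _ ?D] conjI)
    have "?D \<subseteq> (\<lambda>(k, l). SOME p. code k l p) ` (SIGMA k:UNIV. lists (C k))" by auto
    moreover have "countable \<dots>"
      using C(1) by (intro countable_image countable_SIGMA countable_lists) (auto intro: countable_finite)
    ultimately show "countable ?D" by (rule countable_subset)
    have D_L: "?D \<subseteq> ?L"
    proof clarify
      fix k l p assume "code k l p"
      then have "code k l (SOME p. code k l p)" by (rule someI[of "code k l"])
      then show "(SOME p. code k l p) \<in> ?L" unfolding code_def by (rule conjunct1)
    qed
    then show "?D \<subseteq> ?L" .
    show "mtopology_of (loop_metric X x) closure_of ?D = ?L"
    proof
      show "mtopology_of (loop_metric X x) closure_of ?D \<subseteq> ?L"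
        using closure_of_subset_topspace[of "mtopology_of (loop_metric X x)" ?D] unfolding topspace_loop_metric .
      show "?L \<subseteq> mtopology_of (loop_metric X x) closure_of ?D"
      proof
        fix p assume p: "p \<in> ?L"
        show "p \<in> mtopology_of (loop_metric X x) closure_of ?D"
          unfolding in_closure_of topspace_loop_metric
        proof (intro conjI allI impI p)
          fix U assume "p \<in> U \<and> openin (mtopology_of (loop_metric X x)) U"
          then obtain e where e: "e > 0" "\<And>q. q \<in> ?L \<Longrightarrow> mdist (loop_metric X x) p q < e \<Longrightarrow> q \<in> U"
            unfolding openin_loop_metric by blast
          obtain k :: nat where k: "inverse (real (Suc k)) < e / 4" using reals_Archimedean[of "e/4"] e(1) by auto
          obtain l where l: "l \<in> lists (C k)" "code k l p" using coded[OF p] by blast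
          obtain q where q: "q \<in> ?D" "code k l q" using D_code[OF l(2,1)] by blast
          have "mdist (loop_metric X x) p q < e" using close[OF l(2) q(2)] k by simp
          then have "q \<in> U" using e(2) q(2) by (simp add: code_def)
          then show "\<exists>q. q \<in> ?D \<and> q \<in> U" using q(1) by blast
        qed
      qed
    qed
  qed
qed

lemma Polish_loop_space:
  fixes X :: "'a::metric_space set"
  assumes "compact X"
  shows "Polish (mtopology_of (loop_metric X x))"
  using completely_metrizable_loop_space[OF assms] separable_loop_space[OF assms]
  by (simp add: Polish_space_def flip: Polish_space_iff)


section \<open>Elementary moves of loops\<close>

text \<open>All conditions are equalities or non-strict bounds, so that the relation is closed.
  Agreement includes the endpoints of the interval, and \<open>a > b\<close> forces agreement
  everywhere.\<close>

definition move_on :: "real \<Rightarrow> real \<Rightarrow> real \<Rightarrow> (real \<Rightarrow> 'a::metric_space) \<Rightarrow> (real \<Rightarrow> 'a) \<Rightarrow> bool" where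
  "move_on e a b p q \<longleftrightarrow> (\<forall>t\<in>{0..1} \<inter> ({..a} \<union> {b..}). p t = q t) \<and>
     (\<forall>s\<in>{0..1} \<inter> {a..b}. \<forall>t\<in>{0..1} \<inter> {a..b}. dist (p s) (p t) \<le> e \<and> dist (q s) (q t) \<le> e)"

text \<open>Rational endpoints keep the number of kinds of moves countable.\<close>

definition move :: "real \<Rightarrow> 'a::metric_space set \<Rightarrow> 'a \<Rightarrow> (real \<Rightarrow> 'a) \<Rightarrow> (real \<Rightarrow> 'a) \<Rightarrow> bool" where
  "move e X x p q \<longleftrightarrow> loop_at (top_of_set X) x p \<and> loop_at (top_of_set X) x q \<and>
     (\<exists>(n :: nat) (i :: nat) (j :: nat). j \<le> n \<and> move_on e (real i / real n) (real j / real n) p q)"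

section \<open>Elementary moves and concatenation\<close>

lemma loop_at_top_of_setD:
  assumes "loop_at (top_of_set X) x p"
  shows "continuous_on {0..1} p" "p ` {0..1} \<subseteq> X" "p 0 = x" "p 1 = x"
  using assms by (auto simp: loop_at_def pathin_top_of_set path_def path_image_def pathstart_def pathfinish_def)

lemma moveI:
  "loop_at (top_of_set X) x p \<Longrightarrow> loop_at (top_of_set X) x q \<Longrightarrow> j \<le> n \<Longrightarrow>
     move_on e (real i / real n) (real j / real n) p q \<Longrightarrow> move e X x p q"
  unfolding move_def by blast

lemma moveE:
  assumes "move e X x p q"
  obtains n i j :: nat where "loop_at (top_of_set X) x p" "loop_at (top_of_set X) x q"
    "0 \<le> real i / n" "j \<le> n" "real j / n \<le> 1" "move_on e (real i / real n) (real j / real n) p q"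
  using assms unfolding move_def by (auto simp: divide_le_eq_1)

lemma move_agree:
  assumes p: "loop_at (top_of_set X) x p" and eq: "\<And>t. t \<in> {0..1} \<Longrightarrow> q t = p t"
  shows "move e X x p q"
proof -
  have "path_homotopic (top_of_set X) p q"
    using p eq by (intro path_homotopic_eq) (auto simp: loop_at_def)
  then have "loop_at (top_of_set X) x q" using p path_homotopicD[of "top_of_set X" p q] by (simp add: loop_at_def)
  \<comment> \<open>Reversed endpoints give an empty interval, so the move is trivial for every
    \<open>e\<close>.\<close>
  moreover have "move_on e (real 1 / real 1) (real 0 / real 1) p q" using eq by (auto simp: move_on_def)
  ultimately show ?thesis using moveI[OF p] by blast
qed

lemma move_join_left:
  assumes "move e X x p p'" and q: "loop_at (top_of_set X) x q"
  shows "move e X x (p +++ q) (p' +++ q)"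
proof -
  obtain n i j :: nat where m: "loop_at (top_of_set X) x p" "loop_at (top_of_set X) x p'"
    "0 \<le> real i / n" "j \<le> n" "real j / n \<le> 1" "move_on e (real i / real n) (real j / real n) p p'"
    using moveE[OF assms(1)] .
  define a b where "a = real i / n" and "b = real j / n"
  have ab: "real i / real (2 * n) = a / 2" "real j / real (2 * n) = b / 2"
    by (auto simp: a_def b_def)
  have "move_on e (a / 2) (b / 2) (p +++ q) (p' +++ q)"
    using m(3,5,6) unfolding move_on_def a_def[symmetric] b_def[symmetric] by (auto simp: joinpaths_def)
  then have "move_on e (real i / real (2 * n)) (real j / real (2 * n)) (p +++ q) (p' +++ q)"
    unfolding ab .
  then show ?thesis
    by (rule moveI[OF loop_at_join[OF m(1) q] loop_at_join[OF m(2) q], rotated]) (use m(4) in simp)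
qed

lemma move_join_right:
  assumes "move e X x q q'" and p: "loop_at (top_of_set X) x p"
  shows "move e X x (p +++ q) (p +++ q')"
proof -
  obtain n i j :: nat where m: "loop_at (top_of_set X) x q" "loop_at (top_of_set X) x q'"
    "0 \<le> real i / n" "j \<le> n" "real j / n \<le> 1" "move_on e (real i / real n) (real j / real n) q q'"
    using moveE[OF assms(1)] .
  show ?thesis
  \<comment> \<open>For \<open>n = 0\<close> both quotients are \<open>0\<close> and the move is
    trivial, but the shifted fractions below would be wrong.\<close>
  proof (cases "n = 0")
    case True
    then have "q t = q' t" if "t \<in> {0..1}" for t
      using m(6) that by (auto simp: move_on_def)
    then have "(p +++ q') t = (p +++ q) t" if "t \<in> {0..1}" for t
      using that by (auto simp: joinpaths_def)
    then show ?thesis by (rule move_agree[OF loop_at_join[OF p m(1)]])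
  next
    case False
    define a b where "a = real i / n" and "b = real j / n"
    have ab: "real (i + n) / real (2 * n) = (a + 1) / 2" "real (j + n) / real (2 * n) = (b + 1) / 2"
      using False by (auto simp: a_def b_def field_simps)
    have right: "(p +++ r) t = r (2 * t - 1)" if "1/2 \<le> t" "r 0 = x" for r t
    proof -
      have "2 * t - 1 = 0" "2 * t = 1" if "t \<le> 1/2" using that \<open>1/2 \<le> t\<close> by auto
      then show ?thesis using that(2) loop_at_top_of_setD(4)[OF p] by (auto simp: joinpaths_def)
    qed
    have q0: "q 0 = x" "q' 0 = x" using loop_at_top_of_setD(3) m by auto
    have "move_on e ((a + 1) / 2) ((b + 1) / 2) (p +++ q) (p +++ q')"
      unfolding move_on_def
    proof (intro conjI ballI)
      fix t assume t: "t \<in> {0..1} \<inter> ({..(a + 1) / 2} \<union> {(b + 1) / 2..})"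
      show "(p +++ q) t = (p +++ q') t"
      proof (cases "t \<le> 1/2")
        case False
        then have "2 * t - 1 \<in> {0..1} \<inter> ({..a} \<union> {b..})" using t by auto
        then show ?thesis
          using m(6) False q0 unfolding move_on_def a_def[symmetric] b_def[symmetric] by (simp add: right)
      qed (simp add: joinpaths_def)
    next
      fix s t assume "s \<in> {0..1} \<inter> {(a + 1) / 2..(b + 1) / 2}" "t \<in> {0..1} \<inter> {(a + 1) / 2..(b + 1) / 2}"
      then have st: "2 * s - 1 \<in> {0..1} \<inter> {a..b}" "2 * t - 1 \<in> {0..1} \<inter> {a..b}" "1/2 \<le> s" "1/2 \<le> t"
        using m(3) by (auto simp: a_def[symmetric])
      then show "dist ((p +++ q) s) ((p +++ q) t) \<le> e" "dist ((p +++ q') s) ((p +++ q') t) \<le> e"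
        using m(6) q0 unfolding move_on_def a_def[symmetric] b_def[symmetric] by (simp_all add: right)
    qed
    then have "move_on e (real (i + n) / real (2 * n)) (real (j + n) / real (2 * n)) (p +++ q) (p +++ q')"
      unfolding ab .
    then show ?thesis
      by (rule moveI[OF loop_at_join[OF p m(1)] loop_at_join[OF p m(2)], rotated]) (use m(4) in simp)
  qed
qed

text \<open>The square is swept cell by cell. In row \<open>j\<close> the path \<open>r j i\<close>
  has already risen to the next level on the left and is still on the old level on the right;
  passing to \<open>Suc i\<close> shifts the ramp by one column, which changes the loop only on a
  short interval.\<close>

lemma moves_homotopic:
  assumes e: "e > 0" and pq: "path_homotopic (top_of_set X) p q" and p: "loop_at (top_of_set X) x p"
  shows "(move e X x)\<^sup>*\<^sup>* p q"
proof -
  let ?Q = "{0..1::real} \<times> {0..1::real}"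
  have px: "pathstart p = x" "pathfinish p = x" using p by (auto simp: loop_at_def)
  obtain h where h: "continuous_map (top_of_set ?Q) (top_of_set X) h" "\<And>t. h (0,t) = p t" "\<And>t. h (1,t) = q t"
    and sides: "\<And>s. s \<in> {0..1} \<Longrightarrow> h (s,0) = x \<and> h (s,1) = x"
    using pq px unfolding path_homotopic_def homotopic_with_def
    by (auto simp: pathstart_def pathfinish_def)
  have "uniformly_continuous_on ?Q h"
    using h(1) by (intro compact_uniformly_continuous compact_Times) auto
  then obtain d where d: "d > 0" "\<And>z w. z \<in> ?Q \<Longrightarrow> w \<in> ?Q \<Longrightarrow> dist z w < d \<Longrightarrow> dist (h z) (h w) < e"
    unfolding uniformly_continuous_on_def using e by metis
  \<comment> \<open>A step affects at most two columns within one row, hence points of the square at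
    distance at most \<open>3 / n\<close>.\<close>
  obtain n :: nat where n: "inverse (real n) < d / 3" "n \<noteq> 0"
    using ex_inverse_of_nat_less[of "d / 3"] d(1) by auto
  have n0: "real n > 0" using n by simp
  \<comment> \<open>The ramp is \<open>1\<close> up to \<open>(i - 1) / n\<close> and
    \<open>0\<close> from \<open>i / n\<close> on. Thus \<open>r j 0\<close> is level
    \<open>j\<close>, and \<open>r j (Suc n)\<close> is level \<open>Suc j\<close>; at index
    \<open>n\<close> the ramp would still end at time \<open>1\<close>.\<close>
  define c where "c i t = max 0 (min 1 (real i - real n * t))" for i :: nat and t :: real
  define \<sigma> where "\<sigma> j i t = (real j + c i t) / n" for j i :: nat and t :: real
  define r where "r j i t = h (\<sigma> j i t, t)" for j i :: nat and t :: real
  have c01: "0 \<le> c i t" "c i t \<le> 1" for i t by (auto simp: c_def)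
  have \<sigma>01: "\<sigma> j i t \<in> {0..1}" if "j < n" for j i t
  proof -
    have "real j + 1 \<le> n" using that by linarith
    then have "real j + c i t \<le> n" using c01[of i t] by linarith
    then show ?thesis using c01[of i t] n0 by (simp add: \<sigma>_def)
  qed
  have \<sigma>_close: "\<bar>\<sigma> j i t - \<sigma> j k s\<bar> \<le> inverse (real n)" for j i k t s
  proof -
    have "\<bar>c i t - c k s\<bar> \<le> 1" using c01[of i t] c01[of k s] by linarith
    moreover have "\<sigma> j i t - \<sigma> j k s = (c i t - c k s) / n"
      by (simp add: \<sigma>_def add_divide_distrib diff_divide_distrib)
    ultimately show ?thesis using n0 by (simp add: divide_simps)
  qed
  have loop: "loop_at (top_of_set X) x (r j i)" if "j < n" for j i
  proof -
    have "continuous_on {0..1} (\<sigma> j i)"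
      unfolding \<sigma>_def[abs_def] c_def by (intro continuous_intros) (use n(2) in simp)
    then have "continuous_map unit_interval (top_of_set ?Q) (\<lambda>t. (\<sigma> j i t, t))"
      using \<sigma>01[OF that] by (auto intro!: continuous_intros)
    from continuous_map_compose[OF this h(1)] have "pathin (top_of_set X) (r j i)"
      unfolding pathin_def r_def[abs_def] by (simp add: o_def)
    then show ?thesis
      using sides \<sigma>01[OF that] by (simp add: loop_at_def r_def pathstart_def pathfinish_def)
  qed
  have step: "move e X x (r j i) (r j (Suc i))" if "j < n" "i \<le> n" for j i
  proof -
    \<comment> \<open>Truncated subtraction and \<open>min\<close> clip the two affected columns to
      the unit interval at \<open>i = 0\<close> and \<open>i = n\<close>.\<close>
    let ?a = "real (i - 1) / real n" and ?b = "real (min n (Suc i)) / real n"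
    have "move_on e ?a ?b (r j i) (r j (Suc i))"
      unfolding move_on_def
    proof (intro conjI ballI)
      fix t assume t: "t \<in> {0..1} \<inter> ({..?a} \<union> {?b..})"
      consider "t = 0" | "t = 1" | "0 < t" "t \<le> ?a" | "t < 1" "?b \<le> t" using t by fastforce
      then show "r j i t = r j (Suc i) t"
      proof cases
        case 3
        then have "real n * t \<le> real (i - 1)" "0 < real n * t" using n0 by (auto simp: field_simps)
        then have "real n * t \<le> real i - 1" by (cases i) auto
        then have "c i t = 1" "c (Suc i) t = 1" by (auto simp: c_def)
        then show ?thesis by (simp add: r_def \<sigma>_def)
      next
        case 4
        then have le: "real (min n (Suc i)) \<le> real n * t" "real n * t < n" using n0 by (auto simp: field_simps)
        then have "real (Suc i) \<le> real n * t" by (auto simp: min_def split: if_splits)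
        then have "c i t = 0" "c (Suc i) t = 0" by (auto simp: c_def)
        then show ?thesis by (simp add: r_def \<sigma>_def)
      qed (use sides \<sigma>01[OF that(1)] in \<open>auto simp: r_def\<close>)
    next
      fix s t assume st: "s \<in> {0..1} \<inter> {?a..?b}" "t \<in> {0..1} \<inter> {?a..?b}"
      have "real (min n (Suc i)) - real (i - 1) \<le> 2" by (cases i) auto
      then have "?b - ?a \<le> 2 / n" using n0 by (simp add: divide_right_mono flip: diff_divide_distrib)
      then have 1: "\<bar>s - t\<bar> \<le> 2 * inverse (real n)" using st by (auto simp: inverse_eq_divide)
      have "dist (r j k s) (r j k t) \<le> e" for k
      proof -
        have "dist (\<sigma> j k s, s) (\<sigma> j k t, t) \<le> \<bar>\<sigma> j k s - \<sigma> j k t\<bar> + \<bar>s - t\<bar>"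
          unfolding dist_Pair_Pair dist_real_def by (rule sqrt_sum_squares_le_sum) auto
        also have "\<dots> \<le> 3 * inverse (real n)" using 1 \<sigma>_close[of j k s k t] by linarith
        also have "\<dots> < d" using n(1) by simp
        finally have "dist (\<sigma> j k s, s) (\<sigma> j k t, t) < d" .
        moreover have "(\<sigma> j k s, s) \<in> ?Q" "(\<sigma> j k t, t) \<in> ?Q" using st \<sigma>01[OF that(1)] by blast+
        ultimately show ?thesis unfolding r_def using d(2) by (meson less_imp_le)
      qed
      then show "dist (r j i s) (r j i t) \<le> e" "dist (r j (Suc i) s) (r j (Suc i) t) \<le> e" by auto
    qed
    then show ?thesis
      using loop[OF that(1)] by (intro moveI[of X x _ _ "min n (Suc i)" n e "i - 1"]) simp_all
  qed
  have row: "(move e X x)\<^sup>*\<^sup>* (r j 0) (r j i)" if "j < n" "i \<le> Suc n" for j i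
    using that(2)
  proof (induction i)
    case (Suc i)
    then show ?case using step[OF that(1), of i] by (auto intro: rtranclp.rtrancl_into_rtrancl)
  qed simp
  have c0: "c 0 t = 0" "c (Suc n) t = 1" if "t \<in> {0..1}" for t
  proof -
    have "real n * t \<le> real n" "0 \<le> real n * t" using that n0 by (auto simp: mult_left_le)
    then show "c 0 t = 0" "c (Suc n) t = 1" by (auto simp: c_def)
  qed
  have rows: "(move e X x)\<^sup>*\<^sup>* p (r j 0)" if "j < n" for j
    using that
  proof (induction j)
    case 0
    have "move e X x p (r 0 0)"
      by (rule move_agree[OF p]) (simp add: r_def \<sigma>_def c0 h)
    then show ?case by blast
  next
    case (Suc j)
    have "move e X x (r j (Suc n)) (r (Suc j) 0)"
      by (rule move_agree[OF loop]) (use Suc.prems in \<open>simp_all add: r_def \<sigma>_def c0 add.commute\<close>)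
    moreover have "(move e X x)\<^sup>*\<^sup>* p (r j (Suc n))"
      using Suc row[of j "Suc n"] by (auto intro: rtranclp_trans)
    ultimately show ?case by (auto intro: rtranclp.rtrancl_into_rtrancl)
  qed
  have nn: "n - 1 < n" using n(2) by simp
  have "move e X x (r (n - 1) (Suc n)) q"
    by (rule move_agree[OF loop[OF nn]]) (use n in \<open>simp add: r_def \<sigma>_def c0 h\<close>)
  moreover have "(move e X x)\<^sup>*\<^sup>* p (r (n - 1) (Suc n))"
    using rows[OF nn] row[OF nn, of "Suc n"] by (auto intro: rtranclp_trans)
  ultimately show ?thesis by (auto intro: rtranclp.rtrancl_into_rtrancl)
qed

text \<open>A head inside a ball of radius \<open>e / 2\<close> has diameter at most
  \<open>e\<close>, so a single move makes it constant, and the bare stick then contracts by a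
  homotopy. In a product the factors are contracted one after the other.\<close>

lemma moves_null_of_spanier:
  fixes X :: "'a::metric_space set"
  assumes e: "e > 0" and x: "x \<in> X" and p: "loop_at (top_of_set X) x p"
    and "loop_class (top_of_set X) x p \<in> spanier_group_cover (top_of_set X) x ((\<lambda>z. ball z (e / 2) \<inter> X) ` X)"
  shows "(move e X x)\<^sup>*\<^sup>* p (\<lambda>t. x)"
proof -
  have xT: "x \<in> topspace (top_of_set X)" using x by simp
  from assms(4) p xT show ?thesis
  proof (induction rule: spanier_group_cover_induct)
    case (lollipop r l U)
    then obtain z where U: "path_image l \<subseteq> ball z (e / 2)" by auto
    have l: "pathin (top_of_set X) l" "l 0 = r 1" "l 1 = r 1"
      using lollipop(3) by (auto simp: loop_at_def pathstart_def pathfinish_def)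
    let ?c = "\<lambda>t::real. r 1" and ?T = "top_of_set X"
    have "r 1 \<in> topspace ?T" using pathin_subset[OF lollipop(1), of 1] by simp
    then have c: "loop_at ?T (pathfinish r) ?c"
      by (simp add: loop_at_def) (simp add: pathfinish_def)
    note loops = loop_at_lollipop[OF lollipop(1,2,3)] loop_at_lollipop[OF lollipop(1,2) c]
    have lU: "l t \<in> ball z (e / 2)" if "t \<in> {0..1}" for t
      using U that by (simp add: path_image_def image_subset_iff)
    have mid: "(r +++ l +++ reversepath r) t = l (4 * t - 2)" "(r +++ ?c +++ reversepath r) t = r 1"
      if t34: "t \<in> {1/2..3/4}" for t
    proof -
      have "(r +++ l +++ reversepath r) t = l (4 * t - 2) \<and> (r +++ ?c +++ reversepath r) t = r 1"
      proof (cases "t = 1/2")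
        case True
        show ?thesis unfolding True joinpaths_def using l by simp
      next
        case False
        then have "\<not> t \<le> 1/2" "2 * t - 1 \<le> 1/2" using t34 by auto
        then show ?thesis by (simp add: joinpaths_def)
      qed
      then show "(r +++ l +++ reversepath r) t = l (4 * t - 2)" "(r +++ ?c +++ reversepath r) t = r 1"
        by auto
    qed
    \<comment> \<open>In the right-nested join the head occupies exactly the times from
      \<open>1/2\<close> to \<open>3/4\<close>.\<close>
    have "move_on e (2 / 4) (3 / 4) (r +++ l +++ reversepath r) (r +++ ?c +++ reversepath r)"
      unfolding move_on_def
    proof (intro conjI ballI)
      fix t :: real assume t: "t \<in> {0..1} \<inter> ({..2 / 4} \<union> {3 / 4..})"
      consider "t \<le> 1/2" | "t = 3/4" | "3/4 < t" using t by fastforce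
      then show "(r +++ l +++ reversepath r) t = (r +++ ?c +++ reversepath r) t"
      proof cases
        case 2
        show ?thesis unfolding 2 joinpaths_def using l by simp
      qed (simp_all add: joinpaths_def)
    next
      fix s t :: real assume st: "s \<in> {0..1} \<inter> {2 / 4..3 / 4}" "t \<in> {0..1} \<inter> {2 / 4..3 / 4}"
      then have "dist (l (4 * s - 2)) (l (4 * t - 2)) \<le> e"
        using lU[of "4 * s - 2"] lU[of "4 * t - 2"] dist_triangle3[of "l (4 * s - 2)" "l (4 * t - 2)" z] by auto
      then show "dist ((r +++ l +++ reversepath r) s) ((r +++ l +++ reversepath r) t) \<le> e"
        "dist ((r +++ ?c +++ reversepath r) s) ((r +++ ?c +++ reversepath r) t) \<le> e"
        using st e by (simp_all add: mid)
    qed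
    then have 1: "move e X x (r +++ l +++ reversepath r) (r +++ ?c +++ reversepath r)"
      using loops by (intro moveI[of X x _ _ 3 4 e 2]) simp_all
    have "pathfinish r = r 1" by (simp add: pathfinish_def)
    then have "path_homotopic ?T (r +++ ?c +++ reversepath r) (r +++ reversepath r)"
      using lollipop(1) by (intro path_homotopic_join path_homotopic_lid) auto
    also have "path_homotopic ?T \<dots> (\<lambda>t. x)"
      using lollipop(1,2) by (intro path_homotopic_rinv)
    finally have "(move e X x)\<^sup>*\<^sup>* (r +++ ?c +++ reversepath r) (\<lambda>t. x)"
      by (rule moves_homotopic[OF e _ loops(2)])
    with 1 show ?case by (rule converse_rtranclp_into_rtranclp)
  next
    case (join p q)
    have "(move e X x)\<^sup>*\<^sup>* (p +++ q) (p' +++ q)" if "(move e X x)\<^sup>*\<^sup>* p p'" for p'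
      using that
    proof induction
      case (step y z)
      then show ?case using move_join_left[OF step(2) join(2)] by (auto intro: rtranclp.rtrancl_into_rtrancl)
    qed simp
    from this[OF join(3)] have 1: "(move e X x)\<^sup>*\<^sup>* (p +++ q) ((\<lambda>t. x) +++ q)" .
    have "(move e X x)\<^sup>*\<^sup>* ((\<lambda>t. x) +++ q) ((\<lambda>t. x) +++ q')" if "(move e X x)\<^sup>*\<^sup>* q q'" for q'
      using that
    proof induction
      case (step y z)
      then show ?case using move_join_right[OF step(2) loop_at_const[OF xT]] by (auto intro: rtranclp.rtrancl_into_rtrancl)
    qed simp
    from this[OF join(4)] have 2: "(move e X x)\<^sup>*\<^sup>* ((\<lambda>t. x) +++ q) ((\<lambda>t. x) +++ (\<lambda>t. x))" .
    have "(\<lambda>t. x) +++ (\<lambda>t. x) = (\<lambda>t. x)" by (simp add: joinpaths_def fun_eq_iff)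
    then show ?case using rtranclp_trans[OF 1 2] by simp
  next
    case (homotopic p q)
    then show ?case
      using moves_homotopic[OF e path_homotopic_sym[OF homotopic(3)] homotopic(2)] by (auto intro: rtranclp_trans)
  qed simp
qed

text \<open>Cutting at \<open>a\<close> and \<open>b\<close>, the outer pieces agree, and the middle
  ones share their endpoints and lie in one ball. The strict \<open>e < d\<close> is needed since
  moves bound distances by \<open>\<le>\<close> while balls are open.\<close>

lemma holonomy_move:
  fixes X :: "'a::metric_space set"
  assumes "pointed_space (top_of_set X) x"
    and leb: "\<And>z. z \<in> X \<Longrightarrow> \<exists>U\<in>\<U>. ball z d \<inter> X \<subseteq> U" "e < d" and m: "move e X x p q"
  shows "holonomy (top_of_set X) x \<U> p = holonomy (top_of_set X) x \<U> q"
proof -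
  let ?T = "top_of_set X"
  interpret pointed_space ?T x by fact
  let ?hol = "holonomy ?T x \<U>" and ?K = "holonomy_group ?T x \<U>"
  obtain n i j :: nat where m: "loop_at ?T x p" "loop_at ?T x q" "0 \<le> real i / n" "j \<le> n" "real j / n \<le> 1"
    "move_on e (real i / real n) (real j / real n) p q"
    using moveE[OF m] .
  define a b where "a = real i / n" and "b = real j / n"
  have a: "0 \<le> a" and b: "b \<le> 1" using m by (auto simp: a_def b_def)
  have out: "p t = q t" if "t \<in> {0..1}" "t \<le> a \<or> b \<le> t" for t
    using m(6) that unfolding move_on_def a_def[symmetric] b_def[symmetric] by auto
  have pT: "pathin ?T p" "pathin ?T q" using m by (auto simp: loop_at_def)
  show ?thesis
  proof (cases "a \<le> b")
    case False
    then have "path_homotopic ?T p q" using out pT by (intro path_homotopic_eq) force+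
    then show ?thesis by (rule holonomy_homotopic)
  next
    case True
    then have ab: "a \<in> {0..1}" "b \<in> {0..1}" using a b by auto
    have split: "?hol r = ?hol (segpath 0 a r) \<otimes>\<^bsub>?K\<^esub> (?hol (segpath a b r) \<otimes>\<^bsub>?K\<^esub> ?hol (segpath b 1 r))"
      if r: "pathin ?T r" for r
    proof -
      have "?hol r = ?hol (segpath 0 a r +++ segpath a 1 r)"
        using holonomy_homotopic[OF path_homotopic_sym[OF path_homotopic_segpaths[OF r, of 0 a 1]]] ab
        by (simp add: segpath_full)
      also have "\<dots> = ?hol (segpath 0 a r) \<otimes>\<^bsub>?K\<^esub> ?hol (segpath a 1 r)"
        using r ab by (intro holonomy_join) auto
      also have "?hol (segpath a 1 r) = ?hol (segpath a b r +++ segpath b 1 r)"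
        using holonomy_homotopic[OF path_homotopic_sym[OF path_homotopic_segpaths[OF r, of a b 1]]] ab
        by simp
      also have "\<dots> = ?hol (segpath a b r) \<otimes>\<^bsub>?K\<^esub> ?hol (segpath b 1 r)"
        using r ab by (intro holonomy_join) auto
      finally show ?thesis .
    qed
    have same: "?hol (segpath u v p) = ?hol (segpath u v q)"
      if "u \<in> {0..1}" "v \<in> {0..1}" "u \<le> v" "\<And>t. t \<in> {u..v} \<Longrightarrow> p t = q t" for u v
    proof -
      have "linepath u v t \<in> {u..v}" if "t \<in> {0..1}" for t
        using linepath_in_path[OF that, of u v] \<open>u \<le> v\<close> by (simp add: closed_segment_eq_real_ivl)
      then have "path_homotopic ?T (segpath u v p) (segpath u v q)"
        using that pT by (intro path_homotopic_eq pathin_segpath) (auto simp: segpath_def)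
      then show ?thesis by (rule holonomy_homotopic)
    qed
    have "p a \<in> X" using pathin_subset[OF pT(1) ab(1)] by simp
    then obtain U where U: "U \<in> \<U>" "ball (p a) d \<inter> X \<subseteq> U" using leb(1) by blast
    have "p t \<in> U \<and> q t \<in> U" if t: "t \<in> {a..b}" for t
    proof -
      have t01: "t \<in> {0..1}" using t ab by auto
      have "dist (p a) (p t) \<le> e" "dist (q a) (q t) \<le> e"
      proof -
        have "a \<in> {0..1} \<inter> {a..b}" "t \<in> {0..1} \<inter> {a..b}" using t t01 ab True by auto
        then show "dist (p a) (p t) \<le> e" "dist (q a) (q t) \<le> e"
          using m(6) unfolding move_on_def a_def[symmetric] b_def[symmetric] by blast+
      qed
      moreover have "p a = q a" using out[of a] ab by simp
      moreover have "p t \<in> X" "q t \<in> X" using pathin_subset[OF pT(1) t01] pathin_subset[OF pT(2) t01] by auto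
      ultimately show ?thesis using U(2) leb(2) by auto
    qed
    then have "?hol (segpath a b p) = ?hol (segpath a b q)"
      using pT ab out[of a] out[of b] True U(1)
      by (intro holonomy_eq[of _ _ U]) (auto simp: path_image_segpath)
    then show ?thesis
      unfolding split[OF pT(1)] split[OF pT(2)] using same[of 0 a] same[of b 1] out ab by auto
  qed
qed


section \<open>Analyticity for compact spaces\<close>

lemma closedin_Collect_Ball:
  assumes "\<And>i. i \<in> I \<Longrightarrow> closedin T {z \<in> topspace T. P i z}"
  shows "closedin T {z \<in> topspace T. \<forall>i\<in>I. P i z}"
proof (cases "I = {}")
  case False
  then have eq: "{z \<in> topspace T. \<forall>i\<in>I. P i z} = (\<Inter>i\<in>I. {z \<in> topspace T. P i z})" by auto
  show ?thesis unfolding eq by (rule closedin_INT[OF False assms])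
qed simp

text \<open>Evaluation at a fixed time is continuous on loops, so each instance is a closed
  condition; quantifying over times only intersects closed sets.\<close>

lemma closedin_move_on:
  fixes X :: "'a::metric_space set" and x :: 'a
  defines "L \<equiv> mtopology_of (loop_metric X x)"
  shows "closedin (prod_topology L L) {z \<in> topspace (prod_topology L L). move_on e a b (fst z) (snd z)}"
proof -
  let ?Q = "prod_topology L L"
  have ev: "continuous_map ?Q euclidean (\<lambda>z. fst z t)" "continuous_map ?Q euclidean (\<lambda>z. snd z t)"
    if "t \<in> {0..1}" for t
    using continuous_map_compose[OF continuous_map_fst continuous_map_loop_evaluation[OF that, of X x]]
      continuous_map_compose[OF continuous_map_snd continuous_map_loop_evaluation[OF that, of X x]]
    unfolding L_def by (simp_all add: o_def)
  have dist_le: "closedin ?Q {z \<in> topspace ?Q. dist (f z) (g z) \<le> e}"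
    if "continuous_map ?Q euclidean f" "continuous_map ?Q euclidean g" for f g :: "_ \<Rightarrow> 'a"
  proof -
    have "continuous_map ?Q (prod_topology euclidean euclidean) (\<lambda>z. (f z, g z))"
      using that by (rule continuous_map_pairedI)
    moreover have "continuous_map (prod_topology euclidean euclidean) euclideanreal (\<lambda>(y, z :: 'a). dist y z)"
      by (auto simp: case_prod_unfold intro!: continuous_intros)
    ultimately have "continuous_map ?Q euclideanreal ((\<lambda>(y, z). dist y z) \<circ> (\<lambda>z. (f z, g z)))"
      by (rule continuous_map_compose)
    then have "continuous_map ?Q euclideanreal (\<lambda>z. dist (f z) (g z))" by (simp add: o_def)
    from closedin_continuous_map_preimage[OF this, of "{..e}"] show ?thesis by simp
  qed
  have "closedin ?Q {z \<in> topspace ?Q. \<forall>t\<in>{0..1} \<inter> ({..a} \<union> {b..}). fst z t = snd z t}"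
    by (intro closedin_Collect_Ball closedin_continuous_maps_eq[of euclidean]) (auto intro: ev)
  moreover have "closedin ?Q {z \<in> topspace ?Q. \<forall>s\<in>{0..1} \<inter> {a..b}. \<forall>t\<in>{0..1} \<inter> {a..b}.
      dist (fst z s) (fst z t) \<le> e}"
    by (intro closedin_Collect_Ball dist_le) (auto intro: ev)
  moreover have "closedin ?Q {z \<in> topspace ?Q. \<forall>s\<in>{0..1} \<inter> {a..b}. \<forall>t\<in>{0..1} \<inter> {a..b}.
      dist (snd z s) (snd z t) \<le> e}"
    by (intro closedin_Collect_Ball dist_le) (auto intro: ev)
  ultimately have "closedin ?Q ({z \<in> topspace ?Q. \<forall>t\<in>{0..1} \<inter> ({..a} \<union> {b..}). fst z t = snd z t} \<inter>
      ({z \<in> topspace ?Q. \<forall>s\<in>{0..1} \<inter> {a..b}. \<forall>t\<in>{0..1} \<inter> {a..b}. dist (fst z s) (fst z t) \<le> e} \<inter>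
      {z \<in> topspace ?Q. \<forall>s\<in>{0..1} \<inter> {a..b}. \<forall>t\<in>{0..1} \<inter> {a..b}. dist (snd z s) (snd z t) \<le> e}))"
    by (intro closedin_Int)
  then show ?thesis
    by (rule back_subst[of "closedin ?Q"]) (auto simp: move_on_def)
qed

text \<open>Grading by the number of moves writes reachability as a countable union in which each
  stage is a preimage of the previous one. Every stage consists of extensional loops, as the loop
  space requires.\<close>

fun reach :: "real \<Rightarrow> 'a::metric_space set \<Rightarrow> 'a \<Rightarrow> nat \<Rightarrow> (real \<Rightarrow> 'a) set" where
  "reach e X x 0 = {restrict (\<lambda>t. x) {0..1}}"
| "reach e X x (Suc m) = {p \<in> loops (top_of_set X) x. \<exists>q\<in>reach e X x m. move e X x p q}"

lemma reach_subset:
  assumes "x \<in> X"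
  shows "reach e X x m \<subseteq> loops (top_of_set X) x"
  using restrict_loop(1)[OF loop_at_const, of x "top_of_set X"] assms by (cases m) auto

lemma analytic_reach:
  fixes X :: "'a::metric_space set"
  assumes X: "compact X" "x \<in> X"
  shows "analytic_in (mtopology_of (loop_metric X x)) (reach e X x m)"
proof (induction m)
  case 0
  let ?L = "mtopology_of (loop_metric X x)"
  have "Hausdorff_space ?L" using Polish_loop_space[OF X(1)] by (rule Polish_Hausdorff)
  then have "closedin ?L (reach e X x 0)"
    using reach_subset[OF X(2), of e 0] closedin_Hausdorff_finite[of ?L "reach e X x 0"]
    unfolding topspace_loop_metric by simp
  then show ?case using Polish_loop_space[OF X(1)] by (rule analytic_in_closedin[rotated])
next
  case (Suc m)
  let ?L = "mtopology_of (loop_metric X x)" and ?loops = "loops (top_of_set X) x"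
  \<comment> \<open>The number \<open>k\<close> codes the triple \<open>(n, i, j)\<close>, and
    \<open>min j n\<close> builds in the restriction \<open>j \<le> n\<close>, so every code yields
    an admissible closed relation.\<close>
  define R where "R k = (case prod_decode k of (n, k') \<Rightarrow> case prod_decode k' of (i, j) \<Rightarrow>
     {z \<in> topspace (prod_topology ?L ?L). move_on e (real i / real n) (real (min j n) / real n) (fst z) (snd z)})" for k
  have "closedin (prod_topology ?L ?L) (R k)" for k
    by (simp only: R_def case_prod_unfold) (rule closedin_move_on)
  then have "analytic_in ?L {p. \<exists>q\<in>reach e X x m. (p, q) \<in> R k}" for k
    by (rule analytic_in_relation_preimage[OF Polish_loop_space[OF X(1)] _ Suc.IH])
  then have analytic: "analytic_in ?L (\<Union>k. {p. \<exists>q\<in>reach e X x m. (p, q) \<in> R k})"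
    by (rule analytic_in_UN)
  have rel: "(\<exists>k. (p, q) \<in> R k) \<longleftrightarrow> p \<in> ?loops \<and> q \<in> ?loops \<and> move e X x p q" for p q
  proof
    assume "\<exists>k. (p, q) \<in> R k"
    then obtain n i j where "p \<in> ?loops" "q \<in> ?loops" "move_on e (real i / real n) (real (min j n) / real n) p q"
      by (auto simp: R_def mspace_loop_metric case_prod_unfold)
    then show "p \<in> ?loops \<and> q \<in> ?loops \<and> move e X x p q"
      using loop_at_loops moveI[of X x p q "min j n" n e i] by auto
  next
    assume pq: "p \<in> ?loops \<and> q \<in> ?loops \<and> move e X x p q"
    then obtain n i j where "j \<le> n" "move_on e (real i / real n) (real j / real n) p q"
      by (auto simp: move_def)
    then have "(p, q) \<in> R (prod_encode (n, prod_encode (i, j)))"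
      using pq by (simp add: R_def mspace_loop_metric min_absorb1)
    then show "\<exists>k. (p, q) \<in> R k" ..
  qed
  have "(\<Union>k. {p. \<exists>q\<in>reach e X x m. (p, q) \<in> R k}) = {p. \<exists>q\<in>reach e X x m. \<exists>k. (p, q) \<in> R k}"
    by blast
  also have "\<dots> = reach e X x (Suc m)"
    unfolding rel using reach_subset[OF X(2), of e m] by auto
  finally show ?case using analytic by simp
qed

lemma move_on_restrict:
  "move_on e a b (restrict p {0..1}) (restrict q {0..1}) \<longleftrightarrow> move_on e a b p q"
  unfolding move_on_def by (intro arg_cong2[where f = "(\<and>)"] ball_cong refl) auto

text \<open>Moves only see values on \<open>{0..1}\<close>, so a chain through arbitrary
  representatives restricts to a chain of extensional loops.\<close>

lemma reach_of_moves:
  assumes x: "x \<in> X" and "(move e X x)\<^sup>*\<^sup>* p (\<lambda>t. x)" "loop_at (top_of_set X) x p"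
  shows "\<exists>m. restrict p {0..1} \<in> reach e X x m"
  using assms(2,3)
proof (induction rule: converse_rtranclp_induct)
  case base
  have "restrict (\<lambda>t. x) {0..1} \<in> reach e X x 0" by simp
  then show ?case by blast
next
  case (step p q)
  have q: "loop_at (top_of_set X) x q" using step(1) by (simp add: move_def)
  then obtain m where m: "restrict q {0..1} \<in> reach e X x m" using step by blast
  obtain n i j where "j \<le> n" "move_on e (real i / real n) (real j / real n) p q"
    using step(1) by (auto simp: move_def)
  then have "move_on e (real i / real n) (real j / real n) (restrict p {0..1}) (restrict q {0..1})"
    by (simp only: move_on_restrict)
  then have "move e X x (restrict p {0..1}) (restrict q {0..1})"
    using \<open>j \<le> n\<close> restrict_loop(1)[OF step.prems] restrict_loop(1)[OF q] loop_at_loops by (intro moveI)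
  then have "restrict p {0..1} \<in> reach e X x (Suc m)"
    using m restrict_loop(1)[OF step.prems] by auto
  then show ?case by blast
qed

lemma holonomy_reach:
  fixes X :: "'a::metric_space set"
  assumes ps: "pointed_space (top_of_set X) x"
    and leb: "\<And>z. z \<in> X \<Longrightarrow> \<exists>U\<in>\<U>. ball z d \<inter> X \<subseteq> U" "0 < d" "e < d" and p: "p \<in> reach e X x m"
  shows "holonomy (top_of_set X) x \<U> p = \<one>\<^bsub>holonomy_group (top_of_set X) x \<U>\<^esub>"
  using p
proof (induction m arbitrary: p)
  case 0
  interpret pointed_space "top_of_set X" x by fact
  have xX: "x \<in> X" using x by simp
  then obtain U where U: "U \<in> \<U>" "ball x d \<inter> X \<subseteq> U" using leb(1) by blast
  then have "x \<in> U" using xX leb(2) by auto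
  have "path_homotopic (top_of_set X) (\<lambda>t. x) p"
    using 0 x by (intro path_homotopic_eq) auto
  from holonomy_homotopic[OF this, of \<U>] show ?case
    using holonomy_loop_in[of "\<lambda>t. x" U \<U>] U(1) \<open>x \<in> U\<close> x by simp
next
  case (Suc m)
  then obtain q where "q \<in> reach e X x m" "move e X x p q" by auto
  then show ?case using Suc.IH holonomy_move[OF ps leb(1,3)] by metis
qed

text \<open>From left to right, the Spanier condition is used only for covers by balls of radius
  half the mesh. Conversely, an arbitrary cover has a Lebesgue number by compactness, and moves of
  any smaller mesh preserve its holonomy.\<close>

lemma Union_spanier_group_eq:
  fixes X :: "'a::metric_space set"
  assumes X: "compact X" "path_connected X" "x \<in> X"
  shows "\<Union>(spanier_group (top_of_set X) x) = (\<Inter>k. \<Union>m. reach (inverse (real (Suc k))) X x m)"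
proof -
  let ?T = "top_of_set X"
  have ps: "pointed_space ?T x" using X pointed_space_top_of_set by blast
  interpret pointed_space ?T x by (rule ps)
  have sp: "A \<in> spanier_group ?T x \<longleftrightarrow> (\<forall>\<U>. open_cover ?T \<U> \<longrightarrow> A \<in> spanier_group_cover ?T x \<U>)" for A
    by (auto simp: spanier_group_def)
  show ?thesis
    unfolding Union_loop_classes[OF spanier_group_subset[OF x]]
  proof (intro equalityI subsetI)
    fix p assume p: "p \<in> {p \<in> loops ?T x. loop_class ?T x p \<in> spanier_group ?T x}"
    then have lp: "loop_at ?T x p" "restrict p {0..1} = p" using loop_at_loops by (auto simp: loops_def extensional_restrict)
    have "\<exists>m. p \<in> reach (inverse (real (Suc k))) X x m" for k
    proof -
      let ?e = "inverse (real (Suc k))"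
      have e: "?e > 0" by simp
      have "openin ?T (ball z (?e / 2) \<inter> X)" for z
        by (metis inf_commute open_ball openin_open_Int)
      moreover have "z \<in> ball z (?e / 2)" for z using e by simp
      ultimately have "open_cover ?T ((\<lambda>z. ball z (?e / 2) \<inter> X) ` X)"
        unfolding open_cover_def topspace_euclidean_subtopology by blast
      then have "loop_class ?T x p \<in> spanier_group_cover ?T x ((\<lambda>z. ball z (?e / 2) \<inter> X) ` X)"
        using p sp by blast
      from reach_of_moves[OF X(3) moves_null_of_spanier[OF e X(3) lp(1) this] lp(1)]
      show ?thesis unfolding lp(2) .
    qed
    then show "p \<in> (\<Inter>k. \<Union>m. reach (inverse (real (Suc k))) X x m)" by blast
  next
    fix p assume p: "p \<in> (\<Inter>k. \<Union>m. reach (inverse (real (Suc k))) X x m)"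
    then have pl: "p \<in> loops ?T x" using reach_subset[OF X(3)] by blast
    have "loop_class ?T x p \<in> spanier_group_cover ?T x \<U>" if \<U>: "open_cover ?T \<U>" for \<U>
    proof -
      let ?\<G> = "{G. open G \<and> (\<exists>U\<in>\<U>. G \<inter> X \<subseteq> U)}"
      obtain d where d: "d > 0" "\<And>z. z \<in> X \<Longrightarrow> \<exists>G\<in>?\<G>. ball z d \<subseteq> G"
      proof (rule Heine_Borel_lemma[OF X(1)])
        show "X \<subseteq> \<Union>?\<G>"
        proof
          fix z assume "z \<in> X"
          then obtain U where "U \<in> \<U>" "z \<in> U" "openin ?T U" using \<U> unfolding open_cover_def by fastforce
          then show "z \<in> \<Union>?\<G>" unfolding openin_open by blast
        qed
      qed blast+
      have leb: "\<exists>U\<in>\<U>. ball z d \<inter> X \<subseteq> U" if z: "z \<in> X" for z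
      proof -
        obtain G where G: "\<exists>U\<in>\<U>. G \<inter> X \<subseteq> U" "ball z d \<subseteq> G" using d(2)[OF z] by blast
        from G(1) obtain U where "U \<in> \<U>" "G \<inter> X \<subseteq> U" ..
        then show ?thesis using G(2) by (intro bexI[of _ U]) auto
      qed
      obtain k where k: "inverse (real (Suc k)) < d" using reals_Archimedean[OF d(1)] by blast
      obtain m where "p \<in> reach (inverse (real (Suc k))) X x m" using p by blast
      from holonomy_reach[OF ps leb d(1) k this] show ?thesis
        using holonomy_eq_one_iff[OF loop_at_loops[OF pl]] by blast
    qed
    then show "p \<in> {p \<in> loops ?T x. loop_class ?T x p \<in> spanier_group ?T x}" using sp pl by blast
  qed
qed

lemma analytic_spanier_group:
  fixes X :: "'a::metric_space set"
  assumes X: "compact X" "path_connected X" "x \<in> X"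
  shows "analytic_in_pi1 X x (spanier_group (top_of_set X) x)"
  unfolding analytic_in_pi1_def Union_spanier_group_eq[OF X]
  using Polish_Hausdorff[OF Polish_loop_space[OF X(1)]]
  by (intro analytic_in_INT analytic_in_UN analytic_reach X)


theorem theorem5p4:
  fixes X :: "'a::metric_space set" and x :: 'a
  assumes "path_connected X" and "x \<in> X"
  shows "(locally path_connected X \<longrightarrow>
            spanier_group (top_of_set X) x = shape_kernel (top_of_set X) x \<and>
            closed_in_pi1 X x (spanier_group (top_of_set X) x)) \<and>
         (compact X \<longrightarrow> analytic_in_pi1 X x (spanier_group (top_of_set X) x))"
  using spanier_group_eq_shape_kernel closed_spanier_group analytic_spanier_group assms by blast

end
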